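(* Let $d\ge3$ and consider the microscopic coagulation model (deterministic or random version) described in the context, under Hypothesis A stated there. Let $k\ge1$ be an integer. Then for every nonnegative bounded continuous function $K:(\mathbb R^d)^k\to\mathbb R$, $$\mathbb E_N\int_0^\infty\sum_{i_1,\dots,i_k\in I_{\mathbf q(t)}}K\big(x_{i_1}(t),\dots,x_{i_k}(t)\big)\prod_{r=1}^k\gamma_k\big(m_{i_r}(t)\big)\,dt$$ $$\le\ \mathbb E_N\sum_{i_1,\dots,i_k\in I_{\mathbf q(0)}}\big(\Lambda^{m_{i_1}(0),\dots,m_{i_k}(0)}K\big)\big(x_{i_1}(0),\dots,x_{i_k}(0)\big)\prod_{r=1}^k\gamma_k\big(m_{i_r}(0)\big),$$ where all summations are over distinct indices $i_1,\dots,i_k$, where $\gamma_k(m)=m\,d(m)^{d/2}\phi(m)^{\frac{kd}2-1}$, and where the operator $\Lambda$ is defined by $$\Lambda^{n_1,\dots,n_k}K(y_1,\dots,y_k)=c_0(kd)\int\prod_{r=1}^kd(n_r)^{-d/2}\Big(\frac{|y_1-z_1|^2}{d(n_1)}+\dots+\frac{|y_k-z_k|^2}{d(n_k)}\Big)^{1-\frac{kd}2}K(z_1,\dots,z_k)\,dz_1\cdots dz_k,$$ with $c_0(kd)=(kd-2)^{-1}\omega_{kd}^{-1}$ and $\omega_{kd}$ the surface area of the unit sphere in $\mathbb R^{kd}$.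
   Context: **Notation.** $d$ denotes the dimension; $d(\cdot)$ denotes the diffusion coefficient, a function of mass. **Microscopic model.** Let $d\ge 3$. Let $V:\mathbb R^d\to[0,\infty)$ be Hölder continuous, of compact support, with $\int V=1$. Let $h:\mathbb R^d\times(0,\infty)\to[0,\infty)$, $h_n(x)=h(x,n)$, with $Z=\int_0^\infty\int_{\mathbb R^d}h_n(x)\,dx\,dn\in(0,\infty)$. For each positive integer $N$ let $\epsilon>0$ be given by $N=\epsilon^{2-d}Z$. A configuration $\mathbf q$ is an $\mathbb R^d\times(0,\infty)$-valued function $i\mapsto(x_i,m_i)$ (location, mass) on a finite subset $I_{\mathbf q}$ of a fixed countable set $I$ of labels. Initially: in the deterministic model there are $N$ particles; in the random model there are $\mathcal N$ particles, where $\mathcal N$ is sampled from a law $\gamma_N$ with mean $N$ and variance $o(N^2)$. Given their number, the initial particles are independent with density $h_n(x)/Z$ at $(x,n)$. Then $\mathbf q(t)$ is the Markov process with generator $\mathbb L=\mathbb A_0+\mathbb A_c$ (its randomness independent of the sampling of the initial number), where $\mathbb A_0F(\mathbf q)=\sum_{i\in I_{\mathbf q}}d(m_i)\Delta_{x_i}F$ and $$\mathbb A_cF(\mathbf q)=\sum_{i,j\in I_{\mathbf q}}\epsilon^{-2}V\Big(\frac{x_i-x_j}{\epsilon}\Big)\alpha(m_i,m_j)\Big[\frac{m_i}{m_i+m_j}F(S^1_{i,j}\mathbf q)+\frac{m_j}{m_i+m_j}F(S^2_{i,j}\mathbf q)-F(\mathbf q)\Big].$$ Here $S^1_{i,j}\mathbf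 q$ (resp. $S^2_{i,j}\mathbf q$) is obtained from $\mathbf q$ by removing the indices $i,j$ and adding a new index with value $(x_i,m_i+m_j)$ (resp. $(x_j,m_i+m_j)$). In all sums, distinct index labels take distinct values. $\mathbb E_N$ is the expectation for this process. **Hypothesis A.** (1) $d:(0,\infty)\to(0,\infty)$ is bounded and continuous and there is a uniformly positive continuous $\phi:(0,\infty)\to(0,\infty)$ such that $\phi(\cdot)$ and $\phi(\cdot)d(\cdot)$ are non-increasing. (2) $\alpha:(0,\infty)^2\to(0,\infty)$ is bounded, symmetric, continuous, and $\sup_{n\le L}\sup_m\frac{\alpha(n,m)}{m\,d(m)^{d/2}\phi(m)^{d-1}}<\infty$ for every $L>0$. The function $\phi$ in the claim is the one in (1). *)

theory Defs
  imports "HOL-Probability.Probability"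
begin

subsection \<open>Configurations\<close>

text \<open>
  The type \<open>'i\<close> plays the role of the countable label set and \<open>'a\<close> that of
  Euclidean space; a configuration is a map with finite domain, \<open>dom q\<close> being the
  set of labels in use and \<open>q i = Some (x, m)\<close> giving location and mass.
\<close>

type_synonym ('i, 'a) config = "'i \<rightharpoonup> 'a \<times> real"

definition loc :: "('i, 'a) config \<Rightarrow> 'i \<Rightarrow> 'a" where
  "loc q i = fst (the (q i))"

definition mass :: "('i, 'a) config \<Rightarrow> 'i \<Rightarrow> real" where
  "mass q i = snd (the (q i))"

definition config_set :: "('i, 'a) config set" where
  "config_set = {q. finite (dom q) \<and> (\<forall>i\<in>dom q. mass q i > 0)}"

text \<open>
  The Borel structure of the disjoint union of the spaces of \<open>J\<close>-indexed families of
  particles, over the (countably many) finite label sets \<open>J\<close>.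
\<close>

definition configs :: "('i::countable, 'a::euclidean_space) config measure" where
  "configs = sigma config_set
     {{q \<in> config_set. i \<in> dom q \<and> the (q i) \<in> B} | i B. B \<in> sets borel}"


subsection \<open>The generator\<close>

definition relocate :: "('i, 'a) config \<Rightarrow> ('i \<Rightarrow> 'a) \<Rightarrow> ('i, 'a) config" where
  "relocate q x = (\<lambda>i. map_option (\<lambda>(_, m). (x i, m)) (q i))"

definition pderiv_at :: "'i \<Rightarrow> 'a \<Rightarrow> (('i \<Rightarrow> 'a::euclidean_space) \<Rightarrow> real) \<Rightarrow> ('i \<Rightarrow> 'a) \<Rightarrow> real" where
  "pderiv_at i b f x = deriv (\<lambda>t. f (x(i := x i + t *\<^sub>R b))) 0"

definition C1_locations :: "(('i \<Rightarrow> 'a::euclidean_space) \<Rightarrow> real) \<Rightarrow> bool" where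
  "C1_locations f \<longleftrightarrow> continuous_on UNIV f \<and>
     (\<forall>i. \<forall>b\<in>Basis.
        (\<forall>x. (\<lambda>t::real. f (x(i := x i + t *\<^sub>R b))) differentiable (at 0)) \<and>
        continuous_on UNIV (pderiv_at i b f))"

text \<open>
  Applied below only to functions depending on finitely many coordinates, for which
  continuity in the product topology is continuity in those coordinates.
\<close>

definition C2_locations :: "(('i \<Rightarrow> 'a::euclidean_space) \<Rightarrow> real) \<Rightarrow> bool" where
  "C2_locations f \<longleftrightarrow> C1_locations f \<and> (\<forall>i. \<forall>b\<in>Basis. C1_locations (pderiv_at i b f))"

definition laplacian_at ::
    "'i \<Rightarrow> (('i, 'a::euclidean_space) config \<Rightarrow> real) \<Rightarrow> ('i, 'a) config \<Rightarrow> real" where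
  "laplacian_at i F q =
     (\<Sum>b\<in>Basis. pderiv_at i b (pderiv_at i b (\<lambda>x. F (relocate q x))) (loc q))"

definition diffusion_generator ::
    "(real \<Rightarrow> real) \<Rightarrow> (('i, 'a::euclidean_space) config \<Rightarrow> real) \<Rightarrow> ('i, 'a) config \<Rightarrow> real" where
  "diffusion_generator d F q = (\<Sum>i\<in>dom q. d (mass q i) * laplacian_at i F q)"

text \<open>
  Coagulation of \<open>i\<close> and \<open>j\<close>, the new particle being placed at the location of \<open>i\<close>
  (so the other outcome is obtained by exchanging \<open>i\<close> and \<open>j\<close>). Its label is supplied by
  a choice function \<open>fresh\<close> producing a label outside any given finite set.
\<close>

definition coagulate ::
    "('i set \<Rightarrow> 'i) \<Rightarrow> 'i \<Rightarrow> 'i \<Rightarrow> ('i, 'a) config \<Rightarrow> ('i, 'a) config" where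
  "coagulate fresh i j q =
     (q(i := None, j := None))(fresh (dom q) \<mapsto> (loc q i, mass q i + mass q j))"

definition coagulation_generator ::
    "('i set \<Rightarrow> 'i) \<Rightarrow> real \<Rightarrow> ('a::euclidean_space \<Rightarrow> real) \<Rightarrow> (real \<Rightarrow> real \<Rightarrow> real) \<Rightarrow>
     (('i, 'a) config \<Rightarrow> real) \<Rightarrow> ('i, 'a) config \<Rightarrow> real" where
  "coagulation_generator fresh \<epsilon> V \<alpha> F q =
     (\<Sum>(i, j) \<in> {(i, j). i \<in> dom q \<and> j \<in> dom q \<and> i \<noteq> j}.
        \<epsilon> powr (-2) * V ((loc q i - loc q j) /\<^sub>R \<epsilon>) * \<alpha> (mass q i) (mass q j) *
        (mass q i / (mass q i + mass q j) * F (coagulate fresh i j q)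
         + mass q j / (mass q i + mass q j) * F (coagulate fresh j i q)
         - F q))"

definition generator ::
    "('i set \<Rightarrow> 'i) \<Rightarrow> real \<Rightarrow> (real \<Rightarrow> real) \<Rightarrow> ('a::euclidean_space \<Rightarrow> real) \<Rightarrow>
     (real \<Rightarrow> real \<Rightarrow> real) \<Rightarrow> (('i, 'a) config \<Rightarrow> real) \<Rightarrow> ('i, 'a) config \<Rightarrow> real" where
  "generator fresh \<epsilon> d V \<alpha> F q =
     diffusion_generator d F q + coagulation_generator fresh \<epsilon> V \<alpha> F q"

text \<open>
  The test functions: bounded, twice continuously differentiable in the locations (for fixed
  labels and masses), with bounded image under the generator.
\<close>

definition test_functions ::
    "((('i::countable, 'a::euclidean_space) config \<Rightarrow> real) \<Rightarrow> ('i, 'a) config \<Rightarrow> real) \<Rightarrow>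
     (('i, 'a) config \<Rightarrow> real) set" where
  "test_functions L = {F \<in> borel_measurable configs.
     bounded (F ` config_set) \<and>
     (\<forall>q\<in>config_set. C2_locations (\<lambda>x. F (relocate q x))) \<and>
     bounded (L F ` config_set)}"


subsection \<open>Markov processes with a given generator\<close>

definition transition_semigroup :: "'s measure \<Rightarrow> (real \<Rightarrow> 's \<Rightarrow> 's measure) \<Rightarrow> bool" where
  "transition_semigroup S P \<longleftrightarrow>
     (\<forall>t\<ge>0. P t \<in> S \<rightarrow>\<^sub>M prob_algebra S) \<and>
     (\<forall>x\<in>space S. P 0 x = return S x) \<and>
     (\<forall>s\<ge>0. \<forall>t\<ge>0. \<forall>x\<in>space S. P (s + t) x = P s x \<bind> P t)"

text \<open>
  On \<open>D\<close>, the infinitesimal generator of the semigroup is \<open>L\<close>, the derivative at time 0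
  being taken in the sense of bounded pointwise convergence (Dynkin's weak generator).
\<close>

definition has_generator_on ::
    "'s measure \<Rightarrow> (real \<Rightarrow> 's \<Rightarrow> 's measure) \<Rightarrow> (('s \<Rightarrow> real) \<Rightarrow> 's \<Rightarrow> real) \<Rightarrow>
     ('s \<Rightarrow> real) set \<Rightarrow> bool" where
  "has_generator_on S P L D \<longleftrightarrow> (\<forall>F\<in>D.
     (\<exists>C. \<forall>t>0. \<forall>x\<in>space S. \<bar>((\<integral>y. F y \<partial>P t x) - F x) / t\<bar> \<le> C) \<and>
     (\<forall>x\<in>space S. ((\<lambda>t. ((\<integral>y. F y \<partial>P t x) - F x) / t) \<longlongrightarrow> L F x) (at_right 0)))"

definition natural_filtration ::
    "'w measure \<Rightarrow> 's measure \<Rightarrow> (real \<Rightarrow> 'w \<Rightarrow> 's) \<Rightarrow> real \<Rightarrow> 'w measure" where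
  "natural_filtration M S X s =
     sigma (space M) {X r -` A \<inter> space M | r A. 0 \<le> r \<and> r \<le> s \<and> A \<in> sets S}"

text \<open>
  Joint measurability is the only path regularity imposed; it holds in particular for
  right-continuous paths.
\<close>

definition markov_process ::
    "'w measure \<Rightarrow> 's measure \<Rightarrow> (real \<Rightarrow> 's \<Rightarrow> 's measure) \<Rightarrow> (real \<Rightarrow> 'w \<Rightarrow> 's) \<Rightarrow> bool" where
  "markov_process M S P X \<longleftrightarrow>
     prob_space M \<and>
     (\<lambda>(t, \<omega>). X t \<omega>) \<in> restrict_space borel {0..} \<Otimes>\<^sub>M M \<rightarrow>\<^sub>M S \<and>
     (\<forall>s\<ge>0. \<forall>t\<ge>0. \<forall>A\<in>sets S. AE \<omega> in M.
        real_cond_exp M (natural_filtration M S X s) (indicator (X (s + t) -` A \<inter> space M)) \<omega>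
        = measure (P t (X s \<omega>)) A)"

definition coagulation_process ::
    "('i::countable set \<Rightarrow> 'i) \<Rightarrow> real \<Rightarrow> (real \<Rightarrow> real) \<Rightarrow> ('a::euclidean_space \<Rightarrow> real) \<Rightarrow>
     (real \<Rightarrow> real \<Rightarrow> real) \<Rightarrow> 'w measure \<Rightarrow> (real \<Rightarrow> 'w \<Rightarrow> ('i, 'a) config) \<Rightarrow> bool" where
  "coagulation_process fresh \<epsilon> d V \<alpha> M q \<longleftrightarrow>
     (\<exists>P. transition_semigroup configs P \<and>
          has_generator_on configs P (generator fresh \<epsilon> d V \<alpha>)
            (test_functions (generator fresh \<epsilon> d V \<alpha>)) \<and>
          markov_process M configs P q)"


subsection \<open>Initial condition\<close>

text \<open>
  If \<open>n\<close> particles are present initially, they carry the labels in the set \<open>lab n\<close>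
  (any \<open>n\<close>-element set).
\<close>

definition initial_law ::
    "(nat \<Rightarrow> 'i::countable set) \<Rightarrow> ('a::euclidean_space \<Rightarrow> real \<Rightarrow> real) \<Rightarrow> real \<Rightarrow> nat pmf \<Rightarrow>
     ('i, 'a) config measure" where
  "initial_law lab h Z \<nu> = measure_pmf \<nu> \<bind> (\<lambda>n.
     distr (\<Pi>\<^sub>M i\<in>lab n. density (restrict_space lborel (UNIV \<times> {0<..}))
                                (\<lambda>(x, m). ennreal (h x m / Z)))
           configs (\<lambda>f i. if i \<in> lab n then Some (f i) else None))"

definition deterministic_number :: "(nat \<Rightarrow> nat pmf) \<Rightarrow> bool" where
  "deterministic_number \<nu> \<longleftrightarrow> (\<forall>N\<ge>1. \<nu> N = return_pmf N)"

definition random_number :: "(nat \<Rightarrow> nat pmf) \<Rightarrow> bool" where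
  "random_number \<nu> \<longleftrightarrow>
     (\<forall>N\<ge>1. integrable (measure_pmf (\<nu> N)) (\<lambda>n. (real n)\<^sup>2) \<and>
            measure_pmf.expectation (\<nu> N) real = real N) \<and>
     (\<lambda>N. measure_pmf.variance (\<nu> N) real) \<in> o(\<lambda>N. (real N)\<^sup>2)"


subsection \<open>Standing assumptions on the coefficients\<close>

definition interaction_potential :: "('a::euclidean_space \<Rightarrow> real) \<Rightarrow> bool" where
  "interaction_potential V \<longleftrightarrow>
     (\<forall>x. V x \<ge> 0) \<and>
     (\<exists>a C. 0 < a \<and> a \<le> 1 \<and> (\<forall>x y. \<bar>V x - V y\<bar> \<le> C * dist x y powr a)) \<and>
     compact (closure {x. V x \<noteq> 0}) \<and>
     (\<integral>x. V x \<partial>lborel) = 1"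

definition initial_density :: "('a::euclidean_space \<Rightarrow> real \<Rightarrow> real) \<Rightarrow> real \<Rightarrow> bool" where
  "initial_density h Z \<longleftrightarrow>
     (\<lambda>(x, m). h x m) \<in> borel_measurable (restrict_space borel (UNIV \<times> {0<..})) \<and>
     (\<forall>x. \<forall>m>0. h x m \<ge> 0) \<and>
     Z > 0 \<and> (\<integral>\<^sup>+m\<in>{0<..}. (\<integral>\<^sup>+x. ennreal (h x m) \<partial>lborel) \<partial>lborel) = ennreal Z"

definition hypothesis_A ::
    "nat \<Rightarrow> (real \<Rightarrow> real) \<Rightarrow> (real \<Rightarrow> real) \<Rightarrow> (real \<Rightarrow> real \<Rightarrow> real) \<Rightarrow> bool" where
  "hypothesis_A D d \<phi> \<alpha> \<longleftrightarrow>
     (\<forall>m>0. d m > 0) \<and> bounded (d ` {0<..}) \<and> continuous_on {0<..} d \<and>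
     (\<exists>c>0. \<forall>m>0. \<phi> m \<ge> c) \<and> continuous_on {0<..} \<phi> \<and>
     antimono_on {0<..} \<phi> \<and> antimono_on {0<..} (\<lambda>m. \<phi> m * d m) \<and>
     (\<forall>n>0. \<forall>m>0. \<alpha> n m > 0 \<and> \<alpha> n m = \<alpha> m n) \<and>
     bounded ((\<lambda>(n, m). \<alpha> n m) ` ({0<..} \<times> {0<..})) \<and>
     continuous_on ({0<..} \<times> {0<..}) (\<lambda>(n, m). \<alpha> n m) \<and>
     (\<forall>L>0. bdd_above {\<alpha> n m / (m * d m powr (real D / 2) * \<phi> m ^ (D - 1)) | n m.
                        0 < n \<and> n \<le> L \<and> 0 < m})"


subsection \<open>The weight and the operator of the estimate\<close>

definition weight :: "nat \<Rightarrow> nat \<Rightarrow> (real \<Rightarrow> real) \<Rightarrow> (real \<Rightarrow> real) \<Rightarrow> real \<Rightarrow> real" where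
  "weight D k d \<phi> m = m * d m powr (real D / 2) * \<phi> m powr (real (k * D) / 2 - 1)"

text \<open>The \<open>(n - 1)\<close>-dimensional measure of the unit sphere of \<open>n\<close>-dimensional Euclidean space.\<close>

definition sphere_area :: "nat \<Rightarrow> real" where
  "sphere_area n = 2 * pi powr (real n / 2) / Gamma (real n / 2)"

definition c0 :: "nat \<Rightarrow> real" where
  "c0 n = 1 / ((real n - 2) * sphere_area n)"

text \<open>
  The number \<open>k\<close> of arguments is \<open>CARD('k)\<close>. Values lie in the extended nonnegative reals,
  as the integral may diverge for a bounded \<open>K\<close>.
\<close>

definition Lambda_op ::
    "(real \<Rightarrow> real) \<Rightarrow> real ^ 'k \<Rightarrow> ('a::euclidean_space ^ 'k \<Rightarrow> real) \<Rightarrow> 'a ^ 'k \<Rightarrow> ennreal" where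
  "Lambda_op d n K y = ennreal (c0 (CARD('k) * DIM('a))) *
     (\<integral>\<^sup>+z. ennreal ((\<Prod>r\<in>UNIV. d (n $ r) powr (- (real DIM('a) / 2))) *
        (\<Sum>r\<in>UNIV. (norm (y $ r - z $ r))\<^sup>2 / d (n $ r))
          powr (1 - real (CARD('k) * DIM('a)) / 2) * K z) \<partial>lborel)"

definition distinct_tuples :: "('i, 'a) config \<Rightarrow> ('k::finite \<Rightarrow> 'i) set" where
  "distinct_tuples q = {i. inj i \<and> range i \<subseteq> dom q}"

end

theory Submission
  imports Defs "HOL-Real_Asymp.Real_Asymp"
begin

text \<open>
  The kernel of \<open>\<Lambda>\<close> is regularised to \<open>(\<delta> + \<rho>)^(-p)\<close>, where
  \<open>\<rho> = \<Sum>\<^sub>r |y\<^sub>r - z\<^sub>r|\<^sup>2 / d(n\<^sub>r)\<close> and \<open>p = kd/2 - 1\<close>. The diffusion part of the generator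
  maps it to \<open>-4p(p+1)\<delta>(\<delta> + \<rho>)^(-p-2)\<close>, a multiple of an approximate identity, while the
  coagulation part can only decrease the weighted sum over tuples, because
  \<open>\<phi>(m) / (A + a / d(m))\<close> is non-increasing in \<open>m\<close>. To obtain an admissible test function, the sum is
  multiplied by the indicator of the configurations with at most \<open>n\<close> particles, masses at least
  \<open>1/n\<close> and total mass at most \<open>n\<close>; this set is absorbing, since coagulation decreases the number of
  particles, increases masses and conserves the total mass. Dynkin's formula on the event that the
  process starts in this set bounds the time integral of the mollified functional by the initial
  regularised potential. Fatou's lemma lets \<open>n \<rightarrow> \<infinity>\<close> and \<open>\<delta> \<rightarrow> 0\<close>.
\<close>

subsection \<open>A radial integral\<close>

text \<open>The functional that is differentiated carries the weight
  \<open>m * \<phi> m powr p\<close> per particle, without a power of \<open>d\<close>. The factor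
  \<open>d m powr (D/2)\<close> of the final weight appears only in the limit, as the Jacobian of
  the rescaling that turns the mollifier into a fixed profile; on the initial side it cancels
  against the \<open>d powr (-D/2)\<close> in the kernel of \<Lambda>. The relation
  \<open>kd = 2p + 2\<close> makes the kernel with \<delta> = 0 harmonic off its pole in the metric
  given by the diffusivities, and it makes the powers of \<delta> cancel in the rescaling. The
  constant in \<Lambda> is the inverse of \<open>4p(p+1)\<close> times the volume of the unit ball;
  that volume is the integral of \<open>(1 + |w|^2)^(-p-2)\<close> in dimension \<open>kd\<close>.
  The obstacle is how little is assumed of the process: a generator known on bounded test functions,
  and paths that are merely jointly measurable. That the process remains in the absorbing set is
  therefore derived from Dynkin's formula for the indicator of that set, almost surely at each fixed
  time. \<open>K\<close> is cut off to a box so that derivatives pass under an integral over a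
  compact set.\<close>

lemma sphere_area_unit_ball_vol: 
  assumes "n > 0" shows "sphere_area n = real n * unit_ball_vol (real n)"
proof -
  have G: "Gamma (real n / 2 + 1) = (real n / 2) * Gamma (real n / 2)"
    using assms by (subst Gamma_plus1) auto
  show ?thesis unfolding sphere_area_def unit_ball_vol_def G using assms by simp
qed

lemma deriv_one_plus_square:
  fixes s :: real
  shows "((\<lambda>r. - ((1 + r\<^sup>2) powr (- s))) has_real_derivative 2 * s * r * (1 + r\<^sup>2) powr (- s - 1)) (at r)"
proof -
  have "1 + r\<^sup>2 > 0" by (simp add: add_pos_nonneg)
  then show ?thesis
    by (auto intro!: derivative_eq_intros simp: field_simps)
qed

text \<open>The layer-cake form of a decreasing radial function:
  \<open>(1 + a\<^sup>2) powr (- s)\<close> vanishes at infinity, so it is the integral of minus its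
  derivative from \<open>a\<close> on. With \<open>a = norm z\<close> this trades a radial integral
  for volumes of balls.\<close>

lemma nn_integral_tail:
  fixes s a :: real
  assumes "s > 0" "a \<ge> 0"
  shows "(\<integral>\<^sup>+r. ennreal (2 * s * r * (1 + r\<^sup>2) powr (- s - 1)) * indicator {a..} r \<partial>lborel) = ennreal ((1 + a\<^sup>2) powr (- s))"
proof -
  have "((\<lambda>r::real. - ((1 + r\<^sup>2) powr (- s))) \<longlongrightarrow> 0) at_top"
    using assms by real_asymp
  then have "(\<integral>\<^sup>+r. ennreal (2 * s * r * (1 + r\<^sup>2) powr (- s - 1)) * indicator {a..} r \<partial>lborel) = ennreal (0 - (- ((1 + a\<^sup>2) powr (- s))))"
    using assms by (intro nn_integral_FTC_atLeast deriv_one_plus_square) (auto)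
  then show ?thesis by simp
qed

text \<open>For \<open>s = n/2 + 1\<close> the integrand is an exact derivative, that of
  \<open>r ^ (n+2) * (1 + r\<^sup>2) powr (- s)\<close>, which rises from 0 to 1 on the half line.
  This is the one-dimensional integral left over by the layer-cake computation in dimension
  \<open>n\<close>.\<close>

lemma nn_integral_moment:
  assumes "n > 0"
  shows "(\<integral>\<^sup>+r. ennreal (real (n+2) * r ^ (n+1) * (1 + r\<^sup>2) powr (- (real n / 2) - 2)) * indicator {0..} r \<partial>lborel) = 1"
proof -
  define s where "s = real n / 2 + 1"
  have s: "s > 0" "real (n+2) = 2 * s" by (auto simp: s_def)
  let ?F = "\<lambda>r::real. r ^ (n+2) * (1 + r\<^sup>2) powr (- s)"
  have der: "(?F has_real_derivative real (n+2) * r ^ (n+1) * (1 + r\<^sup>2) powr (- s - 1)) (at r)" for r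
  proof -
    have pos: "1 + r\<^sup>2 > 0" by (simp add: add_pos_nonneg)
    have "(?F has_real_derivative real (n+2) * r ^ (n+1) * (1 + r\<^sup>2) powr (- s) + r^(n+2) * (- (2 * s * r * (1 + r\<^sup>2) powr (- s - 1)))) (at r)"
      using DERIV_mult[OF DERIV_pow[of "n+2" r] DERIV_minus[OF deriv_one_plus_square[of s r]]]
      by (simp add: algebra_simps)
    also have "(1 + r\<^sup>2) powr (- s) = (1 + r\<^sup>2) * (1 + r\<^sup>2) powr (- s - 1)"
      using pos by (simp add: powr_diff)
    \<comment> \<open>The terms in \<open>r ^ (n+3)\<close> cancel because
      \<open>2 * s = n + 2\<close>.\<close>
    also have "real (n+2) * r ^ (n+1) * ((1 + r\<^sup>2) * (1 + r\<^sup>2) powr (- s - 1)) + r^(n+2) * (- (2 * s * r * (1 + r\<^sup>2) powr (- s - 1)))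
      = real (n+2) * r ^ (n+1) * (1 + r\<^sup>2) powr (- s - 1)"
      using s by (simp add: algebra_simps power2_eq_square)
    finally show ?thesis .
  qed
  have "((\<lambda>r::real. r powr (2 * s) * (1 + r\<^sup>2) powr (- s)) \<longlongrightarrow> 1) at_top"
    using s by real_asymp
  moreover have "eventually (\<lambda>r. r powr (2 * s) * (1 + r\<^sup>2) powr (- s) = ?F r) at_top"
    using eventually_gt_at_top[of 0]
    by eventually_elim (simp only: s(2)[symmetric] powr_realpow)
  ultimately have lim: "(?F \<longlongrightarrow> 1) at_top" by (rule Lim_transform_eventually)
  have "(\<integral>\<^sup>+r. ennreal (real (n+2) * r ^ (n+1) * (1 + r\<^sup>2) powr (- s - 1)) * indicator {0..} r \<partial>lborel) = ennreal (1 - ?F 0)"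
    by (intro nn_integral_FTC_atLeast lim der) auto
  moreover have "- s - 1 = - (real n / 2) - 2" by (simp add: s_def)
  ultimately show ?thesis by (simp only:) simp
qed

text \<open>Fubini replaces polar coordinates: after the layer-cake step the inner integral over
  \<open>z\<close> is the volume of a ball of radius \<open>r\<close>. In dimension
  \<open>2 * p + 2\<close> the exponent is \<open>- (p + 2)\<close>, that of the mollifier which the
  Laplacian produces.\<close>

lemma nn_integral_radial:
  "(\<integral>\<^sup>+z. ennreal ((1 + (norm (z::'b::euclidean_space))\<^sup>2) powr (- (real DIM('b) / 2 + 1))) \<partial>lborel)
    = ennreal (unit_ball_vol (real DIM('b)))"
proof -
  define n where "n = DIM('b)"
  define s where "s = real n / 2 + 1"
  have n: "n > 0" by (simp add: n_def)
  have s: "s > 0" "real (n+2) = 2 * s" by (auto simp: s_def)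
  let ?g = "\<lambda>r::real. ennreal (2 * s * r * (1 + r\<^sup>2) powr (- s - 1))"
  have "(\<integral>\<^sup>+z. ennreal ((1 + (norm (z::'b))\<^sup>2) powr (- s)) \<partial>lborel)
     = (\<integral>\<^sup>+z. (\<integral>\<^sup>+r. ?g r * indicator {norm (z::'b)..} r \<partial>lborel) \<partial>lborel)"
    using s by (simp add: nn_integral_tail)
  also have "\<dots> = (\<integral>\<^sup>+z. (\<integral>\<^sup>+r. ?g r * indicator {(z,r). norm z \<le> r} (z::'b,r) \<partial>lborel) \<partial>lborel)"
    by (intro nn_integral_cong) (auto simp: indicator_def)
  also have "\<dots> = (\<integral>\<^sup>+r. (\<integral>\<^sup>+z. ?g r * indicator {(z,r). norm z \<le> r} (z::'b,r) \<partial>lborel) \<partial>lborel)"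
    by (rule lborel_pair.Fubini'[symmetric]) measurable
  also have "\<dots> = (\<integral>\<^sup>+r. ennreal (unit_ball_vol (real n)) * (ennreal (real (n+2) * r ^ (n+1) * (1 + r\<^sup>2) powr (- (real n / 2) - 2)) * indicator {0..} r) \<partial>lborel)"
  proof (intro nn_integral_cong)
    fix r :: real
    have "(\<integral>\<^sup>+z. ?g r * indicator {(z,r). norm z \<le> r} (z::'b,r) \<partial>lborel) = (\<integral>\<^sup>+z. ?g r * indicator (cball 0 r) (z::'b) \<partial>lborel)"
      by (intro nn_integral_cong) (auto simp: indicator_def)
    also have "\<dots> = ?g r * emeasure lborel (cball 0 r :: 'b set)"
      by (subst nn_integral_cmult_indicator) auto
    also have "\<dots> = ennreal (unit_ball_vol (real n)) * (ennreal (real (n+2) * r ^ (n+1) * (1 + r\<^sup>2) powr (- (real n / 2) - 2)) * indicator {0..} r)"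
    proof (cases "r \<ge> 0")
      case True
      have "(1 + r\<^sup>2) powr (- s - 1) = (1 + r\<^sup>2) powr (- (real n / 2) - 2)"
        proof -
        have "- s - 1 = - (real n / 2) - 2" by (simp add: s_def)
        then show ?thesis by (simp only:)
      qed
      then have "2 * s * r * (1 + r\<^sup>2) powr (- s - 1) * (unit_ball_vol (real n) * r ^ n) 
         = unit_ball_vol (real n) * (real (n+2) * r ^ (n+1) * (1 + r\<^sup>2) powr (- (real n / 2) - 2))"
        using s(2) by simp
      with True s show ?thesis
        by (simp add: emeasure_cball n_def[symmetric] ennreal_mult'[symmetric] del: of_nat_add)
    qed auto
    finally show "(\<integral>\<^sup>+z. ?g r * indicator {(z,r). norm z \<le> r} (z::'b,r) \<partial>lborel) = ennreal (unit_ball_vol (real n)) * (ennreal (real (n+2) * r ^ (n+1) * (1 + r\<^sup>2) powr (- (real n / 2) - 2)) * indicator {0..} r)" .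
  qed
  also have "\<dots> = ennreal (unit_ball_vol (real n))"
    using nn_integral_moment[OF n] by (subst nn_integral_cmult) auto
  finally show ?thesis by (simp add: s_def n_def)
qed

subsection \<open>Smoothness of the regularised potential\<close>

text \<open>Moving one particle along a basis vector is a one-parameter family, so Leibniz's rule on
  the line suffices although locations live in a product over all labels. Compactness of the box
  makes continuous slices integrable and the integrals continuous in the parameter. A second
  application, to the derivative, yields \<open>C2_locations\<close>.\<close>

lemma C1_locations_integral:
  fixes f :: "('i \<Rightarrow> 'a::euclidean_space) \<Rightarrow> 'b::euclidean_space \<Rightarrow> real"
  assumes cont: "continuous_on (UNIV \<times> cbox l u) (\<lambda>(x, z). f x z)"
    and der: "\<And>i b x z. b \<in> Basis \<Longrightarrow> z \<in> cbox l u \<Longrightarrow>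
      ((\<lambda>t. f (x(i := x i + t *\<^sub>R b)) z) has_real_derivative f' i b x z) (at 0)"
    and cont': "\<And>i b. b \<in> Basis \<Longrightarrow> continuous_on (UNIV \<times> cbox l u) (\<lambda>(x, z). f' i b x z)"
  shows pderiv_at_integral: "\<And>i b. b \<in> Basis \<Longrightarrow>
      pderiv_at i b (\<lambda>x. integral (cbox l u) (f x)) = (\<lambda>x. integral (cbox l u) (f' i b x))"
    and "C1_locations (\<lambda>x. integral (cbox l u) (f x))"
proof -
  have upd: "continuous_on UNIV (\<lambda>t. x(i := x i + t *\<^sub>R b))" for x :: "'i \<Rightarrow> 'a" and i b
  proof (rule continuous_on_coordinatewise_then_product)
    show "continuous_on UNIV (\<lambda>t. (x(i := x i + t *\<^sub>R b)) j)" for j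
      by (cases "j = i") (auto intro!: continuous_intros)
  qed
  have D: "((\<lambda>t. integral (cbox l u) (f (x(i := x i + t *\<^sub>R b)))) has_real_derivative integral (cbox l u) (f' i b x)) (at 0)"
    if b: "b \<in> Basis" for x :: "'i \<Rightarrow> 'a" and i b
  proof -
    let ?x = "\<lambda>t. x(i := x i + t *\<^sub>R b)"
    have "((\<lambda>t. integral (cbox l u) (f (?x t))) has_real_derivative integral (cbox l u) (f' i b (?x 0))) (at 0 within UNIV)"
    proof (rule leibniz_rule_field_derivative)
      fix t z assume "z \<in> cbox l u"
      \<comment> \<open>Leibniz's rule asks for the derivative at every \<open>t\<close>, while the
        hypothesis speaks of 0: the base point is moved to \<open>?x t\<close> and the line is
        reparametrised.\<close>
      from der[OF b this, of "?x t" i]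
      have "((\<lambda>s. f (?x (t + s)) z) has_real_derivative f' i b (?x t) z) (at 0)"
        by (simp add: algebra_simps)
      then show "((\<lambda>t. f (?x t) z) has_real_derivative f' i b (?x t) z) (at t within UNIV)"
        using DERIV_shift[of "\<lambda>t. f (?x t) z" "f' i b (?x t) z" 0 t] by (simp add: add.commute)
    next
      fix t
      have "continuous_on (cbox l u) (\<lambda>z. case (?x t, z) of (x, z) \<Rightarrow> f x z)"
        by (rule continuous_on_compose2[OF cont]) (auto intro!: continuous_intros)
      then show "f (?x t) integrable_on cbox l u"
        by (intro integrable_continuous) simp
    next
      have "continuous_on (UNIV \<times> cbox l u) (\<lambda>w. case (?x (fst w), snd w) of (x, z) \<Rightarrow> f' i b x z)"
      proof (rule continuous_on_compose2[OF cont'[OF b]])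
        show "continuous_on (UNIV \<times> cbox l u) (\<lambda>w. (?x (fst w), snd w))"
          by (intro continuous_on_Pair continuous_on_compose2[OF upd] continuous_on_fst continuous_on_snd continuous_on_id) auto
      qed auto
      then show "continuous_on (UNIV \<times> cbox l u) (\<lambda>(t, z). f' i b (?x t) z)"
        by (simp add: split_beta)
    qed auto
    then show ?thesis by simp
  qed
  show P: "pderiv_at i b (\<lambda>x. integral (cbox l u) (f x)) = (\<lambda>x. integral (cbox l u) (f' i b x))" if "b \<in> Basis" for i b
    unfolding pderiv_at_def using D[OF that] by (intro ext DERIV_imp_deriv) auto
  show "C1_locations (\<lambda>x. integral (cbox l u) (f x))"
    unfolding C1_locations_def
  proof (intro conjI allI ballI)
    show "continuous_on UNIV (\<lambda>x. integral (cbox l u) (f x))"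
      by (rule integral_continuous_on_param[OF cont])
    fix i and b :: 'a assume b: "b \<in> Basis"
    show "(\<lambda>t. integral (cbox l u) (f (x(i := x i + t *\<^sub>R b)))) differentiable at 0" for x
      using D[OF b] real_differentiable_def by blast
    show "continuous_on UNIV (pderiv_at i b (\<lambda>x. integral (cbox l u) (f x)))"
      unfolding P[OF b] by (rule integral_continuous_on_param[OF cont'[OF b]])
  qed
qed

text \<open>The form \<rho> in the regularised kernel, with \<open>a r\<close> the diffusivity in
  slot \<open>r\<close>. The points \<open>y\<close> are a function rather than a vector, so that
  \<open>\<lambda>r. x (t r)\<close> can be inserted for a tuple of labels \<open>t\<close> and
  arbitrary locations \<open>x\<close>.\<close>

definition quad :: "('k::finite \<Rightarrow> real) \<Rightarrow> ('k \<Rightarrow> 'a::euclidean_space) \<Rightarrow> 'a ^ 'k \<Rightarrow> real" where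
  "quad a y z = (\<Sum>r\<in>UNIV. (norm (y r - z $ r))\<^sup>2 / a r)"

text \<open>The derivative is indexed by a label \<open>i\<close>, and the sum picks out the slots
  occupied by \<open>i\<close>. It vanishes for labels outside the tuple and makes sense before
  injectivity of \<open>t\<close> is used.\<close>

definition quad_deriv :: "('i \<Rightarrow> real) \<Rightarrow> ('k::finite \<Rightarrow> 'i) \<Rightarrow> 'i \<Rightarrow> 'a \<Rightarrow> ('i \<Rightarrow> 'a::euclidean_space) \<Rightarrow> 'a ^ 'k \<Rightarrow> real" where
  "quad_deriv e t i b x z = (\<Sum>r\<in>UNIV. if t r = i then 2 * ((x i - z $ r) \<bullet> b) / e i else 0)"

definition quad_deriv2 :: "('i \<Rightarrow> real) \<Rightarrow> ('k::finite \<Rightarrow> 'i) \<Rightarrow> 'i \<Rightarrow> 'a::euclidean_space \<Rightarrow> 'i \<Rightarrow> 'a \<Rightarrow> real" where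
  "quad_deriv2 e t i b j c = (\<Sum>r\<in>UNIV. if t r = i \<and> i = j then 2 * (b \<bullet> c) / e i else 0)"

lemma quad_nonneg: "(\<And>r. a r > 0) \<Longrightarrow> 0 \<le> quad a y z"
  unfolding quad_def by (intro sum_nonneg) (simp add: less_imp_le)

lemma quad_has_derivative:
  "((\<lambda>s. quad (\<lambda>r. e (t r)) (\<lambda>r. (x(i := x i + s *\<^sub>R b)) (t r)) z) has_real_derivative quad_deriv e t i b x z) (at 0)"
  unfolding quad_def quad_deriv_def
proof (rule DERIV_sum)
  fix r
  have "((\<lambda>s. ((norm (x i - z $ r))\<^sup>2 + 2 * s * ((x i - z $ r) \<bullet> b) + s\<^sup>2 * (norm b)\<^sup>2) / e i) has_real_derivative 2 * ((x i - z $ r) \<bullet> b) / e i) (at 0)"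
    by (auto intro!: derivative_eq_intros simp: divide_inverse)
  moreover have "(norm (x i + s *\<^sub>R b - z $ r))\<^sup>2 = (norm (x i - z $ r))\<^sup>2 + 2 * s * ((x i - z $ r) \<bullet> b) + s\<^sup>2 * (norm b)\<^sup>2" for s
    unfolding power2_norm_eq_inner by (simp add: inner_simps algebra_simps inner_commute power2_eq_square)
  ultimately show "((\<lambda>s. (norm ((x(i := x i + s *\<^sub>R b)) (t r) - z $ r))\<^sup>2 / e (t r)) has_real_derivative (if t r = i then 2 * ((x i - z $ r) \<bullet> b) / e i else 0)) (at 0)"
    by (cases "t r = i") auto
qed

lemma quad_deriv_has_derivative:
  "((\<lambda>s. quad_deriv e t i b (x(j := x j + s *\<^sub>R c)) z) has_real_derivative quad_deriv2 e t i b j c) (at 0)"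
  unfolding quad_deriv_def quad_deriv2_def
proof (rule DERIV_sum)
  fix r
  show "((\<lambda>s. if t r = i then 2 * (((x(j := x j + s *\<^sub>R c)) i - z $ r) \<bullet> b) / e i else 0) has_real_derivative (if t r = i \<and> i = j then 2 * (b \<bullet> c) / e i else 0)) (at 0)"
  proof (cases "t r = i \<and> i = j")
    case True
    have "((\<lambda>s. 2 * ((x i - z $ r) \<bullet> b + s * (b \<bullet> c)) / e i) has_real_derivative 2 * (b \<bullet> c) / e i) (at 0)"
      by (auto intro!: derivative_eq_intros simp: divide_inverse)
    then show ?thesis using True by (simp add: inner_simps algebra_simps inner_commute)
  next
    case False
    then have "(\<lambda>s. if t r = i then 2 * (((x(j := x j + s *\<^sub>R c)) i - z $ r) \<bullet> b) / e i else 0) = (\<lambda>s. if t r = i then 2 * ((x i - z $ r) \<bullet> b) / e i else 0)"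
      by auto
    then show ?thesis using False by auto
  qed
qed

lemma continuous_on_location: "continuous_on A (\<lambda>w. fst w i)"
  for A :: "(('i \<Rightarrow> 'a::topological_space) \<times> 'b::topological_space) set"
  by (rule continuous_on_compose2[OF continuous_on_product_coordinates continuous_on_fst[OF continuous_on_id]]) auto

lemma continuous_on_quad:
  fixes A :: "(('i \<Rightarrow> 'a::euclidean_space) \<times> ('a ^ 'k::finite)) set"
  shows "continuous_on A (\<lambda>w. quad (\<lambda>r. e (t r)) (\<lambda>r. fst w (t r)) (snd w))"
  unfolding quad_def divide_inverse by (intro continuous_intros continuous_on_location)

lemma continuous_on_quad_deriv:
  fixes A :: "(('i \<Rightarrow> 'a::euclidean_space) \<times> ('a ^ 'k::finite)) set"
  shows "continuous_on A (\<lambda>w. quad_deriv e t i b (fst w) (snd w))"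
  unfolding quad_deriv_def
  by (intro continuous_on_sum, rename_tac r, case_tac "t r = i") (auto simp: divide_inverse intro!: continuous_intros continuous_on_location)

text \<open>Multiplying the Laplacian in particle \<open>i\<close> by \<open>e i\<close> amounts to
  the Euclidean Laplacian in rescaled variables of dimension \<open>kd\<close>. With
  \<open>\<rho>\<close> now including \<delta>, the squared gradients give
  \<open>4p(p+1) \<rho>^(-p-2) (\<rho> - \<delta>)\<close> and the second derivatives give
  \<open>-2p kd \<rho>^(-p-1)\<close>; for \<open>kd = 2p + 2\<close> all cancels but the part
  carrying \<delta>. The coefficients \<open>c t\<close> are for the masses, which diffusion leaves
  fixed.\<close>

lemma potential_sum_C2:
  fixes K :: "'a::euclidean_space ^ 'k::finite \<Rightarrow> real" and T :: "('k \<Rightarrow> 'i) set" and e :: "'i \<Rightarrow> real"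
    and c :: "('k \<Rightarrow> 'i) \<Rightarrow> real"
  assumes \<delta>: "\<delta> > 0" and e: "\<And>t r. t \<in> T \<Longrightarrow> e (t r) > 0" and K: "continuous_on (cbox l u) K"
    and J: "finite J" "\<And>t r. t \<in> T \<Longrightarrow> t r \<in> J" and inj: "\<And>t. t \<in> T \<Longrightarrow> inj t"
    and p: "real (CARD('k) * DIM('a)) = 2 * p + 2"
  defines "\<rho> \<equiv> (\<lambda>t x z. \<delta> + quad (\<lambda>r. e (t r)) (\<lambda>r. x (t r)) z)"
  defines "F \<equiv> (\<lambda>x. integral (cbox l u) (\<lambda>z. (\<Sum>t\<in>T. c t * \<rho> t x z powr (- p)) * K z))"
  shows "C2_locations F"
    and "(\<Sum>i\<in>J. e i * (\<Sum>b\<in>Basis. pderiv_at i b (pderiv_at i b F) x))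
      = - (integral (cbox l u) (\<lambda>z. (\<Sum>t\<in>T. c t * (4 * p * (p + 1) * \<delta> * \<rho> t x z powr (- p - 2))) * K z))"
proof -
  have pos: "\<rho> t x z > 0" if "t \<in> T" for t x z
    unfolding \<rho>_def using quad_nonneg[of "\<lambda>r. e (t r)"] e[OF that] \<delta> by (auto intro: add_pos_nonneg)
  let ?f = "\<lambda>x z. (\<Sum>t\<in>T. c t * \<rho> t x z powr (- p)) * K z"
  let ?f1 = "\<lambda>i b x z. (\<Sum>t\<in>T. c t * (- p * \<rho> t x z powr (- p - 1) * quad_deriv e t i b x z)) * K z"
  let ?f2 = "\<lambda>i b j b' x z. (\<Sum>t\<in>T. c t * (- p * (- p - 1) * \<rho> t x z powr (- p - 2) * quad_deriv e t j b' x z * quad_deriv e t i b x z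
       + - p * \<rho> t x z powr (- p - 1) * quad_deriv2 e t i b j b')) * K z"
  have \<rho>D: "((\<lambda>s. \<rho> t (x(i := x i + s *\<^sub>R b)) z) has_real_derivative quad_deriv e t i b x z) (at 0)" for t x i b z
    unfolding \<rho>_def by (rule DERIV_cong[OF DERIV_add[OF DERIV_const quad_has_derivative]]) simp
  have powD: "((\<lambda>s. \<rho> t (x(i := x i + s *\<^sub>R b)) z powr s') has_real_derivative s' * \<rho> t x z powr (s' - 1) * quad_deriv e t i b x z) (at 0)"
    if "t \<in> T" for t x i b z s'
    using DERIV_fun_powr[OF \<rho>D[of t x i b z], of s'] pos[OF that, of x z] by simp
  have \<rho>c: "continuous_on A (\<lambda>w. \<rho> t (fst w) (snd w) powr s')" if "t \<in> T" for t s' and A :: "(('i \<Rightarrow> 'a) \<times> ('a ^ 'k)) set"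
  proof -
    have "\<rho> t (fst w) (snd w) \<noteq> 0" for w using pos[OF that, of "fst w" "snd w"] by simp
    then show ?thesis
      by (intro continuous_on_powr continuous_on_const) (auto simp: \<rho>_def intro!: continuous_intros continuous_on_quad)
  qed
  have Kc: "continuous_on (UNIV \<times> cbox l u) (\<lambda>w :: ('i \<Rightarrow> 'a) \<times> ('a ^ 'k). K (snd w))"
    by (rule continuous_on_compose2[OF K]) (auto intro!: continuous_intros)
  have c0: "continuous_on (UNIV \<times> cbox l u) (\<lambda>(x, z). ?f x z)"
    unfolding split_beta by (intro continuous_intros \<rho>c Kc)
  have c1: "continuous_on (UNIV \<times> cbox l u) (\<lambda>(x, z). ?f1 i b x z)" for i b
    unfolding split_beta by (intro continuous_intros \<rho>c Kc continuous_on_quad_deriv)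
  have c2: "continuous_on (UNIV \<times> cbox l u) (\<lambda>(x, z). ?f2 i b j b' x z)" for i b j b'
    unfolding split_beta by (intro continuous_intros \<rho>c Kc continuous_on_quad_deriv)
  have d1: "((\<lambda>s. ?f (x(i := x i + s *\<^sub>R b)) z) has_real_derivative ?f1 i b x z) (at 0)" for i b x z
    by (intro DERIV_cmult_right DERIV_sum DERIV_cmult powD)
  have d2: "((\<lambda>s. ?f1 i b (x(j := x j + s *\<^sub>R b')) z) has_real_derivative ?f2 i b j b' x z) (at 0)" for i b j b' x z
  proof (intro DERIV_cmult_right DERIV_sum DERIV_cmult)
    fix t assume t: "t \<in> T"
    have "((\<lambda>s. - p * (\<rho> t (x(j := x j + s *\<^sub>R b')) z powr (- p - 1) * quad_deriv e t i b (x(j := x j + s *\<^sub>R b')) z)) has_real_derivative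
      - p * ((- p - 1) * \<rho> t x z powr (- p - 1 - 1) * quad_deriv e t j b' x z * quad_deriv e t i b x z + quad_deriv2 e t i b j b' * \<rho> t x z powr (- p - 1))) (at 0)"
      using DERIV_cmult[OF DERIV_mult[OF powD[OF t, of x j b' z "- p - 1"] quad_deriv_has_derivative[of e t i b x j b' z]], of "- p"] by simp
    then show "((\<lambda>s. - p * \<rho> t (x(j := x j + s *\<^sub>R b')) z powr (- p - 1) * quad_deriv e t i b (x(j := x j + s *\<^sub>R b')) z) has_real_derivative
      - p * (- p - 1) * \<rho> t x z powr (- p - 2) * quad_deriv e t j b' x z * quad_deriv e t i b x z + - p * \<rho> t x z powr (- p - 1) * quad_deriv2 e t i b j b') (at 0)"
      by (simp add: algebra_simps)
  qed
  have P1: "pderiv_at i b F = (\<lambda>x. integral (cbox l u) (?f1 i b x))" if "b \<in> Basis" for i b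
    unfolding F_def by (rule pderiv_at_integral[OF c0 d1 c1 that])
  have P2: "pderiv_at j b' (pderiv_at i b F) = (\<lambda>x. integral (cbox l u) (?f2 i b j b' x))" if "b \<in> Basis" "b' \<in> Basis" for i b j b'
    unfolding P1[OF that(1)] by (rule pderiv_at_integral[OF c1 d2 c2 that(2)])
  have C1: "C1_locations F" unfolding F_def by (rule C1_locations_integral[OF c0 d1 c1])
  have C1': "C1_locations (pderiv_at i b F)" if "b \<in> Basis" for i b
    unfolding P1[OF that] by (rule C1_locations_integral[OF c1 d2 c2])
  show "C2_locations F"
    using C1 C1' by (simp add: C2_locations_def)
  have slice: "(\<lambda>z. g x z) integrable_on cbox l u" if "continuous_on (UNIV \<times> cbox l u) (\<lambda>(x, z). g x z)" for g :: "('i \<Rightarrow> 'a) \<Rightarrow> 'a ^ 'k \<Rightarrow> real"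
  proof -
    have "continuous_on (cbox l u) (\<lambda>z. case (x, z) of (x, z) \<Rightarrow> g x z)"
      by (rule continuous_on_compose2[OF that]) (auto intro!: continuous_intros)
    then show ?thesis by (intro integrable_continuous) simp
  qed
  have "(\<Sum>i\<in>J. e i * (\<Sum>b\<in>Basis. pderiv_at i b (pderiv_at i b F) x))
     = (\<Sum>i\<in>J. e i * (\<Sum>b\<in>Basis. integral (cbox l u) (?f2 i b i b x)))"
    by (intro sum.cong refl arg_cong2[where f="(*)"]) (simp add: P2)
  also have "\<dots> = integral (cbox l u) (\<lambda>z. \<Sum>i\<in>J. e i * (\<Sum>b\<in>Basis. ?f2 i b i b x z))"
  proof -
    have "integral (cbox l u) (\<lambda>z. \<Sum>i\<in>J. e i * (\<Sum>b\<in>Basis. ?f2 i b i b x z)) = (\<Sum>i\<in>J. integral (cbox l u) (\<lambda>z. e i * (\<Sum>b\<in>Basis. ?f2 i b i b x z)))"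
      by (rule integral_sum[OF J(1)]) (intro integrable_on_mult_right integrable_sum slice c2 finite_Basis)
    also have "\<dots> = (\<Sum>i\<in>J. e i * (\<Sum>b\<in>Basis. integral (cbox l u) (?f2 i b i b x)))"
      by (intro sum.cong refl, subst integral_mult_right, subst integral_sum[OF finite_Basis slice[OF c2]], rule refl)
    finally show ?thesis by simp
  qed
  also have "\<dots> = integral (cbox l u) (\<lambda>z. - ((\<Sum>t\<in>T. c t * (4 * p * (p + 1) * \<delta> * \<rho> t x z powr (- p - 2))) * K z))"
  proof (intro arg_cong[where f="integral (cbox l u)"] ext)
    fix z
    have key: "(\<Sum>i\<in>J. e i * (\<Sum>b\<in>Basis. - p * (- p - 1) * \<rho> t x z powr (- p - 2) * quad_deriv e t i b x z * quad_deriv e t i b x z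
       + - p * \<rho> t x z powr (- p - 1) * quad_deriv2 e t i b i b)) = - (4 * p * (p + 1) * \<delta> * \<rho> t x z powr (- p - 2))" if t: "t \<in> T" for t
    proof -
      let ?h = "\<lambda>i. e i * (\<Sum>b\<in>Basis. - p * (- p - 1) * \<rho> t x z powr (- p - 2) * quad_deriv e t i b x z * quad_deriv e t i b x z
         + - p * \<rho> t x z powr (- p - 1) * quad_deriv2 e t i b i b)"
      have z0: "?h i = 0" if "i \<notin> range t" for i
      proof -
        have "t r \<noteq> i" for r using that by auto
        then show ?thesis by (simp add: quad_deriv_def quad_deriv2_def)
      qed
      \<comment> \<open>Particles outside the tuple do not enter its kernel; injectivity then allows
        summation over slots instead of labels.\<close>
      have "sum ?h J = sum ?h (range t)"
        using J t z0 by (intro sum.mono_neutral_right) auto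
      also have "\<dots> = (\<Sum>r\<in>UNIV. ?h (t r))"
        using inj[OF t] by (simp add: sum.reindex)
      also have "\<dots> = (\<Sum>r\<in>UNIV. 4 * p * (p + 1) * \<rho> t x z powr (- p - 2) * ((norm (x (t r) - z $ r))\<^sup>2 / e (t r)) - 2 * p * \<rho> t x z powr (- p - 1) * DIM('a))"
      proof (rule sum.cong[OF refl])
        fix r
        have tr: "t r' = t r \<longleftrightarrow> r' = r" for r' using inj[OF t] by (auto simp: inj_def)
        have q1: "quad_deriv e t (t r) b x z = 2 * ((x (t r) - z $ r) \<bullet> b) / e (t r)" for b
          unfolding quad_deriv_def tr by (simp add: sum.delta)
        have q2: "quad_deriv2 e t (t r) b (t r) b = 2 * (b \<bullet> b) / e (t r)" for b
          unfolding quad_deriv2_def tr by (simp add: sum.delta)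
        have "?h (t r) = e (t r) * (\<Sum>b\<in>Basis. (4 * p * (p + 1) * \<rho> t x z powr (- p - 2) / (e (t r))\<^sup>2) * (((x (t r) - z $ r) \<bullet> b) * ((x (t r) - z $ r) \<bullet> b)) - 2 * p * \<rho> t x z powr (- p - 1) / e (t r))"
          unfolding q1 q2 by (intro arg_cong2[where f="(*)"] refl sum.cong) (simp add: inner_same_Basis field_simps power2_eq_square)
        \<comment> \<open>The basis is orthonormal: squared components sum to the squared norm, and
          the constant terms are counted once per dimension.\<close>
        also have "\<dots> = e (t r) * ((4 * p * (p + 1) * \<rho> t x z powr (- p - 2) / (e (t r))\<^sup>2) * (norm (x (t r) - z $ r))\<^sup>2 - DIM('a) * (2 * p * \<rho> t x z powr (- p - 1) / e (t r)))"
          unfolding power2_norm_eq_inner euclidean_inner[of "x (t r) - z $ r" "x (t r) - z $ r"]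
          by (simp add: sum_subtractf sum_distrib_left)
        also have "\<dots> = 4 * p * (p + 1) * \<rho> t x z powr (- p - 2) * ((norm (x (t r) - z $ r))\<^sup>2 / e (t r)) - 2 * p * \<rho> t x z powr (- p - 1) * DIM('a)"
          using e[OF t, of r] by (simp add: field_simps power2_eq_square)
        finally show "?h (t r) = 4 * p * (p + 1) * \<rho> t x z powr (- p - 2) * ((norm (x (t r) - z $ r))\<^sup>2 / e (t r)) - 2 * p * \<rho> t x z powr (- p - 1) * DIM('a)" .
      qed
      also have "\<dots> = 4 * p * (p + 1) * \<rho> t x z powr (- p - 2) * quad (\<lambda>r. e (t r)) (\<lambda>r. x (t r)) z - real (CARD('k) * DIM('a)) * (2 * p * \<rho> t x z powr (- p - 1))"
        by (simp add: sum_subtractf quad_def sum_distrib_left)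
      also have "\<dots> = - (4 * p * (p + 1) * \<delta> * \<rho> t x z powr (- p - 2))"
      proof -
        have "- p - 1 = 1 + (- p - 2)" by simp
        then have e1: "\<rho> t x z powr (- p - 1) = \<rho> t x z * \<rho> t x z powr (- p - 2)"
          using pos[OF t, of x z] by (simp only: powr_mult_base less_imp_le)
        have e2: "quad (\<lambda>r. e (t r)) (\<lambda>r. x (t r)) z = \<rho> t x z - \<delta>" by (simp add: \<rho>_def)
        show ?thesis unfolding p e1 e2 by (simp add: algebra_simps)
      qed
      finally show ?thesis .
    qed
    have "(\<Sum>i\<in>J. e i * (\<Sum>b\<in>Basis. ?f2 i b i b x z)) = (\<Sum>t\<in>T. c t * (\<Sum>i\<in>J. e i * (\<Sum>b\<in>Basis. - p * (- p - 1) * \<rho> t x z powr (- p - 2) * quad_deriv e t i b x z * quad_deriv e t i b x z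
       + - p * \<rho> t x z powr (- p - 1) * quad_deriv2 e t i b i b))) * K z"
      unfolding sum_distrib_left sum_distrib_right
      by (subst sum.swap, subst sum.swap) (simp add: ac_simps sum.swap[of _ _ T])
    also have "\<dots> = (\<Sum>t\<in>T. c t * - (4 * p * (p + 1) * \<delta> * \<rho> t x z powr (- p - 2))) * K z"
      by (intro arg_cong2[where f="(*)"] sum.cong refl key)
    also have "\<dots> = - ((\<Sum>t\<in>T. c t * (4 * p * (p + 1) * \<delta> * \<rho> t x z powr (- p - 2))) * K z)"
      by (simp add: sum_negf)
    finally show "(\<Sum>i\<in>J. e i * (\<Sum>b\<in>Basis. ?f2 i b i b x z)) = - ((\<Sum>t\<in>T. c t * (4 * p * (p + 1) * \<delta> * \<rho> t x z powr (- p - 2))) * K z)" .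
  qed
  finally show "(\<Sum>i\<in>J. e i * (\<Sum>b\<in>Basis. pderiv_at i b (pderiv_at i b F) x))
      = - (integral (cbox l u) (\<lambda>z. (\<Sum>t\<in>T. c t * (4 * p * (p + 1) * \<delta> * \<rho> t x z powr (- p - 2))) * K z))"
    by simp
qed

subsection \<open>Measurability on configurations\<close>

lemma space_configs[simp]: "space configs = config_set"
  unfolding configs_def by (rule space_measure_of) (auto simp: config_set_def)

lemma config_sets_basic:
  "B \<in> sets borel \<Longrightarrow> {q \<in> config_set. i \<in> dom q \<and> the (q i) \<in> B} \<in> sets configs"
  unfolding configs_def by (subst sets_measure_of) (auto simp: config_set_def)

lemma measurable_dom_member[measurable]: "Measurable.pred configs (\<lambda>q. i \<in> dom q)"
proof -
  have "{q \<in> config_set. i \<in> dom q \<and> the (q i) \<in> UNIV} \<in> sets configs"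
    by (rule config_sets_basic) simp
  then show ?thesis by (simp add: pred_def)
qed

text \<open>Off the domain \<open>the (q i)\<close> is the fixed value \<open>the None\<close>. The
  preimage of \<open>B\<close> is therefore a generating set, enlarged by all configurations without
  label \<open>i\<close> if that value happens to lie in \<open>B\<close>.\<close>

lemma measurable_particle[measurable]:
  fixes i :: "'i::countable"
  shows "(\<lambda>q :: ('i, 'a::euclidean_space) config. the (q i)) \<in> configs \<rightarrow>\<^sub>M borel"
proof (rule measurableI)
  fix B :: "('a \<times> real) set" assume B: "B \<in> sets borel"
  have "(\<lambda>q. the (q i)) -` B \<inter> space configs =
     {q \<in> config_set. i \<in> dom q \<and> the (q i) \<in> B} \<union> (if the None \<in> B then {q \<in> space configs. i \<notin> dom q} else {})"
    by (intro set_eqI, rename_tac q, case_tac "i \<in> dom q") (auto simp: domIff simp del: not_None_eq)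
  also have "\<dots> \<in> sets configs"
  proof -
    have "{q \<in> space configs. i \<notin> dom q} \<in> sets configs" by measurable
    then show ?thesis using config_sets_basic[OF B] by (intro sets.Un) auto
  qed
  finally show "(\<lambda>q. the (q i)) -` B \<inter> space (configs :: ('i, 'a) config measure) \<in> sets configs" .
qed simp

lemma measurable_loc[measurable]: "(\<lambda>q. loc q i) \<in> configs \<rightarrow>\<^sub>M borel"
  unfolding loc_def by (rule measurable_compose[OF measurable_particle]) (simp add: borel_prod[symmetric])

lemma measurable_mass[measurable]: "(\<lambda>q. mass q i) \<in> configs \<rightarrow>\<^sub>M borel"
  unfolding mass_def by (rule measurable_compose[OF measurable_particle]) (simp add: borel_prod[symmetric])

text \<open>There are countably many finite label sets, so preimages of singletons suffice, and each
  is a countable intersection, over labels, of the events \<open>i \<in> dom q\<close> or their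
  complements.\<close>

lemma measurable_dom[measurable]: "dom \<in> configs \<rightarrow>\<^sub>M count_space (Collect finite)"
proof -
  have "countable (Collect finite :: 'a set set)"
    using countable_Collect_finite by simp
  moreover have "dom -` {J} \<inter> space configs \<in> sets configs" for J :: "'a set"
  proof -
    have "dom -` {J} \<inter> space configs = {q \<in> space configs. \<forall>i. (i \<in> dom q) = (i \<in> J)}"
      by blast
    also have "\<dots> \<in> sets configs" by measurable
    finally show ?thesis .
  qed
  ultimately show ?thesis
    by (subst measurable_count_space_eq_countable) (auto simp: config_set_def)
qed

text \<open>Sums over \<open>dom q\<close> have a random index set; splitting according to its
  countably many values leaves measurability for one fixed finite \<open>J\<close> at a
  time.\<close>

lemma measurable_split_dom:
  assumes "\<And>J. finite J \<Longrightarrow> f J \<in> configs \<rightarrow>\<^sub>M N"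
  shows "(\<lambda>q. f (dom q) q) \<in> configs \<rightarrow>\<^sub>M N"
  by (rule measurable_compose_countable'[OF _ measurable_dom]) (use assms countable_Collect_finite in auto)

text \<open>Continuity is given on the positive reals, so \<open>f\<close> is extended by 0, which
  agrees with it at the mass of every label in use. For the other labels the value is the constant
  \<open>f (snd (the None))\<close>.\<close>

lemma measurable_mass_function:
  fixes f :: "real \<Rightarrow> real"
  assumes f: "continuous_on {0<..} f"
  shows "(\<lambda>q. f (mass q i)) \<in> borel_measurable configs"
proof -
  have f0: "(\<lambda>m. if m \<in> {0<..} then f m else 0) \<in> borel_measurable borel"
    by (rule borel_measurable_continuous_on_if[OF _ f]) auto
  have "(\<lambda>q. if i \<in> dom q then (\<lambda>m. if m \<in> {0<..} then f m else 0) (mass q i) else f (snd (the None))) \<in> borel_measurable configs"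
    by (rule measurable_If[OF measurable_compose[OF measurable_mass f0] measurable_const]) (simp, rule predE, measurable)
  then show ?thesis
    by (rule measurable_cong[THEN iffD1, rotated]) (auto simp: config_set_def mass_def domIff simp del: not_None_eq)
qed

subsection \<open>Dynkin's formula for the weak generator\<close>

text \<open>
  Only the right derivative exists and \<open>g\<close> is not known to be continuous, so the difference
  quotients are integrated first; their integrals are difference quotients of a primitive of \<open>f\<close>.
\<close>

lemma right_derivative_has_integral:
  fixes f g :: "real \<Rightarrow> real"
  assumes T: "T \<ge> 0"
    and Lip: "\<And>s t. 0 \<le> s \<Longrightarrow> 0 \<le> t \<Longrightarrow> \<bar>f t - f s\<bar> \<le> C * \<bar>t - s\<bar>"
    and der: "\<And>s. 0 \<le> s \<Longrightarrow> ((\<lambda>h. (f (s + h) - f s) / h) \<longlongrightarrow> g s) (at_right 0)"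
  shows "(g has_integral (f T - f 0)) {0..T}"
proof -
  define h where "h k = 1 / real (Suc k)" for k
  have h: "h k > 0" "h k \<le> 1" for k by (auto simp: h_def)
  have h0: "h \<longlonglongrightarrow> 0"
    unfolding h_def using LIMSEQ_Suc[OF lim_const_over_n[of 1]] by simp
  have hlim: "filterlim h (at_right 0) sequentially"
    unfolding filterlim_at using h0 h(1) by (auto intro!: always_eventually simp: less_imp_neq[THEN not_sym])
  \<comment> \<open>The interval is longer by 1 to leave room for the shifts \<open>h k\<close>,
    which do not exceed 1.\<close>
  have "continuous_on {0..T + 1} f"
  proof (rule lipschitz_on_continuous_on)
    have "C \<ge> 0" using Lip[of 0 1] by simp
    then show "C-lipschitz_on {0..T + 1} f"
      by (auto simp: lipschitz_on_def dist_real_def intro!: Lip)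
  qed
  then obtain \<Phi> where \<Phi>: "\<And>x. x \<in> {0..T + 1} \<Longrightarrow> (\<Phi> has_vector_derivative f x) (at x within {0..T + 1})"
    using antiderivative_continuous by blast
  have int1: "((\<lambda>s. f (s + a)) has_integral (\<Phi> (T + a) - \<Phi> a)) {0..T}" if a: "0 \<le> a" "a \<le> 1" for a
  proof -
    have "((\<lambda>s. f (s + a)) has_integral (\<Phi> (T + a) - \<Phi> (0 + a))) {0..T}"
    proof (rule fundamental_theorem_of_calculus[OF T, where f="\<lambda>s. \<Phi> (s + a)"])
      fix s assume s: "s \<in> {0..T}"
      have "((\<Phi> \<circ> (\<lambda>s. s + a)) has_vector_derivative 1 *\<^sub>R f (s + a)) (at s within {0..T})"
      proof (rule vector_diff_chain_within)
        show "((\<lambda>s. s + a) has_vector_derivative 1) (at s within {0..T})"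
          by (auto intro!: derivative_eq_intros)
        show "(\<Phi> has_vector_derivative f (s + a)) (at (s + a) within (\<lambda>s. s + a) ` {0..T})"
          using \<Phi>[of "s + a"] s a by (rule_tac has_vector_derivative_within_subset) auto
      qed
      then show "((\<lambda>s. \<Phi> (s + a)) has_vector_derivative f (s + a)) (at s within {0..T})"
        by (simp add: o_def)
    qed
    then show ?thesis by simp
  qed
  let ?q = "\<lambda>k s. (f (s + h k) - f s) / h k"
  have int2: "(?q k has_integral ((\<Phi> (T + h k) - \<Phi> (h k)) - (\<Phi> T - \<Phi> 0)) / h k) {0..T}" for k
    using has_integral_diff[OF int1[of "h k"] int1[of 0]] h[of k]
    by (auto intro!: has_integral_divide)
  have bound: "norm (?q k s) \<le> C" if "s \<in> {0..T}" for k s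
    using Lip[of s "s + h k"] that h[of k] by (simp add: divide_le_eq)
  have conv: "(\<lambda>k. ?q k s) \<longlonglongrightarrow> g s" if "s \<in> {0..T}" for s
    using filterlim_compose[OF der hlim] that by auto
  have "(?q k) integrable_on {0..T}" for k
    using int2 by (auto simp: integrable_on_def)
  note dominated_convergence[OF this _ bound conv, OF integrable_const_ivl]
  moreover have "(\<lambda>k. integral {0..T} (?q k)) \<longlonglongrightarrow> f T - f 0"
  proof -
    have lim: "(\<lambda>k. (\<Phi> (x + h k) - \<Phi> x) / h k) \<longlonglongrightarrow> f x" if x: "0 \<le> x" "x \<le> T" for x
    proof -
      have "((\<lambda>y. (\<Phi> y - \<Phi> x) / (y - x)) \<longlongrightarrow> f x) (at x within {0..T + 1})"
        using \<Phi>[of x] x by (simp add: has_real_derivative_iff_has_vector_derivative[symmetric] has_field_derivative_iff)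
      moreover have "filterlim (\<lambda>k. x + h k) (at x within {0..T + 1}) sequentially"
        unfolding filterlim_at using x h tendsto_add[OF tendsto_const[of x] h0]
        by (auto intro!: always_eventually simp: add_mono less_imp_le order.strict_implies_not_eq)
           (smt (verit) h)+
      ultimately have "(\<lambda>k. (\<Phi> (x + h k) - \<Phi> x) / (x + h k - x)) \<longlonglongrightarrow> f x"
        by (rule filterlim_compose)
      then show ?thesis by simp
    qed
    have "(\<lambda>k. (\<Phi> (T + h k) - \<Phi> T) / h k - (\<Phi> (0 + h k) - \<Phi> 0) / h k) \<longlonglongrightarrow> f T - f 0"
      using T by (intro tendsto_diff lim) auto
    moreover have "integral {0..T} (?q k) = (\<Phi> (T + h k) - \<Phi> T) / h k - (\<Phi> (0 + h k) - \<Phi> 0) / h k" for k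
      using integral_unique[OF int2[of k]] by (simp add: diff_divide_distrib)
    ultimately show ?thesis by simp
  qed
  ultimately show ?thesis
    using LIMSEQ_unique has_integral_iff by blast
qed

text \<open>\<open>max 0 t\<close> extends the process constantly to negative times, giving a map on
  the product with the whole Borel line, to which Fubini for \<open>lborel\<close> applies.\<close>

lemma markov_process_measurable_pair:
  assumes X: "markov_process M S P X"
  shows "(\<lambda>(t, \<omega>). X (max 0 t) \<omega>) \<in> borel \<Otimes>\<^sub>M M \<rightarrow>\<^sub>M S"
proof -
  have "(\<lambda>(t, \<omega>). (max 0 t, \<omega>)) \<in> (borel :: real measure) \<Otimes>\<^sub>M M \<rightarrow>\<^sub>M restrict_space borel {0..} \<Otimes>\<^sub>M M"
    unfolding split_beta by (intro measurable_Pair measurable_restrict_space2) auto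
  from measurable_compose[OF this, of "\<lambda>(t, \<omega>). X t \<omega>" S] X show ?thesis
    by (simp add: markov_process_def split_beta)
qed

lemma markov_process_measurable:
  assumes X: "markov_process M S P X" and "r \<ge> 0"
  shows "X r \<in> M \<rightarrow>\<^sub>M S"
proof -
  have "(\<lambda>\<omega>. case (r, \<omega>) of (t, \<omega>) \<Rightarrow> X (max 0 t) \<omega>) \<in> M \<rightarrow>\<^sub>M S"
    by (intro measurable_compose[OF _ markov_process_measurable_pair[OF X]] measurable_Pair1') simp
  then show ?thesis using assms(2) by (simp add: max_def)
qed

text \<open>The hypothesis concerns conditional probabilities of single events. Integrated over
  \<open>?B\<close>, which belongs to the filtration at time \<open>s\<close> because 0 \<le>
  \<open>s\<close>, it says that two measures agree: the law of \<open>X (s + t)\<close> on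
  \<open>?B\<close>, and the law of \<open>X s\<close> on \<open>?B\<close> followed by the kernel
  \<open>P t\<close>. Integrating \<open>f\<close> against both extends it to nonnegative functions.
  The event at time 0 is carried along for the later localisation.\<close>

lemma markov_nn_integral:
  assumes X: "markov_process M S P X" and P: "P t \<in> S \<rightarrow>\<^sub>M prob_algebra S"
    and st: "0 \<le> s" "0 \<le> t" and A: "A \<in> sets S" and f: "f \<in> borel_measurable S"
  shows "(\<integral>\<^sup>+\<omega>. indicator (X 0 -` A \<inter> space M) \<omega> * f (X (s + t) \<omega>) \<partial>M)
    = (\<integral>\<^sup>+\<omega>. indicator (X 0 -` A \<inter> space M) \<omega> * (\<integral>\<^sup>+y. f y \<partial>P t (X s \<omega>)) \<partial>M)"
proof -
  interpret prob_space M using X by (simp add: markov_process_def)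
  note Xm = markov_process_measurable[OF X]
  have [measurable]: "X s \<in> M \<rightarrow>\<^sub>M S" "X (s + t) \<in> M \<rightarrow>\<^sub>M S" "X 0 \<in> M \<rightarrow>\<^sub>M S" using Xm st by auto
  note [measurable] = P[THEN measurable_prob_algebraD] A f
  let ?B = "X 0 -` A \<inter> space M"
  have [measurable]: "?B \<in> sets M" by measurable
  let ?F = "natural_filtration M S X s"
  have "{X r -` A \<inter> space M | r A. 0 \<le> r \<and> r \<le> s \<and> A \<in> sets S} \<subseteq> sets M"
    using Xm by (auto intro: measurable_sets)
  then have sub: "subalgebra M ?F"
    unfolding subalgebra_def natural_filtration_def
    by (subst sets_measure_of) (auto intro!: sets.sigma_sets_subset simp: space_measure_of_conv)
  interpret F: finite_measure_subalgebra M ?F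
    by unfold_locales (rule sub)
  have BF: "?B \<in> sets ?F"
    unfolding natural_filtration_def
    by (subst sets_measure_of) (use A st in \<open>blast intro: sigma_sets.Basic order_refl\<close>)+
  let ?M = "density M (indicator ?B)"
  have Pp: "prob_space (P t x)" "sets (P t x) = sets S" if "x \<in> space S" for x
    using measurable_space[OF P that] by (auto simp: space_prob_algebra)
  have "distr ?M S (X (s + t)) = ?M \<bind> (\<lambda>\<omega>. P t (X s \<omega>))"
  proof (rule measure_eqI)
    have ne: "space ?M \<noteq> {}" using not_empty by simp
    show sets_eq: "sets (distr ?M S (X (s + t))) = sets (?M \<bind> (\<lambda>\<omega>. P t (X s \<omega>)))"
      using Pp(2) measurable_space[OF Xm[OF st(1)]] ne by (subst sets_bind[where N=S]) auto
    fix C assume "C \<in> sets (distr ?M S (X (s + t)))"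
    then have C[measurable]: "C \<in> sets S" by simp
    let ?i = "indicator (X (s + t) -` C \<inter> space M) :: _ \<Rightarrow> real"
    have [measurable]: "X (s + t) -` C \<inter> space M \<in> sets M" by measurable
    have ii: "integrable M ?i"
      by (intro integrable_real_indicator) (auto simp: emeasure_eq_measure)
    have pm: "(\<lambda>\<omega>. measure (P t (X s \<omega>)) C) \<in> borel_measurable M"
      by measurable
    have pi: "integrable M (\<lambda>\<omega>. indicator ?B \<omega> * measure (P t (X s \<omega>)) C)"
      using pm by (intro integrable_const_bound[where B=1])
        (auto simp: indicator_def intro!: prob_space.prob_le_1 Pp measurable_space[OF Xm[OF st(1)]])
    have "(LINT \<omega>:?B|M. ?i \<omega>) = (LINT \<omega>:?B|M. real_cond_exp M ?F ?i \<omega>)"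
      by (rule F.real_cond_exp_intA[OF ii BF])
    also have "\<dots> = (LINT \<omega>:?B|M. measure (P t (X s \<omega>)) C)"
      unfolding set_lebesgue_integral_def
    proof (rule integral_cong_AE)
      have "AE \<omega> in M. real_cond_exp M ?F ?i \<omega> = measure (P t (X s \<omega>)) C"
        using X st C unfolding markov_process_def by blast
      then show "AE \<omega> in M. indicat_real ?B \<omega> *\<^sub>R real_cond_exp M ?F ?i \<omega> = indicat_real ?B \<omega> *\<^sub>R measure (P t (X s \<omega>)) C"
        by eventually_elim simp
    qed (use pm in measurable)
    finally have eq: "(LINT \<omega>:?B|M. ?i \<omega>) = (LINT \<omega>:?B|M. measure (P t (X s \<omega>)) C)" .
    have "emeasure (distr ?M S (X (s + t))) C = (\<integral>\<^sup>+\<omega>. indicator ?B \<omega> * indicator (X (s + t) -` C \<inter> space M) \<omega> \<partial>M)"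
      by (subst emeasure_distr) (auto simp: emeasure_density)
    also have "\<dots> = (\<integral>\<^sup>+\<omega>. ennreal (indicator ?B \<omega> * ?i \<omega>) \<partial>M)"
      by (intro nn_integral_cong) (auto simp: indicator_def)
    also have "\<dots> = ennreal (LINT \<omega>:?B|M. ?i \<omega>)"
      unfolding set_lebesgue_integral_def
      using integrable_mult_indicator[OF _ ii, of ?B]
      by (subst nn_integral_eq_integral) (auto simp: indicator_def)
    also have "\<dots> = ennreal (LINT \<omega>:?B|M. measure (P t (X s \<omega>)) C)"
      by (simp only: eq)
    also have "\<dots> = (\<integral>\<^sup>+\<omega>. ennreal (indicator ?B \<omega> * measure (P t (X s \<omega>)) C) \<partial>M)"
      unfolding set_lebesgue_integral_def using pi
      by (subst nn_integral_eq_integral) (auto simp: indicator_def)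
    also have "\<dots> = (\<integral>\<^sup>+\<omega>. indicator ?B \<omega> * emeasure (P t (X s \<omega>)) C \<partial>M)"
      using Pp measurable_space[OF Xm[OF st(1)]]
      by (intro nn_integral_cong) (auto simp: indicator_def prob_space_def finite_measure.emeasure_eq_measure)
    also have "\<dots> = emeasure (?M \<bind> (\<lambda>\<omega>. P t (X s \<omega>))) C"
      using ne by (subst emeasure_bind[where N=S]) (auto simp: nn_integral_density)
    finally show "emeasure (distr ?M S (X (s + t))) C = emeasure (?M \<bind> (\<lambda>\<omega>. P t (X s \<omega>))) C" .
  qed
  then have "(\<integral>\<^sup>+x. f x \<partial>distr ?M S (X (s + t))) = (\<integral>\<^sup>+x. f x \<partial>(?M \<bind> (\<lambda>\<omega>. P t (X s \<omega>))))" by simp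
  then show ?thesis
    by (subst (asm) nn_integral_distr, simp, simp, subst (asm) nn_integral_bind[where B=S])
       (auto simp: nn_integral_density)
qed

text \<open>Measurability of \<open>L F\<close> is hard to see from a differential expression; it is
  inherited from the semigroup, as a limit of difference quotients along the times
  \<open>1 / Suc k\<close>.\<close>

lemma has_generator_on_measurable:
  assumes P: "transition_semigroup S P" and L: "has_generator_on S P L D" and F: "F \<in> D"
    and [measurable]: "F \<in> borel_measurable S"
  shows "L F \<in> borel_measurable S"
proof (rule borel_measurable_LIMSEQ_real)
  let ?q = "\<lambda>k x. ((\<integral>y. F y \<partial>P (1 / real (Suc k)) x) - F x) / (1 / real (Suc k))"
  show "?q k \<in> borel_measurable S" for k
  proof -
    have [measurable]: "P (1 / real (Suc k)) \<in> S \<rightarrow>\<^sub>M subprob_algebra S"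
      using P by (auto simp: transition_semigroup_def intro!: measurable_prob_algebraD)
    show ?thesis by measurable
  qed
  show "(\<lambda>k. ?q k x) \<longlonglongrightarrow> L F x" if "x \<in> space S" for x
  proof -
    have "((\<lambda>t. ((\<integral>y. F y \<partial>P t x) - F x) / t) \<longlongrightarrow> L F x) (at_right 0)"
      using L F that by (auto simp: has_generator_on_def)
    moreover have "filterlim (\<lambda>k. 1 / real (Suc k)) (at_right 0) sequentially"
      unfolding filterlim_at using LIMSEQ_Suc[OF lim_const_over_n[of "1::real"]]
      by (auto intro!: always_eventually)
    ultimately show ?thesis by (rule filterlim_compose)
  qed
qed

text \<open>With \<open>f s\<close> the expectation of \<open>F (X s)\<close> on the initial event,
  the Markov property writes \<open>f (s + h) - f s\<close> as the expectation of the semigroup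
  increment at \<open>X s\<close>. The uniform bound in \<open>has_generator_on\<close> makes
  \<open>f\<close> Lipschitz and dominates the difference quotients, so \<open>f\<close> has the
  expected right derivative, which integrates to the claim. The initial event is what allows a start
  in an absorbing set.\<close>

lemma dynkin_formula:
  assumes X: "markov_process M S P X" and P: "transition_semigroup S P"
    and L: "has_generator_on S P L D" and F: "F \<in> D"
    and Fm[measurable]: "F \<in> borel_measurable S"
    and Fb: "\<And>x. x \<in> space S \<Longrightarrow> 0 \<le> F x" "\<And>x. x \<in> space S \<Longrightarrow> F x \<le> C"
    and A: "A \<in> sets S" and T: "T \<ge> 0"
  shows "((\<lambda>s. LINT \<omega>:X 0 -` A \<inter> space M|M. L F (X s \<omega>)) has_integral
          (LINT \<omega>:X 0 -` A \<inter> space M|M. F (X T \<omega>)) - (LINT \<omega>:X 0 -` A \<inter> space M|M. F (X 0 \<omega>))) {0..T}"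
proof -
  interpret prob_space M using X by (simp add: markov_process_def)
  note Xm[measurable] = markov_process_measurable[OF X]
  note Xs = measurable_space[OF Xm]
  let ?B = "X 0 -` A \<inter> space M"
  have B[measurable]: "?B \<in> sets M" using measurable_sets[OF Xm A] by simp
  define f where "f s = (LINT \<omega>:?B|M. F (X s \<omega>))" for s
  obtain C' where C': "\<And>t x. t > 0 \<Longrightarrow> x \<in> space S \<Longrightarrow> \<bar>((\<integral>y. F y \<partial>P t x) - F x) / t\<bar> \<le> C'"
    using L F unfolding has_generator_on_def by blast
  have [measurable]: "L F \<in> borel_measurable S"
    by (rule has_generator_on_measurable[OF P L F Fm])
  have Pm: "P t \<in> S \<rightarrow>\<^sub>M prob_algebra S" if "t \<ge> 0" for t
    using P that by (simp add: transition_semigroup_def)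
  have Pp: "prob_space (P t x)" "sets (P t x) = sets S" if "x \<in> space S" "t \<ge> 0" for x t
    using measurable_space[OF Pm that(1)] that by (auto simp: space_prob_algebra)
  have Psp: "space (P t x) = space S" if "x \<in> space S" "t \<ge> 0" for x t
    using Pp(2)[OF that] by (rule sets_eq_imp_space_eq)
  define PF where "PF t x = (\<integral>y. F y \<partial>P t x)" for t x
  have PFm: "PF t \<in> borel_measurable S" if "t \<ge> 0" for t
    unfolding PF_def using measurable_prob_algebraD[OF Pm[OF that]] by measurable
  have PFi: "(\<integral>\<^sup>+y. ennreal (F y) \<partial>P t x) = ennreal (PF t x)" "0 \<le> PF t x" "PF t x \<le> C" if x: "x \<in> space S" and t: "t \<ge> 0" for x t
  proof -
    interpret Q: prob_space "P t x" using Pp[OF x t] by simp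
    have [measurable]: "F \<in> borel_measurable (P t x)"
      using Fm measurable_cong_sets[OF Pp(2)[OF x t] refl] by blast
    have i: "integrable (P t x) F"
      using Fb Psp[OF x t] by (intro Q.integrable_const_bound[where B=C]) (auto intro!: AE_I2 simp: abs_of_nonneg)
    show "(\<integral>\<^sup>+y. ennreal (F y) \<partial>P t x) = ennreal (PF t x)"
      unfolding PF_def using i Fb Psp[OF x t] by (intro nn_integral_eq_integral) (auto intro!: AE_I2)
    show "0 \<le> PF t x" unfolding PF_def using Fb Psp[OF x t] by (intro integral_nonneg_AE) (auto intro!: AE_I2)
    show "PF t x \<le> C" unfolding PF_def using i Fb Psp[OF x t] by (intro Q.integral_le_const) (auto intro!: AE_I2)
  qed
  have si: "set_integrable M ?B (\<lambda>\<omega>. G (X s \<omega>))"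
    if [measurable]: "G \<in> borel_measurable S" and s: "s \<ge> 0" and G: "\<And>x. x \<in> space S \<Longrightarrow> 0 \<le> G x \<and> G x \<le> C" for G s
  proof -
    have [measurable]: "X s \<in> M \<rightarrow>\<^sub>M S" using Xm s by simp
    show ?thesis
      unfolding set_integrable_def
      by (rule integrable_mult_indicator[OF B], rule integrable_const_bound[where B=C])
         (use G Xs[OF s] in \<open>auto intro!: AE_I2\<close>)
  qed
  have nn: "(\<integral>\<^sup>+\<omega>. indicator ?B \<omega> * ennreal (G (X s \<omega>)) \<partial>M) = ennreal (LINT \<omega>:?B|M. G (X s \<omega>))"
    if Gm: "G \<in> borel_measurable S" and s: "s \<ge> 0" and G: "\<And>x. x \<in> space S \<Longrightarrow> 0 \<le> G x \<and> G x \<le> C" for G s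
  proof -
    have "(\<integral>\<^sup>+\<omega>. indicator ?B \<omega> * ennreal (G (X s \<omega>)) \<partial>M) = (\<integral>\<^sup>+\<omega>. ennreal (indicator ?B \<omega> *\<^sub>R G (X s \<omega>)) \<partial>M)"
      by (intro nn_integral_cong) (auto simp: indicator_def)
    also have "\<dots> = ennreal (LINT \<omega>:?B|M. G (X s \<omega>))"
      unfolding set_lebesgue_integral_def using si[OF Gm s G] Xs[OF s] G
      by (intro nn_integral_eq_integral) (auto intro!: AE_I2 simp: set_integrable_def)
    finally show ?thesis .
  qed
  have step: "f (s + t) = (LINT \<omega>:?B|M. PF t (X s \<omega>))" if st: "s \<ge> 0" "t \<ge> 0" for s t
  proof -
    \<comment> \<open>The Markov identity is available for nonnegative integrals;
      \<open>F \<ge> 0\<close> permits the return to real ones by injectivity of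
      \<open>ennreal\<close>.\<close>
    have "ennreal (f (s + t)) = (\<integral>\<^sup>+\<omega>. indicator ?B \<omega> * ennreal (F (X (s + t) \<omega>)) \<partial>M)"
      unfolding f_def using st Fb by (intro nn[symmetric]) auto
    also have "\<dots> = (\<integral>\<^sup>+\<omega>. indicator ?B \<omega> * (\<integral>\<^sup>+y. ennreal (F y) \<partial>P t (X s \<omega>)) \<partial>M)"
      by (rule markov_nn_integral[OF X Pm[OF st(2)] st A]) measurable
    also have "\<dots> = (\<integral>\<^sup>+\<omega>. indicator ?B \<omega> * ennreal (PF t (X s \<omega>)) \<partial>M)"
      using PFi Xs st by (intro nn_integral_cong) auto
    also have "\<dots> = ennreal (LINT \<omega>:?B|M. PF t (X s \<omega>))"
      using st PFi PFm by (intro nn) auto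
    finally show ?thesis
    proof (subst (asm) ennreal_inj)
      show "0 \<le> f (s + t)" unfolding f_def set_lebesgue_integral_def
        using Fb Xs st by (intro integral_nonneg_AE) (auto intro!: AE_I2 simp: indicator_def)
      show "0 \<le> (LINT \<omega>:?B|M. PF t (X s \<omega>))" unfolding set_lebesgue_integral_def
        using PFi Xs st by (intro integral_nonneg_AE) (auto intro!: AE_I2 simp: indicator_def)
    qed
  qed
  have diff: "(f (s + h) - f s) / h = (LINT \<omega>|M. indicator ?B \<omega> * ((PF h (X s \<omega>) - F (X s \<omega>)) / h))" if "s \<ge> 0" "h > 0" for s h
  proof -
    have "f (s + h) - f s = (LINT \<omega>:?B|M. PF h (X s \<omega>) - F (X s \<omega>))"
      unfolding step[OF that(1) less_imp_le[OF that(2)]] unfolding f_def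
      using that Fb PFi PFm by (intro set_integral_diff(2)[symmetric] si) auto
    then show ?thesis
      unfolding set_lebesgue_integral_def by (simp flip: integral_divide_zero)
  qed
  have bd: "norm (indicator ?B \<omega> * ((PF h (X s \<omega>) - F (X s \<omega>)) / h)) \<le> C'" if "s \<ge> 0" "h > 0" "\<omega> \<in> space M" for s h \<omega>
  proof -
    have "\<bar>(PF h (X s \<omega>) - F (X s \<omega>)) / h\<bar> \<le> C'"
      unfolding PF_def using that Xs by (intro C') auto
    moreover from this have "0 \<le> C'" by (meson abs_ge_zero order_trans)
    ultimately show ?thesis by (auto simp: indicator_def)
  qed
  have mq: "(\<lambda>\<omega>. indicator ?B \<omega> * ((PF h (X s \<omega>) - F (X s \<omega>)) / h)) \<in> borel_measurable M" if "s \<ge> 0" "h > 0" for s h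
  proof -
    have [measurable]: "X s \<in> M \<rightarrow>\<^sub>M S" "PF h \<in> borel_measurable S" using that Xm PFm by auto
    show ?thesis by (intro borel_measurable_times borel_measurable_indicator B) measurable
  qed
  have "((\<lambda>s. LINT \<omega>:?B|M. L F (X s \<omega>)) has_integral (f T - f 0)) {0..T}"
  proof (rule right_derivative_has_integral[OF T])
    have le: "\<bar>f (s + h) - f s\<bar> \<le> C' * h" if "s \<ge> 0" "h > 0" for s h
    proof -
      let ?g = "\<lambda>\<omega>. indicator ?B \<omega> * ((PF h (X s \<omega>) - F (X s \<omega>)) / h)"
      have i: "integrable M ?g"
        using bd[OF that] mq[OF that] by (intro integrable_const_bound[where B=C']) (auto intro!: AE_I2)
      have "norm (LINT \<omega>|M. ?g \<omega>) \<le> (LINT \<omega>|M. norm (?g \<omega>))"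
        by (rule integral_norm_bound)
      also have "\<dots> \<le> C'"
        using bd[OF that] by (intro integral_le_const integrable_norm i) (auto intro!: AE_I2)
      finally have "norm (LINT \<omega>|M. ?g \<omega>) \<le> C'" .
      then have "\<bar>(f (s + h) - f s) / h\<bar> \<le> C'"
        by (simp only: diff[OF that] real_norm_def)
      then show ?thesis using that by (simp add: abs_divide divide_le_eq)
    qed
    show "\<bar>f t - f s\<bar> \<le> C' * \<bar>t - s\<bar>" if "0 \<le> s" "0 \<le> t" for s t
      using le[of s "t - s"] le[of t "s - t"] that
      by (cases s t rule: linorder_cases) (auto simp: abs_minus_commute)
    show "((\<lambda>h. (f (s + h) - f s) / h) \<longlongrightarrow> (LINT \<omega>:?B|M. L F (X s \<omega>))) (at_right 0)" if s: "0 \<le> s" for s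
    proof -
      have [measurable]: "X s \<in> M \<rightarrow>\<^sub>M S" using Xm s by simp
      have "((\<lambda>h. LINT \<omega>|M. indicator ?B \<omega> * ((PF h (X s \<omega>) - F (X s \<omega>)) / h)) \<longlongrightarrow> (LINT \<omega>|M. indicator ?B \<omega> * L F (X s \<omega>))) (at_right 0)"
      proof (rule tendsto_at_right_sequentially[where b=1])
        fix h :: "nat \<Rightarrow> real" assume h: "\<And>n. 0 < h n" "h \<longlonglongrightarrow> 0"
        then have hl: "filterlim h (at_right 0) sequentially"
          unfolding filterlim_at by (auto intro!: always_eventually simp: less_imp_neq[THEN not_sym])
        show "(\<lambda>n. LINT \<omega>|M. indicator ?B \<omega> * ((PF (h n) (X s \<omega>) - F (X s \<omega>)) / h n)) \<longlonglongrightarrow> (LINT \<omega>|M. indicator ?B \<omega> * L F (X s \<omega>))"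
        proof (rule integral_dominated_convergence[where w="\<lambda>_. C'"])
          show "AE \<omega> in M. (\<lambda>n. indicator ?B \<omega> * ((PF (h n) (X s \<omega>) - F (X s \<omega>)) / h n)) \<longlonglongrightarrow> indicator ?B \<omega> * L F (X s \<omega>)"
          proof (rule AE_I2)
            fix \<omega> assume "\<omega> \<in> space M"
            then have "((\<lambda>t. (PF t (X s \<omega>) - F (X s \<omega>)) / t) \<longlongrightarrow> L F (X s \<omega>)) (at_right 0)"
              unfolding PF_def using L F Xs[OF s] by (auto simp: has_generator_on_def)
            from filterlim_compose[OF this hl]
            show "(\<lambda>n. indicator ?B \<omega> * ((PF (h n) (X s \<omega>) - F (X s \<omega>)) / h n)) \<longlonglongrightarrow> indicator ?B \<omega> * L F (X s \<omega>)"
              by (intro tendsto_mult_left)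
          qed
          show "AE \<omega> in M. norm (indicator ?B \<omega> * ((PF (h n) (X s \<omega>) - F (X s \<omega>)) / h n)) \<le> C'" for n
            by (intro AE_I2 bd s h)
          show "(\<lambda>\<omega>. indicator ?B \<omega> * ((PF (h n) (X s \<omega>) - F (X s \<omega>)) / h n)) \<in> borel_measurable M" for n
            by (intro mq s h)
          show "(\<lambda>\<omega>. indicator ?B \<omega> * L F (X s \<omega>)) \<in> borel_measurable M"
            by (intro borel_measurable_times borel_measurable_indicator B) measurable
        qed simp
      qed simp
      then have "((\<lambda>h. LINT \<omega>|M. indicator ?B \<omega> * ((PF h (X s \<omega>) - F (X s \<omega>)) / h)) \<longlongrightarrow> (LINT \<omega>:?B|M. L F (X s \<omega>))) (at_right 0)"
        by (simp add: set_lebesgue_integral_def)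
      then show ?thesis
        proof (rule Lim_transform_eventually)
        show "\<forall>\<^sub>F h in at_right 0. (LINT \<omega>|M. indicator ?B \<omega> * ((PF h (X s \<omega>) - F (X s \<omega>)) / h)) = (f (s + h) - f s) / h"
          using eventually_at_right_less[of 0] by eventually_elim (rule diff[OF s, symmetric])
      qed
    qed
  qed
  then show ?thesis by (simp add: f_def)
qed

subsection \<open>Monotonicity under coagulation\<close>

text \<open>Two exponents are kept apart: the power \<open>p\<close> of \<open>\<phi>\<close> never
  changes, while that of the kernel is \<open>p\<close> for the potential and \<open>p + 2\<close>
  for its image under diffusion. Particles are given slot by slot, so that changing one of them is a
  function update.\<close>

definition tuple_weight ::
    "real \<Rightarrow> real \<Rightarrow> real \<Rightarrow> (real \<Rightarrow> real) \<Rightarrow> (real \<Rightarrow> real) \<Rightarrow> 'a::euclidean_space ^ 'k \<Rightarrow> ('k::finite \<Rightarrow> 'a \<times> real) \<Rightarrow> real" where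
  "tuple_weight \<delta> p s d \<phi> z P = (\<Prod>r\<in>UNIV. snd (P r) * \<phi> (snd (P r)) powr p) *
     (\<delta> + quad (\<lambda>r. d (snd (P r))) (\<lambda>r. fst (P r)) z) powr (- s)"

definition tuple_sum ::
    "real \<Rightarrow> real \<Rightarrow> real \<Rightarrow> (real \<Rightarrow> real) \<Rightarrow> (real \<Rightarrow> real) \<Rightarrow> ('i, 'a::euclidean_space) config \<Rightarrow> 'a ^ 'k::finite \<Rightarrow> real" where
  "tuple_sum \<delta> p s d \<phi> q z = (\<Sum>t\<in>distinct_tuples q. tuple_weight \<delta> p s d \<phi> z (\<lambda>r. the (q (t r))))"

lemma finite_distinct_tuples:
  assumes "q \<in> config_set"
  shows "finite (distinct_tuples q :: ('k::finite \<Rightarrow> 'i) set)"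
proof (rule finite_subset)
  show "(distinct_tuples q :: ('k \<Rightarrow> 'i) set) \<subseteq> PiE UNIV (\<lambda>_. dom q)"
    by (auto simp: distinct_tuples_def)
  show "finite (PiE (UNIV :: 'k set) (\<lambda>_. dom q))"
    using assms by (intro finite_PiE) (auto simp: config_set_def)
qed

lemma tuple_weight_nonneg:
  assumes "\<And>r. snd (P r) > 0"
  shows "tuple_weight \<delta> p s d \<phi> z P \<ge> 0"
  unfolding tuple_weight_def using assms
  by (intro mult_nonneg_nonneg prod_nonneg) (auto intro: less_imp_le)

text \<open>
  The monotonicity of \<open>\<phi>\<close> and \<open>\<phi> d\<close> is equivalent to that of
  \<open>\<phi> m / (A + a / d m)\<close> for all \<open>A, a \<ge> 0\<close>, which is why the kernel can only decrease
  (per unit of mass) when a particle grows.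
\<close>

lemma tuple_weight_increase_mass:
  fixes P :: "'k::finite \<Rightarrow> 'a::euclidean_space \<times> real"
  assumes \<delta>: "\<delta> > 0" and p: "p \<ge> 0"
    and d: "\<And>m. m > 0 \<Longrightarrow> d m > 0" and \<phi>: "\<And>m. m > 0 \<Longrightarrow> \<phi> m > 0"
    and anti: "antimono_on {0<..} \<phi>" "antimono_on {0<..} (\<lambda>m. \<phi> m * d m)"
    and P: "\<And>r. snd (P r) > 0" and Pr: "P r\<^sub>0 = (x, m)" and m: "m \<le> m'"
  shows "m * tuple_weight \<delta> p p d \<phi> z (P(r\<^sub>0 := (x, m'))) \<le> m' * tuple_weight \<delta> p p d \<phi> z P"
proof -
  let ?P' = "P(r\<^sub>0 := (x, m'))"
  \<comment> \<open>This isolates the growing particle: the kernel becomes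
    \<open>A + a / d m\<close> before and \<open>A + a / d m'\<close> after, with \<open>A\<close>
    and \<open>a\<close> unaffected by its mass.\<close>
  define A where "A = \<delta> + (\<Sum>r\<in>UNIV - {r\<^sub>0}. (norm (fst (P r) - z $ r))\<^sup>2 / d (snd (P r)))"
  define a where "a = (norm (x - z $ r\<^sub>0))\<^sup>2"
  define R where "R = (\<Prod>r\<in>UNIV - {r\<^sub>0}. snd (P r) * \<phi> (snd (P r)) powr p)"
  have m0: "m > 0" using P[of r\<^sub>0] Pr by simp
  have m'0: "m' > 0" using m0 m by simp
  have A: "A > 0" unfolding A_def using \<delta> d P
    by (intro add_pos_nonneg sum_nonneg divide_nonneg_nonneg) (auto intro: less_imp_le)
  have a: "a \<ge> 0" by (simp add: a_def)
  have R: "R \<ge> 0" unfolding R_def using P by (intro prod_nonneg) (simp add: less_imp_le)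
  have q: "\<delta> + quad (\<lambda>r. d (snd (P r))) (\<lambda>r. fst (P r)) z = A + a / d m"
    "\<delta> + quad (\<lambda>r. d (snd (?P' r))) (\<lambda>r. fst (?P' r)) z = A + a / d m'"
    unfolding quad_def A_def a_def
    by (simp_all add: sum.remove[of UNIV r\<^sub>0] Pr)
  have w: "(\<Prod>r\<in>UNIV. snd (P r) * \<phi> (snd (P r)) powr p) = m * \<phi> m powr p * R"
    "(\<Prod>r\<in>UNIV. snd (?P' r) * \<phi> (snd (?P' r)) powr p) = m' * \<phi> m' powr p * R"
    unfolding R_def by (simp_all add: prod.remove[of UNIV r\<^sub>0] Pr)
  have pos: "A + a / d m > 0" "A + a / d m' > 0"
    using A a d[OF m0] d[OF m'0] by (auto intro!: add_pos_nonneg)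
  have le1: "\<phi> m' \<le> \<phi> m" and le2: "\<phi> m' * d m' \<le> \<phi> m * d m"
    using anti m m0 by (auto simp: monotone_on_def)
  \<comment> \<open>Division of \<open>\<phi> m' * d m' \<le> \<phi> m * d m\<close> by
    \<open>d m * d m'\<close>. This handles the part multiplied by \<open>a\<close>, monotonicity of
    \<open>\<phi>\<close> the part multiplied by \<open>A\<close>.\<close>
  have "\<phi> m' / d m \<le> \<phi> m / d m'"
    using le2 d[OF m0] d[OF m'0] by (simp add: field_simps)
  then have "\<phi> m' * A + a * (\<phi> m' / d m) \<le> \<phi> m * A + a * (\<phi> m / d m')"
    using le1 A a by (intro add_mono mult_left_mono mult_right_mono) auto
  then have "\<phi> m' * (A + a / d m) \<le> \<phi> m * (A + a / d m')"
    by (simp add: algebra_simps)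
  then have "\<phi> m' / (A + a / d m') \<le> \<phi> m / (A + a / d m)"
    using pos by (simp add: pos_divide_le_eq pos_le_divide_eq mult.commute)
  then have "(\<phi> m' / (A + a / d m')) powr p \<le> (\<phi> m / (A + a / d m)) powr p"
    using p \<phi>[OF m'0] pos by (intro powr_mono2) auto
  then have key: "\<phi> m' powr p * (A + a / d m') powr (- p) \<le> \<phi> m powr p * (A + a / d m) powr (- p)"
    using \<phi>[OF m0] \<phi>[OF m'0] pos by (simp add: powr_divide powr_minus_divide)
  \<comment> \<open>The cross factors \<open>m\<close> and \<open>m'\<close> of the claim complete
    the mass prefactors on both sides to the same \<open>m * m' * R\<close>.\<close>
  have "m * tuple_weight \<delta> p p d \<phi> z ?P' = (m * m' * R) * (\<phi> m' powr p * (A + a / d m') powr (- p))"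
    unfolding tuple_weight_def q w by simp
  also have "\<dots> \<le> (m * m' * R) * (\<phi> m powr p * (A + a / d m) powr (- p))"
    using key m0 m'0 R by (intro mult_left_mono) auto
  also have "\<dots> = m' * tuple_weight \<delta> p p d \<phi> z P"
    unfolding tuple_weight_def q w by simp
  finally show ?thesis .
qed

lemma dom_coagulate:
  assumes "i \<in> dom q" "j \<in> dom q" "fresh (dom q) \<notin> dom q"
  shows "dom (coagulate fresh i j q) = insert (fresh (dom q)) (dom q - {i, j})"
  using assms by (auto simp: coagulate_def)

text \<open>A tuple through the new label \<open>u\<close> comes from exactly one tuple through
  \<open>i\<close> avoiding \<open>j\<close>, by exchanging \<open>i\<close> and \<open>u\<close>.
  The transposition is an involution, so the same formula serves in both directions. Tuples through
  \<open>j\<close> have no counterpart.\<close>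

lemma distinct_tuples_coagulate:
  assumes ij: "i \<in> dom q" "j \<in> dom q" "i \<noteq> j" and u: "u = fresh (dom q)" "u \<notin> dom q"
  shows "distinct_tuples (coagulate fresh i j q) =
     {t \<in> distinct_tuples q. i \<notin> range t \<and> j \<notin> range t} \<union>
     (\<lambda>t. Transposition.transpose i u \<circ> t) ` {t \<in> distinct_tuples q. i \<in> range t \<and> j \<notin> range t}" (is "?L = ?T0 \<union> ?f ` ?Ti")
proof (intro set_eqI iffI)
  have D: "dom (coagulate fresh i j q) = insert u (dom q - {i, j})"
    using dom_coagulate ij u by metis
  have iu: "i \<noteq> u" "j \<noteq> u" using ij u by auto
  {
    fix t assume t: "t \<in> ?L"
    then have inj: "inj t" and ran: "range t \<subseteq> insert u (dom q - {i, j})"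
      by (auto simp: distinct_tuples_def D)
    show "t \<in> ?T0 \<union> ?f ` ?Ti"
    proof (cases "u \<in> range t")
      case True
      let ?t = "Transposition.transpose i u \<circ> t"
      have tr: "t r = u \<or> t r \<in> dom q - {i, j}" for r using ran by auto
      have "inj ?t" using inj by (intro inj_compose) auto
      moreover have "?t r \<in> dom q" for r
        using tr[of r] ij iu by (auto simp: Transposition.transpose_def simp del: domIff)
      moreover have "i \<in> range ?t" using True by (auto simp: image_iff Transposition.transpose_def)
      moreover have "j \<notin> range ?t" using ran iu ij(3) by (auto simp: Transposition.transpose_def split: if_splits)
      ultimately have "?t \<in> ?Ti"
        unfolding distinct_tuples_def by blast
      then have "?f ?t \<in> ?f ` ?Ti" by (rule imageI)
      moreover have "?f ?t = t" by (auto simp: fun_eq_iff)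
      ultimately show ?thesis by simp
    next
      case False
      then show ?thesis using inj ran by (auto simp: distinct_tuples_def)
    qed
  }
  {
    fix t assume "t \<in> ?T0 \<union> ?f ` ?Ti"
    then consider "t \<in> ?T0" | s where "s \<in> ?Ti" "t = ?f s" by blast
    then show "t \<in> ?L"
    proof cases
      case 1
      then show ?thesis unfolding distinct_tuples_def D by auto
    next
      case 2
      then have "inj s" and ran: "range s \<subseteq> dom q" "j \<notin> range s" by (auto simp: distinct_tuples_def)
      moreover have "inj t" unfolding 2(2) using \<open>inj s\<close> by (intro inj_compose) auto
      moreover have "t r \<in> insert u (dom q - {i, j})" for r
      proof -
        have "s r \<in> dom q" "s r \<noteq> u" "s r \<noteq> j" using ran u(2) by blast+
        then show ?thesis using 2(2) by (auto simp: Transposition.transpose_def simp del: domIff)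
      qed
      then have "range t \<subseteq> insert u (dom q - {i, j})" by blast
      ultimately show ?thesis unfolding distinct_tuples_def D by auto
    qed
  }
qed

text \<open>For tuples through \<open>i\<close>, that slot grows from \<open>mass q i\<close> to the
  sum of both masses at an unchanged location, so \<open>tuple_weight_increase_mass\<close> applies.
  The factor \<open>mass q i\<close> stays on the left, ready for an outcome chosen with probability
  proportional to this mass.\<close>

lemma tuple_sum_coagulate_le:
  fixes q :: "('i, 'a::euclidean_space) config" and z :: "'a ^ 'k::finite"
  assumes \<delta>: "\<delta> > 0" and p: "p \<ge> 0"
    and d: "\<And>m. m > 0 \<Longrightarrow> d m > 0" and \<phi>: "\<And>m. m > 0 \<Longrightarrow> \<phi> m > 0"
    and anti: "antimono_on {0<..} \<phi>" "antimono_on {0<..} (\<lambda>m. \<phi> m * d m)"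
    and q: "q \<in> config_set" and ij: "i \<in> dom q" "j \<in> dom q" "i \<noteq> j"
    and fresh: "fresh (dom q) \<notin> dom q"
  defines "W \<equiv> \<lambda>t :: 'k \<Rightarrow> 'i. tuple_weight \<delta> p p d \<phi> z (\<lambda>r. the (q (t r)))"
  shows "mass q i * tuple_sum \<delta> p p d \<phi> (coagulate fresh i j q) z
    \<le> mass q i * (\<Sum>t | t \<in> distinct_tuples q \<and> i \<notin> range t \<and> j \<notin> range t. W t)
      + (mass q i + mass q j) * (\<Sum>t | t \<in> distinct_tuples q \<and> i \<in> range t \<and> j \<notin> range t. W t)"
proof -
  let ?T0 = "{t :: 'k \<Rightarrow> 'i. t \<in> distinct_tuples q \<and> i \<notin> range t \<and> j \<notin> range t}"
  let ?Ti = "{t :: 'k \<Rightarrow> 'i. t \<in> distinct_tuples q \<and> i \<in> range t \<and> j \<notin> range t}"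
  define u where "u = fresh (dom q)"
  let ?q = "coagulate fresh i j q"
  let ?f = "\<lambda>t :: 'k \<Rightarrow> 'i. Transposition.transpose i u \<circ> t"
  have u: "u \<notin> dom q" "i \<noteq> u" "j \<noteq> u" using ij fresh by (auto simp: u_def)
  have mpos: "snd (the (q k)) > 0" if "k \<in> dom q" for k
    using q that by (auto simp: config_set_def mass_def)
  have fin: "finite ?T0" "finite ?Ti" using finite_distinct_tuples[OF q] by auto
  have disj: "?T0 \<inter> ?f ` ?Ti = {}"
  proof (intro equalityI subsetI)
    fix t assume "t \<in> ?T0 \<inter> ?f ` ?Ti"
    then obtain s r where "t \<in> distinct_tuples q" "t = ?f s" "s r = i" by auto
    then have "t r = u" "range t \<subseteq> dom q" by (auto simp: distinct_tuples_def)
    then show "t \<in> {}" using u(1) by auto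
  qed simp
  have inj: "inj_on ?f ?Ti"
    by (intro inj_onI) (metis (no_types, lifting) comp_assoc transpose_comp_involutory id_comp)
  have Q: "?q k = (if k = u then Some (loc q i, mass q i + mass q j) else if k = i \<or> k = j then None else q k)" for k
    by (auto simp: coagulate_def u_def)
  have "tuple_sum \<delta> p p d \<phi> ?q z = (\<Sum>t\<in>?T0. tuple_weight \<delta> p p d \<phi> z (\<lambda>r. the (?q (t r)))) + (\<Sum>t\<in>?Ti. tuple_weight \<delta> p p d \<phi> z (\<lambda>r. the (?q (?f t r))))"
    unfolding tuple_sum_def distinct_tuples_coagulate[where i=i and j=j and u=u and q=q and fresh=fresh, OF ij u_def u(1)]
    using fin disj inj by (subst sum.union_disjoint) (auto simp: sum.reindex)
  also have "(\<Sum>t\<in>?T0. tuple_weight \<delta> p p d \<phi> z (\<lambda>r. the (?q (t r)))) = sum W ?T0"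
  proof (rule sum.cong[OF refl])
    fix t assume "t \<in> ?T0"
    then have "t r \<noteq> i" "t r \<noteq> j" "t r \<noteq> u" for r
      using u(1) by (auto simp: distinct_tuples_def)
    then show "tuple_weight \<delta> p p d \<phi> z (\<lambda>r. the (?q (t r))) = W t"
      unfolding W_def Q by simp
  qed
  finally have eq: "tuple_sum \<delta> p p d \<phi> ?q z = sum W ?T0 + (\<Sum>t\<in>?Ti. tuple_weight \<delta> p p d \<phi> z (\<lambda>r. the (?q (?f t r))))" .
  have "mass q i * tuple_weight \<delta> p p d \<phi> z (\<lambda>r. the (?q (?f t r))) \<le> (mass q i + mass q j) * W t" if t: "t \<in> ?Ti" for t
  proof -
    from t obtain r\<^sub>0 where r0: "t r\<^sub>0 = i" by auto
    have tt: "inj t" "t r \<in> dom q" "t r \<noteq> j" "t r \<noteq> u" for r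
    proof -
      have "inj t" "range t \<subseteq> dom q" "j \<notin> range t" using t by (auto simp: distinct_tuples_def)
      then show "inj t" "t r \<in> dom q" "t r \<noteq> j" "t r \<noteq> u" using u(1) by blast+
    qed
    have eqi: "t r = i \<longleftrightarrow> r = r\<^sub>0" for r using r0 tt(1) by (auto simp: inj_def)
    have "(\<lambda>r. the (?q (?f t r))) = (\<lambda>r. the (q (t r)))(r\<^sub>0 := (loc q i, mass q i + mass q j))"
    proof
      fix r
      show "the (?q (?f t r)) = ((\<lambda>r. the (q (t r)))(r\<^sub>0 := (loc q i, mass q i + mass q j))) r"
        using tt(3,4)[of r] eqi[of r] by (cases "r = r\<^sub>0") (auto simp: Q Transposition.transpose_def)
    qed
    then show ?thesis
      unfolding W_def using mpos tt(2) r0 mpos[OF ij(2)]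
      by (simp only:, intro tuple_weight_increase_mass[OF \<delta> p d \<phi> anti]) (auto simp: loc_def mass_def)
  qed
  then have "(\<Sum>t\<in>?Ti. mass q i * tuple_weight \<delta> p p d \<phi> z (\<lambda>r. the (?q (?f t r)))) \<le> (\<Sum>t\<in>?Ti. (mass q i + mass q j) * W t)"
    by (rule sum_mono)
  then show ?thesis unfolding eq by (simp add: sum_distrib_left distrib_left)
qed

text \<open>The placement probabilities compensate the growth exactly: the outcome at
  \<open>i\<close> has probability \<open>m\<^sub>i / (m\<^sub>i + m\<^sub>j)\<close>, and its
  tuples gain at most the reciprocal factor. A tuple through just one of the two labels thus counts
  with weight at most 1, one through neither with weight 1, and those through both are lost, which
  lowers the sum.\<close>

lemma tuple_sum_coagulation:
  fixes q :: "('i, 'a::euclidean_space) config" and z :: "'a ^ 'k::finite"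
  assumes \<delta>: "\<delta> > 0" and p: "p \<ge> 0"
    and d: "\<And>m. m > 0 \<Longrightarrow> d m > 0" and \<phi>: "\<And>m. m > 0 \<Longrightarrow> \<phi> m > 0"
    and anti: "antimono_on {0<..} \<phi>" "antimono_on {0<..} (\<lambda>m. \<phi> m * d m)"
    and q: "q \<in> config_set" and ij: "i \<in> dom q" "j \<in> dom q" "i \<noteq> j"
    and fresh: "fresh (dom q) \<notin> dom q"
  shows "mass q i / (mass q i + mass q j) * tuple_sum \<delta> p p d \<phi> (coagulate fresh i j q) z
       + mass q j / (mass q i + mass q j) * tuple_sum \<delta> p p d \<phi> (coagulate fresh j i q) z
       \<le> tuple_sum \<delta> p p d \<phi> q z"
proof -
  define W where "W = (\<lambda>t :: 'k \<Rightarrow> 'i. tuple_weight \<delta> p p d \<phi> z (\<lambda>r. the (q (t r))))"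
  let ?T0 = "{t :: 'k \<Rightarrow> 'i. t \<in> distinct_tuples q \<and> i \<notin> range t \<and> j \<notin> range t}"
  let ?Ti = "{t :: 'k \<Rightarrow> 'i. t \<in> distinct_tuples q \<and> i \<in> range t \<and> j \<notin> range t}"
  let ?Tj = "{t :: 'k \<Rightarrow> 'i. t \<in> distinct_tuples q \<and> j \<in> range t \<and> i \<notin> range t}"
  have mpos: "mass q k > 0" if "k \<in> dom q" for k
    using q that by (auto simp: config_set_def)
  have W0: "W t \<ge> 0" if "t \<in> distinct_tuples q" for t
  proof -
    have "t r \<in> dom q" for r using that by (auto simp: distinct_tuples_def)
    then show ?thesis unfolding W_def using mpos by (intro tuple_weight_nonneg) (simp add: mass_def)
  qed
  have fin: "finite (distinct_tuples q :: ('k \<Rightarrow> 'i) set)" by (rule finite_distinct_tuples[OF q])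
  have "sum W ?T0 + sum W ?Ti + sum W ?Tj = sum W (?T0 \<union> ?Ti \<union> ?Tj)"
    using fin by (subst sum.union_disjoint; (subst sum.union_disjoint)?) auto
  also have "\<dots> \<le> sum W (distinct_tuples q)"
    using fin W0 by (intro sum_mono2) auto
  finally have S: "sum W ?T0 + sum W ?Ti + sum W ?Tj \<le> tuple_sum \<delta> p p d \<phi> q z"
    by (simp add: tuple_sum_def W_def)
  have T0: "{t :: 'k \<Rightarrow> 'i. t \<in> distinct_tuples q \<and> j \<notin> range t \<and> i \<notin> range t} = ?T0" by auto
  note 1 = tuple_sum_coagulate_le[where fresh=fresh, OF \<delta> p d \<phi> anti q ij fresh, of z, folded W_def]
  note 2 = tuple_sum_coagulate_le[where fresh=fresh, OF \<delta> p d \<phi> anti q ij(2,1) ij(3)[symmetric] fresh, of z, folded W_def, unfolded T0]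
  let ?M = "mass q i + mass q j"
  have M: "?M > 0" using mpos ij by (simp add: add_pos_pos)
  have "mass q i * tuple_sum \<delta> p p d \<phi> (coagulate fresh i j q) z + mass q j * tuple_sum \<delta> p p d \<phi> (coagulate fresh j i q) z
     \<le> ?M * (sum W ?T0 + sum W ?Ti + sum W ?Tj)"
    using 1 2 by (simp add: algebra_simps)
  also have "\<dots> \<le> ?M * tuple_sum \<delta> p p d \<phi> q z"
    using S M by (intro mult_left_mono) auto
  finally have "(mass q i * tuple_sum \<delta> p p d \<phi> (coagulate fresh i j q) z + mass q j * tuple_sum \<delta> p p d \<phi> (coagulate fresh j i q) z) / ?M
     \<le> tuple_sum \<delta> p p d \<phi> q z"
    using M by (simp only: pos_divide_le_eq mult.commute)
  then show ?thesis by (simp add: add_divide_distrib)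
qed

subsection \<open>Absorbing sets of configurations and test functions\<close>

lemma C1_locations_const: "C1_locations (\<lambda>_. c)"
  by (simp add: C1_locations_def pderiv_at_def)

lemma C2_locations_const: "C2_locations (\<lambda>_ :: 'b \<Rightarrow> 'a::euclidean_space. c)"
proof -
  have "pderiv_at i b (\<lambda>_. c) = (\<lambda>_. 0)" for i :: 'b and b :: 'a
    by (rule ext) (simp add: pderiv_at_def)
  then show ?thesis
    by (simp add: C2_locations_def C1_locations_const)
qed

lemma dom_relocate[simp]: "dom (relocate q x) = dom q"
  by (auto simp: relocate_def dom_def)

lemma mass_relocate[simp]: "i \<in> dom q \<Longrightarrow> mass (relocate q x) i = mass q i"
  by (auto simp: relocate_def mass_def)

lemma loc_relocate[simp]: "i \<in> dom q \<Longrightarrow> loc (relocate q x) i = x i"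
  by (auto simp: relocate_def loc_def)

lemma relocate_in_config_set[simp]: "relocate q x \<in> config_set \<longleftrightarrow> q \<in> config_set"
  by (simp add: config_set_def)

lemma distinct_tuples_relocate[simp]: "distinct_tuples (relocate q x) = distinct_tuples q"
  by (simp add: distinct_tuples_def)

lemma distinct_tuples_in_dom: "t \<in> distinct_tuples q \<Longrightarrow> t r \<in> dom q"
  by (auto simp: distinct_tuples_def)

text \<open>Each constraint serves a bound: the number of particles limits tuples and pairs, the
  lower bound on masses keeps \<open>\<phi>\<close> below \<open>\<phi> (1 / real n)\<close>, and
  the total mass limits every single mass. Locations are left free, so diffusion stays inside. For
  \<open>n = 0\<close> only the empty configuration remains.\<close>

definition stable :: "nat \<Rightarrow> ('i, 'a) config set" where
  "stable n = {q \<in> config_set. card (dom q) \<le> n \<and> (\<forall>i\<in>dom q. 1 / real n \<le> mass q i) \<and>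
     (\<Sum>i\<in>dom q. mass q i) \<le> real n}"

lemma relocate_in_stable[simp]: "relocate q x \<in> stable n \<longleftrightarrow> q \<in> stable n"
  by (simp add: stable_def)

lemma stable_mass:
  assumes q: "q \<in> stable n" and i: "i \<in> dom q"
  shows "n > 0" "1 / real n \<le> mass q i" "mass q i \<le> real n"
proof -
  have fin: "finite (dom q)" using q by (simp add: stable_def config_set_def)
  show "n > 0" using q i fin by (cases n) (auto simp: stable_def)
  show "1 / real n \<le> mass q i" using q i by (simp add: stable_def)
  have "mass q i \<le> (\<Sum>i\<in>dom q. mass q i)"
    using q i by (intro member_le_sum fin) (auto simp: stable_def config_set_def intro: less_imp_le)
  then show "mass q i \<le> real n" using q by (simp add: stable_def)
qed

lemma eventually_stable:
  assumes q: "q \<in> config_set"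
  shows "eventually (\<lambda>n. q \<in> stable n) sequentially"
proof -
  have fin: "finite (dom q)" and pos: "\<And>i. i \<in> dom q \<Longrightarrow> mass q i > 0" using q by (auto simp: config_set_def)
  have "eventually (\<lambda>n. card (dom q) \<le> n) sequentially" by (rule eventually_ge_at_top)
  moreover have "eventually (\<lambda>n. \<forall>i\<in>dom q. 1 / real n \<le> mass q i) sequentially"
  proof (rule eventually_ball_finite[OF fin], rule ballI)
    fix i assume "i \<in> dom q"
    from order_tendstoD(2)[OF lim_1_over_n pos[OF this]]
    show "eventually (\<lambda>n. 1 / real n \<le> mass q i) sequentially" by eventually_elim simp
  qed
  moreover have "eventually (\<lambda>n. (\<Sum>i\<in>dom q. mass q i) \<le> real n) sequentially"
    using filterlim_real_sequentially by (simp add: filterlim_at_top)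
  ultimately show ?thesis
    by eventually_elim (simp add: stable_def q)
qed

lemma stable_measurable[measurable]: "(stable n :: ('i::countable, 'a::euclidean_space) config set) \<in> sets configs"
proof -
  have "(\<lambda>q :: ('i, 'a) config. card (dom q) \<le> n \<and> (\<forall>i\<in>dom q. 1 / real n \<le> mass q i) \<and> (\<Sum>i\<in>dom q. mass q i) \<le> real n)
     \<in> configs \<rightarrow>\<^sub>M count_space UNIV"
    by (rule measurable_split_dom[where f="\<lambda>J q. card J \<le> n \<and> (\<forall>i\<in>J. 1 / real n \<le> mass q i) \<and> (\<Sum>i\<in>J. mass q i) \<le> real n"]) measurable
  then have "{q \<in> space configs. card (dom q) \<le> n \<and> (\<forall>i\<in>dom q. 1 / real n \<le> mass q i) \<and> (\<Sum>i\<in>dom q. mass q i) \<le> real n} \<in> sets (configs :: ('i, 'a) config measure)"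
    by (rule predE)
  then show ?thesis by (simp add: stable_def)
qed

section \<open>Bounds for the generator on functions vanishing off an absorbing set\<close>

locale coagulation_coefficients =
  fixes fresh :: "'i::countable set \<Rightarrow> 'i"
    and \<epsilon> :: real and d :: "real \<Rightarrow> real" and V :: "'a::euclidean_space \<Rightarrow> real"
    and \<alpha> :: "real \<Rightarrow> real \<Rightarrow> real" and \<phi> :: "real \<Rightarrow> real" and V_max \<alpha>_max :: real
  assumes fresh: "\<And>J. finite J \<Longrightarrow> fresh J \<notin> J"
    and V_nonneg: "\<And>x. 0 \<le> V x" and V_le: "\<And>x. V x \<le> V_max"
    and \<alpha>_nonneg: "\<And>m m'. 0 < m \<Longrightarrow> 0 < m' \<Longrightarrow> 0 \<le> \<alpha> m m'"
    and \<alpha>_le: "\<And>m m'. 0 < m \<Longrightarrow> 0 < m' \<Longrightarrow> \<alpha> m m' \<le> \<alpha>_max"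
    and d_pos: "\<And>m. 0 < m \<Longrightarrow> 0 < d m" and \<phi>_pos: "\<And>m. 0 < m \<Longrightarrow> 0 < \<phi> m"
    and d_cont: "continuous_on {0<..} d" and \<phi>_cont: "continuous_on {0<..} \<phi>"
    and \<phi>_antimono: "antimono_on {0<..} \<phi>" and \<phi>_d_antimono: "antimono_on {0<..} (\<lambda>m. \<phi> m * d m)"
begin

abbreviation "L \<equiv> generator fresh \<epsilon> d V \<alpha> :: (('i, 'a) config \<Rightarrow> real) \<Rightarrow> ('i, 'a) config \<Rightarrow> real"
abbreviation "Lc \<equiv> coagulation_generator fresh \<epsilon> V \<alpha> :: (('i, 'a) config \<Rightarrow> real) \<Rightarrow> ('i, 'a) config \<Rightarrow> real"

lemma coagulate_props:
  fixes q :: "('i, 'a) config"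
  assumes q: "q \<in> config_set" and ij: "i \<in> dom q" "j \<in> dom q" "i \<noteq> j"
  shows coagulate_in_config_set: "coagulate fresh i j q \<in> config_set"
    and card_coagulate: "Suc (card (dom (coagulate fresh i j q))) = card (dom q)"
    and coagulate_in_stable: "q \<in> stable n \<Longrightarrow> coagulate fresh i j q \<in> stable n"
proof -
  let ?q = "coagulate fresh i j q"
  define u where "u = fresh (dom q)"
  have fin: "finite (dom q)" using q by (simp add: config_set_def)
  have u: "u \<notin> dom q" using fresh[OF fin] by (simp add: u_def)
  have D: "dom ?q = insert u (dom q - {i, j})"
    unfolding u_def using ij(1,2) fresh[OF fin] by (rule dom_coagulate)
  have m: "mass ?q u = mass q i + mass q j" "\<And>k. k \<in> dom q - {i, j} \<Longrightarrow> mass ?q k = mass q k"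
    using u by (auto simp: coagulate_def mass_def u_def[symmetric])
  have pos: "mass q k > 0" if "k \<in> dom q" for k using q that by (simp add: config_set_def)
  show c: "?q \<in> config_set"
    unfolding config_set_def using fin pos ij m by (auto simp: D add_pos_pos)
  have split: "dom q = insert i (insert j (dom q - {i, j}))" using ij by blast
  have "card (dom q) = Suc (Suc (card (dom q - {i, j})))"
    using fin ij(3) by (subst split) simp
  then show card: "Suc (card (dom ?q)) = card (dom q)"
    unfolding D using fin u by (subst card_insert_disjoint) auto
  have "(\<Sum>k\<in>dom ?q. mass ?q k) = mass q i + mass q j + (\<Sum>k\<in>dom q - {i, j}. mass q k)"
    unfolding D using fin u m by (subst sum.insert) auto
  also have "\<dots> = (\<Sum>k\<in>dom q. mass q k)"
    using fin ij(3) by (subst (2) split) simp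
  finally have total: "(\<Sum>k\<in>dom ?q. mass ?q k) = (\<Sum>k\<in>dom q. mass q k)" .
  assume s: "q \<in> stable n"
  have "1 / real n \<le> mass ?q k" if "k \<in> dom ?q" for k
  proof (cases "k = u")
    case True
    then show ?thesis using m(1) stable_mass(2)[OF s ij(1)] pos[OF ij(2)] by simp
  next
    case False
    then show ?thesis using that m(2) stable_mass(2)[OF s] by (auto simp: D simp del: domIff)
  qed
  then show "?q \<in> stable n"
    using s c card total by (simp add: stable_def)
qed

lemma pair_rate_nonneg:
  fixes q :: "('i, 'a) config"
  assumes "q \<in> config_set" "i \<in> dom q" "j \<in> dom q"
  shows "0 \<le> \<epsilon> powr (-2) * V ((loc q i - loc q j) /\<^sub>R \<epsilon>) * \<alpha> (mass q i) (mass q j)"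
  using assms V_nonneg by (intro mult_nonneg_nonneg \<alpha>_nonneg) (auto simp: config_set_def)

text \<open>One coagulation removes one particle, so from \<open>Suc n\<close> particles the process
  can still jump into \<open>stable n\<close>; from more, both outcomes and \<open>q\<close> itself
  lie where \<open>F\<close> vanishes. Hence at most \<open>Suc n\<close> squared ordered pairs
  count. The factor 2 stems from a convex combination of two values minus a third.\<close>

lemma coagulation_generator_bounded:
  assumes F0: "\<And>q. q \<in> config_set - stable n \<Longrightarrow> F q = 0"
    and Fb: "\<And>q. q \<in> config_set \<Longrightarrow> \<bar>F q\<bar> \<le> C" and q: "q \<in> config_set"
  shows "\<bar>Lc F q\<bar> \<le> (real (Suc n))\<^sup>2 * (\<epsilon> powr (-2) * V_max * \<alpha>_max * (2 * C))"
proof -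
  let ?P = "{(i, j). i \<in> dom q \<and> j \<in> dom q \<and> i \<noteq> j}"
  let ?h = "\<lambda>(i, j). \<epsilon> powr (-2) * V ((loc q i - loc q j) /\<^sub>R \<epsilon>) * \<alpha> (mass q i) (mass q j) *
        (mass q i / (mass q i + mass q j) * F (coagulate fresh i j q)
         + mass q j / (mass q i + mass q j) * F (coagulate fresh j i q) - F q)"
  have fin: "finite (dom q)" and pos: "\<And>i. i \<in> dom q \<Longrightarrow> mass q i > 0" using q by (auto simp: config_set_def)
  have C: "C \<ge> 0" using Fb[OF q] by (meson abs_ge_zero order_trans)
  have Vm: "V_max \<ge> 0" using V_nonneg V_le order_trans by blast
  have am: "\<alpha>_max \<ge> 0" using \<alpha>_nonneg[of 1 1] \<alpha>_le[of 1 1] by simp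
  show ?thesis
  proof (cases "card (dom q) \<le> Suc n")
    case True
    have "\<bar>Lc F q\<bar> \<le> (\<Sum>x\<in>?P. \<bar>?h x\<bar>)"
      unfolding coagulation_generator_def by (rule sum_abs)
    also have "\<dots> \<le> (\<Sum>x\<in>?P. \<epsilon> powr (-2) * V_max * \<alpha>_max * (2 * C))"
    proof (rule sum_mono)
      fix x assume "x \<in> ?P"
      then obtain i j where x: "x = (i, j)" and ij: "i \<in> dom q" "j \<in> dom q" "i \<noteq> j" by blast
      let ?a = "mass q i / (mass q i + mass q j)" and ?b = "mass q j / (mass q i + mass q j)"
      have ab: "0 \<le> ?a" "0 \<le> ?b" "?a + ?b = 1"
        using pos[OF ij(1)] pos[OF ij(2)] by (auto simp: add_divide_distrib[symmetric])
      have "\<bar>?a * F (coagulate fresh i j q) + ?b * F (coagulate fresh j i q) - F q\<bar> \<le> ?a * C + ?b * C + C"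
      proof -
        have "\<bar>?a * F (coagulate fresh i j q)\<bar> \<le> ?a * C" "\<bar>?b * F (coagulate fresh j i q)\<bar> \<le> ?b * C"
          using ab(1,2) Fb[OF coagulate_in_config_set[OF q ij]] Fb[OF coagulate_in_config_set[OF q ij(2,1) ij(3)[symmetric]]]
          by (simp_all only: abs_mult abs_of_nonneg mult_left_mono)
        then show ?thesis using Fb[OF q] by linarith
      qed
      also have "\<dots> = 2 * C" unfolding distrib_right[symmetric] ab(3) by simp
      finally have X: "\<bar>?a * F (coagulate fresh i j q) + ?b * F (coagulate fresh j i q) - F q\<bar> \<le> 2 * C" .
      have "\<epsilon> powr (-2) * V ((loc q i - loc q j) /\<^sub>R \<epsilon>) * \<alpha> (mass q i) (mass q j) \<le> \<epsilon> powr (-2) * V_max * \<alpha>_max"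
        using V_nonneg V_le Vm \<alpha>_nonneg \<alpha>_le pos[OF ij(1)] pos[OF ij(2)] by (intro mult_mono) auto
      moreover have "\<bar>r * y\<bar> \<le> R * Y" if "0 \<le> r" "r \<le> R" "\<bar>y\<bar> \<le> Y" for r R y Y :: real
        using that by (simp add: abs_mult mult_mono')
      ultimately show "\<bar>?h x\<bar> \<le> \<epsilon> powr (-2) * V_max * \<alpha>_max * (2 * C)"
        using X pair_rate_nonneg[OF q ij(1,2)] unfolding x prod.case by blast
    qed
    also have "\<dots> = real (card ?P) * (\<epsilon> powr (-2) * V_max * \<alpha>_max * (2 * C))" by simp
    also have "\<dots> \<le> (real (Suc n))\<^sup>2 * (\<epsilon> powr (-2) * V_max * \<alpha>_max * (2 * C))"
    proof (rule mult_right_mono)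
      have "card ?P \<le> card (dom q \<times> dom q)" using fin by (intro card_mono) auto
      also have "\<dots> \<le> Suc n * Suc n" using True by (simp add: card_cartesian_product mult_mono del: mult_Suc mult_Suc_right)
      finally have "real (card ?P) \<le> real (Suc n * Suc n)" by (simp only: of_nat_le_iff)
      then show "real (card ?P) \<le> (real (Suc n))\<^sup>2" by (simp only: power2_eq_square of_nat_mult)
    qed (use Vm am C in auto)
    finally show ?thesis .
  next
    case False
    have "?h (i, j) = 0" if ij: "i \<in> dom q" "j \<in> dom q" "i \<noteq> j" for i j
    proof -
      have "coagulate fresh i j q \<notin> stable n" "coagulate fresh j i q \<notin> stable n" "q \<notin> stable n"
        using False card_coagulate[OF q ij] card_coagulate[OF q ij(2,1) ij(3)[symmetric]] by (auto simp: stable_def)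
      then have "F (coagulate fresh i j q) = 0" "F (coagulate fresh j i q) = 0" "F q = 0"
        using F0 coagulate_in_config_set[OF q ij] coagulate_in_config_set[OF q ij(2,1) ij(3)[symmetric]] q by auto
      then show ?thesis by simp
    qed
    then have "Lc F q = 0"
      unfolding coagulation_generator_def by (intro sum.neutral) auto
    then show ?thesis using Vm am C by simp
  qed
qed

text \<open>Membership in \<open>stable n\<close> depends on labels and masses only, so a function
  vanishing off the set vanishes along all relocations there and the truncation creates no
  discontinuity in the locations.\<close>

lemma diffusion_generator_not_stable:
  assumes F0: "\<And>q. q \<in> config_set - stable n \<Longrightarrow> F q = 0" and q: "q \<in> config_set - stable n"
  shows "(\<lambda>x. F (relocate q x)) = (\<lambda>_. 0)" "diffusion_generator d F q = 0"
proof -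
  show "(\<lambda>x. F (relocate q x)) = (\<lambda>_. 0)" using F0 q by auto
  then show "diffusion_generator d F q = 0"
    by (simp add: diffusion_generator_def laplacian_at_def pderiv_at_def)
qed

lemma test_functionI:
  assumes Fm: "F \<in> borel_measurable configs"
    and F0: "\<And>q. q \<in> config_set - stable n \<Longrightarrow> F q = 0"
    and Fb: "\<And>q. q \<in> stable n \<Longrightarrow> \<bar>F q\<bar> \<le> C"
    and C2: "\<And>q. q \<in> stable n \<Longrightarrow> C2_locations (\<lambda>x. F (relocate q x))"
    and Db: "\<And>q. q \<in> stable n \<Longrightarrow> \<bar>diffusion_generator d F q\<bar> \<le> C'"
  shows "F \<in> test_functions L"
proof -
  have Fb': "\<bar>F q\<bar> \<le> max C 0" if "q \<in> config_set" for q
    using Fb[of q] F0[of q] that by (cases "q \<in> stable n") auto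
  have Db': "\<bar>diffusion_generator d F q\<bar> \<le> max C' 0" if "q \<in> config_set" for q
    using Db[of q] diffusion_generator_not_stable[where F=F and n=n, OF F0] that by (cases "q \<in> stable n") auto
  have Lb: "\<bar>L F q\<bar> \<le> max C' 0 + (real (Suc n))\<^sup>2 * (\<epsilon> powr (-2) * V_max * \<alpha>_max * (2 * max C 0))" if q: "q \<in> config_set" for q
    unfolding generator_def using Db'[OF q] coagulation_generator_bounded[where F=F and n=n, OF F0 Fb' q] by linarith
  have C2': "C2_locations (\<lambda>x. F (relocate q x))" if "q \<in> config_set" for q
    using C2[of q] diffusion_generator_not_stable[where F=F and n=n, OF F0] C2_locations_const[of 0] that by (cases "q \<in> stable n") auto
  show ?thesis
    unfolding test_functions_def using Fm Fb' Lb C2' by (auto intro!: boundedI)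
qed

text \<open>Inside the set both outcomes stay inside and their probabilities sum to 1, giving 0;
  outside, a jump can only enter. The indicator is thus subharmonic for the generator, from which it
  will follow that the process does not leave the set.\<close>

lemma indicator_stable_test_function: "indicator (stable n) \<in> test_functions L"
  and generator_indicator_stable: "q \<in> config_set \<Longrightarrow> L (indicator (stable n)) q \<ge> 0"
proof -
  let ?F = "indicator (stable n) :: ('i, 'a) config \<Rightarrow> real"
  have c: "(\<lambda>x. ?F (relocate q x)) = (\<lambda>_. ?F q)" for q by (auto simp: indicator_def)
  have D: "diffusion_generator d ?F q = 0" for q
    by (simp add: diffusion_generator_def laplacian_at_def c pderiv_at_def)
  show "?F \<in> test_functions L"
    by (rule test_functionI[where n=n and C=1 and C'=0]) (auto simp: c C2_locations_const D)
  assume q: "q \<in> config_set"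
  have "Lc ?F q \<ge> 0"
    unfolding coagulation_generator_def
  proof (rule sum_nonneg)
    fix x assume "x \<in> {(i, j). i \<in> dom q \<and> j \<in> dom q \<and> i \<noteq> j}"
    then obtain i j where x: "x = (i, j)" and ij: "i \<in> dom q" "j \<in> dom q" "i \<noteq> j" by blast
    have pos: "mass q i > 0" "mass q j > 0" using q ij by (auto simp: config_set_def)
    then have "mass q i / (mass q i + mass q j) * ?F (coagulate fresh i j q) + mass q j / (mass q i + mass q j) * ?F (coagulate fresh j i q) - ?F q \<ge> 0"
      using coagulate_in_stable[OF q ij, of n] coagulate_in_stable[OF q ij(2,1) ij(3)[symmetric], of n]
      by (cases "q \<in> stable n") (auto simp: add_divide_distrib[symmetric])
    then show "0 \<le> (case x of (i, j) \<Rightarrow> \<epsilon> powr (-2) * V ((loc q i - loc q j) /\<^sub>R \<epsilon>) * \<alpha> (mass q i) (mass q j) *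
        (mass q i / (mass q i + mass q j) * ?F (coagulate fresh i j q)
         + mass q j / (mass q i + mass q j) * ?F (coagulate fresh j i q) - ?F q))"
      unfolding x prod.case by (intro mult_nonneg_nonneg[OF pair_rate_nonneg[OF q ij(1,2)]])
  qed
  then show "L ?F q \<ge> 0" by (simp add: generator_def D)
qed

end

section \<open>The regularised potential and its image under the generator\<close>

context coagulation_coefficients
begin

text \<open>The integral is over a box because differentiation under it uses compactness; in the
  application \<open>K\<close> vanishes outside the box.\<close>

definition potential ::
    "real \<Rightarrow> real \<Rightarrow> real \<Rightarrow> 'a ^ 'k::finite \<Rightarrow> 'a ^ 'k \<Rightarrow> ('a ^ 'k \<Rightarrow> real) \<Rightarrow> ('i, 'a) config \<Rightarrow> real" where
  "potential \<delta> p s l u K q = integral (cbox l u) (\<lambda>z. tuple_sum \<delta> p s d \<phi> q z * K z)"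

lemma tuple_mass_pos: "q \<in> config_set \<Longrightarrow> t \<in> distinct_tuples q \<Longrightarrow> mass q (t r) > 0"
  using distinct_tuples_in_dom by (fastforce simp: config_set_def)

lemma tuple_weight_config:
  "tuple_weight \<delta> p s d \<phi> z (\<lambda>r. the (q (t r))) = (\<Prod>r\<in>UNIV. mass q (t r) * \<phi> (mass q (t r)) powr p) *
     (\<delta> + quad (\<lambda>r. d (mass q (t r))) (\<lambda>r. loc q (t r)) z) powr (- s)"
  by (simp add: tuple_weight_def mass_def loc_def)

lemma quad_config_nonneg:
  assumes "q \<in> config_set" "t \<in> distinct_tuples q"
  shows "quad (\<lambda>r. d (mass q (t r))) (\<lambda>r. loc q (t r)) z \<ge> 0"
  using tuple_mass_pos[OF assms] d_pos by (intro quad_nonneg) auto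

lemma tuple_sum_nonneg: "q \<in> config_set \<Longrightarrow> tuple_sum \<delta> p s d \<phi> q z \<ge> 0"
  unfolding tuple_sum_def
  by (intro sum_nonneg tuple_weight_nonneg) (use tuple_mass_pos in \<open>auto simp: mass_def\<close>)

text \<open>In each slot \<open>\<phi>\<close> is at most its value at the least mass
  \<open>1 / real n\<close> and the mass is at most \<open>n\<close>; the kernel is at most
  \<open>\<delta> powr (- s)\<close>, and there are at most \<open>n ^ k\<close> tuples.\<close>

lemma tuple_sum_le:
  fixes z :: "'a ^ 'k::finite" and q :: "('i, 'a) config"
  assumes \<delta>: "\<delta> > 0" and ps: "0 \<le> p" "0 \<le> s" and q: "q \<in> stable n"
  shows "tuple_sum \<delta> p s d \<phi> q z \<le> real n ^ CARD('k) * ((real n * \<phi> (1 / real n) powr p) ^ CARD('k) * \<delta> powr (- s))"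
proof -
  let ?C = "(real n * \<phi> (1 / real n) powr p) ^ CARD('k) * \<delta> powr (- s)"
  have qc: "q \<in> config_set" using q by (simp add: stable_def)
  have "tuple_weight \<delta> p s d \<phi> z (\<lambda>r. the (q (t r))) \<le> ?C" if t: "t \<in> distinct_tuples q" for t :: "'k \<Rightarrow> 'i"
    unfolding tuple_weight_config
  proof (rule mult_mono)
    have m: "mass q (t r) > 0" "1 / real n \<le> mass q (t r)" "mass q (t r) \<le> real n" "1 / real n > 0" for r
      using stable_mass[OF q distinct_tuples_in_dom[OF t, of r]] tuple_mass_pos[OF qc t, of r] by auto
    have "mass q (t r) * \<phi> (mass q (t r)) powr p \<le> real n * \<phi> (1 / real n) powr p" for r
    proof (intro mult_mono powr_mono2 ps)
      show "\<phi> (mass q (t r)) \<le> \<phi> (1 / real n)"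
        using monotone_onD[OF \<phi>_antimono, of "1 / real n" "mass q (t r)"] m(1,2)[of r] m(4) by simp
    qed (use m(1,3)[of r] \<phi>_pos[of "mass q (t r)"] in auto)
    then have "(\<Prod>r\<in>UNIV. mass q (t r) * \<phi> (mass q (t r)) powr p) \<le> (\<Prod>r\<in>(UNIV :: 'k set). real n * \<phi> (1 / real n) powr p)"
      using m by (intro prod_mono) (simp add: less_imp_le)
    then show "(\<Prod>r\<in>UNIV. mass q (t r) * \<phi> (mass q (t r)) powr p) \<le> (real n * \<phi> (1 / real n) powr p) ^ CARD('k)"
      by simp
    show "(\<delta> + quad (\<lambda>r. d (mass q (t r))) (\<lambda>r. loc q (t r)) z) powr - s \<le> \<delta> powr - s"
      using quad_config_nonneg[OF qc t, of z] \<delta> ps(2) by (intro powr_mono2') auto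
  qed auto
  then have "tuple_sum \<delta> p s d \<phi> q z \<le> real (card (distinct_tuples q :: ('k \<Rightarrow> 'i) set)) * ?C"
    unfolding tuple_sum_def by (rule sum_bounded_above)
  also have "\<dots> \<le> real n ^ CARD('k) * ?C"
  proof (rule mult_right_mono)
    have fin: "finite (dom q)" using qc by (simp add: config_set_def)
    have "card (distinct_tuples q :: ('k \<Rightarrow> 'i) set) \<le> card (PiE (UNIV :: 'k set) (\<lambda>_. dom q))"
      using fin by (intro card_mono finite_PiE) (auto simp: distinct_tuples_def)
    also have "\<dots> = card (dom q) ^ CARD('k)" by (simp add: card_PiE)
    also have "\<dots> \<le> n ^ CARD('k)" using q by (intro power_mono) (auto simp: stable_def)
    finally show "real (card (distinct_tuples q :: ('k \<Rightarrow> 'i) set)) \<le> real n ^ CARD('k)"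
      by (simp flip: of_nat_power)
  qed auto
  finally show ?thesis .
qed

lemma tuple_sum_continuous:
  fixes q :: "('i, 'a) config"
  assumes \<delta>: "\<delta> > 0" and q: "q \<in> config_set"
  shows "continuous_on (A :: ('a ^ 'k::finite) set) (tuple_sum \<delta> p s d \<phi> q)"
  unfolding tuple_sum_def tuple_weight_config quad_def divide_inverse
proof (intro continuous_intros)
  fix t :: "'k \<Rightarrow> 'i" assume t: "t \<in> distinct_tuples q"
  show "\<forall>z\<in>A. \<delta> + (\<Sum>r\<in>UNIV. (norm (loc q (t r) - z $ r))\<^sup>2 * inverse (d (mass q (t r)))) \<noteq> 0"
  proof
    fix z
    from quad_config_nonneg[OF q t, of z]
    show "\<delta> + (\<Sum>r\<in>UNIV. (norm (loc q (t r) - z $ r))\<^sup>2 * inverse (d (mass q (t r)))) \<noteq> 0"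
      using \<delta> by (simp add: quad_def divide_inverse)
  qed
qed

lemma measurable_tuple_sum:
  "(\<lambda>(q, z). tuple_sum \<delta> p s d \<phi> q z) \<in> borel_measurable ((configs :: ('i, 'a) config measure) \<Otimes>\<^sub>M (borel :: ('a ^ 'k::finite) measure))"
proof -
  have [measurable]: "(\<lambda>q :: ('i, 'a) config. \<phi> (mass q i)) \<in> borel_measurable configs"
    "(\<lambda>q :: ('i, 'a) config. d (mass q i)) \<in> borel_measurable configs" for i
    by (intro measurable_mass_function \<phi>_cont d_cont)+
  have [measurable]: "(\<lambda>z :: 'a ^ 'k. z $ r) \<in> borel_measurable borel" for r
    by (intro borel_measurable_continuous_onI continuous_intros)
  have "(\<lambda>w :: ('i, 'a) config \<times> ('a ^ 'k). (\<lambda>J w. \<Sum>t\<in>{t. inj t \<and> range t \<subseteq> J}. tuple_weight \<delta> p s d \<phi> (snd w) (\<lambda>r. the (fst w (t r)))) (dom (fst w)) w)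
     \<in> borel_measurable (configs \<Otimes>\<^sub>M borel)"
  proof (rule measurable_compose_countable'[where g="\<lambda>w. dom (fst w)" and I="Collect finite"])
    show "(\<lambda>w :: ('i, 'a) config \<times> ('a ^ 'k). \<Sum>t\<in>{t. inj t \<and> range t \<subseteq> J}. tuple_weight \<delta> p s d \<phi> (snd w) (\<lambda>r. the (fst w (t r)))) \<in> borel_measurable (configs \<Otimes>\<^sub>M borel)" for J
      unfolding tuple_weight_config quad_def by measurable
  qed (auto intro: countable_Collect_finite measurable_compose[OF measurable_fst measurable_dom])
  then show ?thesis by (simp add: tuple_sum_def distinct_tuples_def case_prod_unfold)
qed

text \<open>Differentiation uses the gauge integral, whereas measurability in the configuration
  comes from parametrised Lebesgue integrals; this passes between the two.\<close>

lemma potential_lebesgue: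
  fixes K :: "'a ^ 'k::finite \<Rightarrow> real" and q :: "('i, 'a) config"
  assumes \<delta>: "\<delta> > 0" and q: "q \<in> config_set" and K: "continuous_on UNIV K"
  shows "(\<lambda>z. tuple_sum \<delta> p s d \<phi> q z * K z) integrable_on cbox l u"
    and "potential \<delta> p s l u K q = (LINT z|lborel. indicator (cbox l u) z * (tuple_sum \<delta> p s d \<phi> q z * K z))"
proof -
  have c: "continuous_on (cbox l u) (\<lambda>z. tuple_sum \<delta> p s d \<phi> q z * K z)"
    by (intro continuous_intros tuple_sum_continuous[OF \<delta> q] continuous_on_subset[OF K]) auto
  then show "(\<lambda>z. tuple_sum \<delta> p s d \<phi> q z * K z) integrable_on cbox l u"
    by (rule integrable_continuous)
  have "set_integrable lborel (cbox l u) (\<lambda>z. tuple_sum \<delta> p s d \<phi> q z * K z)"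
    unfolding set_integrable_def by (intro borel_integrable_compact c compact_cbox)
  from set_borel_integral_eq_integral(2)[OF this]
  show "potential \<delta> p s l u K q = (LINT z|lborel. indicator (cbox l u) z * (tuple_sum \<delta> p s d \<phi> q z * K z))"
    by (simp add: potential_def set_lebesgue_integral_def)
qed

lemma potential_measurable:
  fixes K :: "'a ^ 'k::finite \<Rightarrow> real"
  assumes \<delta>: "\<delta> > 0" and K: "continuous_on UNIV K"
  shows "potential \<delta> p s l u K \<in> borel_measurable configs"
proof -
  have K': "(\<lambda>w. K (snd w)) \<in> borel_measurable (configs \<Otimes>\<^sub>M lborel)"
    by (rule measurable_compose[OF measurable_snd]) (simp add: borel_measurable_continuous_onI[OF K])
  have "sets ((configs :: ('i, 'a) config measure) \<Otimes>\<^sub>M (lborel :: ('a ^ 'k) measure)) = sets (configs \<Otimes>\<^sub>M borel)"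
    by (intro sets_pair_measure_cong) auto
  note cong = measurable_cong_sets[OF this refl]
  have ts: "(\<lambda>w :: ('i, 'a) config \<times> ('a ^ 'k). tuple_sum \<delta> p s d \<phi> (fst w) (snd w)) \<in> borel_measurable (configs \<Otimes>\<^sub>M lborel)"
    unfolding cong by (rule measurable_tuple_sum[unfolded case_prod_unfold])
  have "(\<lambda>w :: ('i, 'a) config \<times> ('a ^ 'k). indicator (cbox l u) (snd w) * (tuple_sum \<delta> p s d \<phi> (fst w) (snd w) * K (snd w))) \<in> borel_measurable (configs \<Otimes>\<^sub>M lborel)"
    by (intro borel_measurable_times ts K') measurable
  then have "(\<lambda>q :: ('i, 'a) config. LINT z|lborel. indicator (cbox l u) z * (tuple_sum \<delta> p s d \<phi> q z * K z)) \<in> borel_measurable configs"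
    by (intro sigma_finite_measure.borel_measurable_lebesgue_integral) (auto simp: lborel.sigma_finite_measure_axioms case_prod_unfold)
  then show ?thesis
    by (rule measurable_cong[THEN iffD1, rotated]) (simp add: potential_lebesgue[OF \<delta> _ K])
qed

lemma potential_nonneg:
  fixes q :: "('i, 'a) config"
  assumes \<delta>: "\<delta> > 0" and q: "q \<in> config_set" and K: "continuous_on UNIV K" "\<And>z. K z \<ge> 0"
  shows "potential \<delta> p s l u K q \<ge> 0"
  unfolding potential_def
  by (intro integral_nonneg potential_lebesgue[OF \<delta> q K(1)]) (simp add: K(2) tuple_sum_nonneg[OF q])

lemma potential_le:
  fixes K :: "'a ^ 'k::finite \<Rightarrow> real" and q :: "('i, 'a) config"
  assumes \<delta>: "\<delta> > 0" and ps: "0 \<le> p" "0 \<le> s" and q: "q \<in> stable n" and K: "continuous_on UNIV K" "\<And>z. K z \<ge> 0"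
  shows "potential \<delta> p s l u K q \<le> real n ^ CARD('k) * ((real n * \<phi> (1 / real n) powr p) ^ CARD('k) * \<delta> powr (- s)) * integral (cbox l u) K"
proof -
  have qc: "q \<in> config_set" using q by (simp add: stable_def)
  have Ki: "K integrable_on cbox l u" by (intro integrable_continuous continuous_on_subset[OF K(1)]) auto
  let ?C = "real n ^ CARD('k) * ((real n * \<phi> (1 / real n) powr p) ^ CARD('k) * \<delta> powr (- s))"
  have "potential \<delta> p s l u K q \<le> integral (cbox l u) (\<lambda>z. ?C * K z)"
    unfolding potential_def
  proof (rule integral_le[OF potential_lebesgue(1)[OF \<delta> qc K(1)]])
    show "(\<lambda>z. ?C * K z) integrable_on cbox l u" by (rule integrable_on_mult_right[OF Ki])
    show "tuple_sum \<delta> p s d \<phi> q z * K z \<le> ?C * K z" for z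
      by (intro mult_right_mono tuple_sum_le[OF \<delta> ps q] K(2))
  qed
  then show ?thesis by simp
qed

text \<open>Relocation changes no mass, so the mass products become the constants \<open>c t\<close>
  and the diffusivities the constants \<open>e i\<close> of \<open>potential_sum_C2\<close>.\<close>

lemma relocated_potential:
  fixes K :: "'a ^ 'k::finite \<Rightarrow> real"
  shows "potential \<delta> p s l u K (relocate q x) = integral (cbox l u) (\<lambda>z.
     (\<Sum>t\<in>distinct_tuples q. (\<Prod>r\<in>UNIV. mass q (t r) * \<phi> (mass q (t r)) powr p) *
       (\<delta> + quad (\<lambda>r. d (mass q (t r))) (\<lambda>r. x (t r)) z) powr (- s)) * K z)"
  unfolding potential_def tuple_sum_def tuple_weight_config distinct_tuples_relocate
proof (rule arg_cong[where f="integral (cbox l u)"], rule ext, rule arg_cong2[where f="(*)", OF sum.cong[OF refl] refl])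
  fix t :: "'k \<Rightarrow> 'i" and z assume t: "t \<in> distinct_tuples q"
  have "mass (relocate q x) (t r) = mass q (t r)" "loc (relocate q x) (t r) = x (t r)" for r
    by (intro mass_relocate loc_relocate distinct_tuples_in_dom[OF t])+
  then show "(\<Prod>r\<in>UNIV. mass (relocate q x) (t r) * \<phi> (mass (relocate q x) (t r)) powr p) *
       (\<delta> + quad (\<lambda>r. d (mass (relocate q x) (t r))) (\<lambda>r. loc (relocate q x) (t r)) z) powr (- s)
     = (\<Prod>r\<in>UNIV. mass q (t r) * \<phi> (mass q (t r)) powr p) *
       (\<delta> + quad (\<lambda>r. d (mass q (t r))) (\<lambda>r. x (t r)) z) powr (- s)" by simp
qed

text \<open>Both outcomes stay in \<open>stable n\<close>, so the indicator is 1 throughout and the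
  inequality for \<open>tuple_sum\<close> can be integrated against \<open>K \<ge> 0\<close>.
  Outside \<open>stable n\<close> the sign may fail: a jump into the set can raise \<open>F\<close>
  from 0.\<close>

lemma potential_coagulation_generator:
  fixes K :: "'a ^ 'k::finite \<Rightarrow> real" and l u :: "'a ^ 'k" and \<delta> p :: real and n :: nat
  assumes \<delta>: "\<delta> > 0" and p: "0 \<le> p" and q: "q \<in> stable n" and K: "continuous_on UNIV K" "\<And>z. K z \<ge> 0"
  defines "F \<equiv> \<lambda>q. indicator (stable n) q * potential \<delta> p p l u K q"
  shows "Lc F q \<le> 0"
  unfolding coagulation_generator_def
proof (rule sum_nonpos)
  have qc: "q \<in> config_set" using q by (simp add: stable_def)
  fix x assume "x \<in> {(i, j). i \<in> dom q \<and> j \<in> dom q \<and> i \<noteq> j}"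
  then obtain i j where x: "x = (i, j)" and ij: "i \<in> dom q" "j \<in> dom q" "i \<noteq> j" by blast
  let ?a = "mass q i / (mass q i + mass q j)" and ?b = "mass q j / (mass q i + mass q j)"
  let ?q1 = "coagulate fresh i j q" and ?q2 = "coagulate fresh j i q"
  have c: "?q1 \<in> config_set" "?q2 \<in> config_set" "?q1 \<in> stable n" "?q2 \<in> stable n"
    using coagulate_in_config_set[OF qc ij] coagulate_in_config_set[OF qc ij(2,1) ij(3)[symmetric]]
      coagulate_in_stable[OF qc ij q] coagulate_in_stable[OF qc ij(2,1) ij(3)[symmetric] q] by auto
  have fr: "fresh (dom q) \<notin> dom q" using qc fresh by (simp add: config_set_def)
  note I = potential_lebesgue(1)[OF \<delta> _ K(1), of _ p p l u]
  have "?a * F ?q1 + ?b * F ?q2 = integral (cbox l u) (\<lambda>z. ?a * (tuple_sum \<delta> p p d \<phi> ?q1 z * K z) + ?b * (tuple_sum \<delta> p p d \<phi> ?q2 z * K z))"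
  proof -
    have i: "(\<lambda>z. ?a * (tuple_sum \<delta> p p d \<phi> ?q1 z * K z)) integrable_on cbox l u" "(\<lambda>z. ?b * (tuple_sum \<delta> p p d \<phi> ?q2 z * K z)) integrable_on cbox l u"
      by (intro integrable_on_mult_right I c)+
    show ?thesis
      unfolding integral_add[OF i] integral_mult_right using c by (simp add: F_def potential_def)
  qed
  also have "\<dots> \<le> integral (cbox l u) (\<lambda>z. tuple_sum \<delta> p p d \<phi> q z * K z)"
  proof (rule integral_le)
    show "(\<lambda>z. ?a * (tuple_sum \<delta> p p d \<phi> ?q1 z * K z) + ?b * (tuple_sum \<delta> p p d \<phi> ?q2 z * K z)) integrable_on cbox l u"
      by (intro integrable_add integrable_on_mult_right I c)
    show "(\<lambda>z. tuple_sum \<delta> p p d \<phi> q z * K z) integrable_on cbox l u" by (rule I[OF qc])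
    fix z :: "'a ^ 'k"
    have "?a * tuple_sum \<delta> p p d \<phi> ?q1 z + ?b * tuple_sum \<delta> p p d \<phi> ?q2 z \<le> tuple_sum \<delta> p p d \<phi> q z"
      by (rule tuple_sum_coagulation[where fresh=fresh, OF \<delta> p d_pos \<phi>_pos \<phi>_antimono \<phi>_d_antimono qc ij fr])
    from mult_right_mono[OF this K(2)[of z]]
    show "?a * (tuple_sum \<delta> p p d \<phi> ?q1 z * K z) + ?b * (tuple_sum \<delta> p p d \<phi> ?q2 z * K z) \<le> tuple_sum \<delta> p p d \<phi> q z * K z"
      by (simp only: distrib_right mult.assoc)
  qed
  also have "\<dots> = F q" using q by (simp add: F_def potential_def)
  finally show "(case x of (i, j) \<Rightarrow> \<epsilon> powr (-2) * V ((loc q i - loc q j) /\<^sub>R \<epsilon>) * \<alpha> (mass q i) (mass q j) *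
        (mass q i / (mass q i + mass q j) * F (coagulate fresh i j q)
         + mass q j / (mass q i + mass q j) * F (coagulate fresh j i q) - F q)) \<le> 0"
    unfolding x prod.case by (intro mult_nonneg_nonpos[OF pair_rate_nonneg[OF qc ij(1,2)]]) simp
qed

text \<open>Diffusion gives an equality and coagulation only lowers it. Membership among the test
  functions uses \<open>potential_le\<close> twice: with exponent \<open>p\<close> for
  \<open>F\<close> and with \<open>p + 2\<close> for its diffusion part.\<close>

lemma potential_test_function:
  fixes K :: "'a ^ 'k::finite \<Rightarrow> real" and l u :: "'a ^ 'k" and \<delta> p :: real and n :: nat
  assumes \<delta>: "\<delta> > 0" and p: "0 \<le> p" "real (CARD('k) * DIM('a)) = 2 * p + 2"
    and K: "continuous_on UNIV K" "\<And>z. K z \<ge> 0"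
  defines "F \<equiv> \<lambda>q. indicator (stable n) q * potential \<delta> p p l u K q"
  shows "F \<in> test_functions L"
    and "q \<in> stable n \<Longrightarrow> L F q \<le> - (4 * p * (p + 1) * \<delta> * potential \<delta> p (p + 2) l u K q)"
proof -
  have F_rel: "(\<lambda>x. F (relocate q x)) = (\<lambda>x. integral (cbox l u) (\<lambda>z.
     (\<Sum>t\<in>distinct_tuples q. (\<Prod>r\<in>UNIV. mass q (t r) * \<phi> (mass q (t r)) powr p) *
       (\<delta> + quad (\<lambda>r. d (mass q (t r))) (\<lambda>r. x (t r)) z) powr (- p)) * K z))" if "q \<in> stable n" for q
    using that by (simp add: F_def relocated_potential)
  have qc: "q \<in> config_set" if "q \<in> stable n" for q using that by (simp add: stable_def)
  have dpos: "d (mass q (t r)) > 0" if "q \<in> stable n" "t \<in> distinct_tuples q" for q and t :: "'k \<Rightarrow> 'i" and r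
    by (intro d_pos tuple_mass_pos[OF qc] that)
  have fin: "finite (dom q)" if "q \<in> stable n" for q using qc[OF that] by (simp add: config_set_def)
  have inj: "inj t" if "t \<in> distinct_tuples q" for t :: "'k \<Rightarrow> 'i" and q :: "('i, 'a) config"
    using that by (simp add: distinct_tuples_def)
  have C2: "C2_locations (\<lambda>x. F (relocate q x))" if "q \<in> stable n" for q
    unfolding F_rel[OF that]
    by (rule potential_sum_C2(1)[where T="distinct_tuples q" and J="dom q" and e="\<lambda>i. d (mass q i)"])
         (assumption | rule \<delta> p(2) dpos[OF that] fin[OF that] continuous_on_subset[OF K(1) subset_UNIV] distinct_tuples_in_dom inj)+
  have D: "diffusion_generator d F q = - (4 * p * (p + 1) * \<delta> * potential \<delta> p (p + 2) l u K q)" if q: "q \<in> stable n" for q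
  proof -
    have "diffusion_generator d F q = - integral (cbox l u) (\<lambda>z. (\<Sum>t\<in>distinct_tuples q. (\<Prod>r\<in>UNIV. mass q (t r) * \<phi> (mass q (t r)) powr p) *
       (4 * p * (p + 1) * \<delta> * (\<delta> + quad (\<lambda>r. d (mass q (t r))) (\<lambda>r. loc q (t r)) z) powr (- p - 2))) * K z)"
      unfolding diffusion_generator_def laplacian_at_def F_rel[OF q]
      by (rule potential_sum_C2(2)[where T="distinct_tuples q" and J="dom q" and e="\<lambda>i. d (mass q i)"])
         (assumption | rule \<delta> p(2) dpos[OF q] fin[OF q] continuous_on_subset[OF K(1) subset_UNIV] distinct_tuples_in_dom inj)+
    also have "integral (cbox l u) (\<lambda>z. (\<Sum>t\<in>distinct_tuples q. (\<Prod>r\<in>UNIV. mass q (t r) * \<phi> (mass q (t r)) powr p) *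
       (4 * p * (p + 1) * \<delta> * (\<delta> + quad (\<lambda>r. d (mass q (t r))) (\<lambda>r. loc q (t r)) z) powr (- p - 2))) * K z)
      = integral (cbox l u) (\<lambda>z. 4 * p * (p + 1) * \<delta> * (tuple_sum \<delta> p (p + 2) d \<phi> q z * K z))"
      by (intro arg_cong[where f="integral (cbox l u)"] ext)
         (simp add: tuple_sum_def tuple_weight_config sum_distrib_left sum_distrib_right ac_simps)
    finally show ?thesis by (simp add: potential_def)
  qed
  show "F \<in> test_functions L"
  proof (rule test_functionI[where n=n])
    show "F \<in> borel_measurable configs"
      unfolding F_def using potential_measurable[OF \<delta> K(1)] by measurable
    show "\<bar>F q\<bar> \<le> real n ^ CARD('k) * ((real n * \<phi> (1 / real n) powr p) ^ CARD('k) * \<delta> powr (- p)) * integral (cbox l u) K" if "q \<in> stable n" for q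
      using potential_nonneg[OF \<delta> qc[OF that] K, of p p l u] potential_le[OF \<delta> p(1) p(1) that K, of l u] that
      by (simp add: F_def)
    show "\<bar>diffusion_generator d F q\<bar> \<le> 4 * p * (p + 1) * \<delta> * (real n ^ CARD('k) * ((real n * \<phi> (1 / real n) powr p) ^ CARD('k) * \<delta> powr (- (p + 2))) * integral (cbox l u) K)" if "q \<in> stable n" for q
    proof -
      have "\<bar>potential \<delta> p (p + 2) l u K q\<bar> \<le> real n ^ CARD('k) * ((real n * \<phi> (1 / real n) powr p) ^ CARD('k) * \<delta> powr (- (p + 2))) * integral (cbox l u) K"
        using potential_nonneg[OF \<delta> qc[OF that] K, of p "p + 2" l u] potential_le[OF \<delta> p(1) _ that K, of "p + 2" l u] p(1) by simp
      moreover have "4 * p * (p + 1) * \<delta> \<ge> 0" using p(1) \<delta> by simp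
      ultimately show ?thesis unfolding D[OF that] abs_minus_cancel abs_mult[of "4 * p * (p + 1) * \<delta>"]
        by (simp only: abs_of_nonneg mult_left_mono)
    qed
    show "F q = 0" if "q \<in> config_set - stable n" for q using that by (simp add: F_def)
  qed (rule C2)
  show "L F q \<le> - (4 * p * (p + 1) * \<delta> * potential \<delta> p (p + 2) l u K q)" if "q \<in> stable n" for q
    using D[OF that] potential_coagulation_generator[OF \<delta> p(1) that K, of l u] by (simp add: generator_def F_def)
qed

end

subsection \<open>The estimate for the regularised potential\<close>

text \<open>The scale may differ from slot to slot but is common to all coordinates within a slot,
  hence \<open>DIM('a)\<close> equal Jacobian factors for each.\<close>

lemma lborel_rescale:
  fixes y :: "'k::finite \<Rightarrow> 'a::euclidean_space" and c :: "'k \<Rightarrow> real"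
  assumes c: "\<And>r. c r > 0" and f[measurable]: "f \<in> borel_measurable borel"
  shows "(\<integral>\<^sup>+z. f z \<partial>lborel) = ennreal (\<Prod>r\<in>UNIV. c r ^ DIM('a)) * (\<integral>\<^sup>+w. f (\<chi> r. y r + c r *\<^sub>R (w $ r)) \<partial>lborel)"
proof -
  \<comment> \<open>The affine formula scales along basis vectors of the product space. On
    \<open>axis r b\<close> only component \<open>r\<close> is nonzero, with norm 1, so
    \<open>cc\<close> returns \<open>c r\<close> there.\<close>
  define cc where "cc j = (\<Sum>r\<in>UNIV. c r * norm (j $ r))" for j :: "'a ^ 'k"
  define T where "T x = (\<chi> r. y r) + (\<Sum>j\<in>Basis. (cc j * (x \<bullet> j)) *\<^sub>R j)" for x :: "'a ^ 'k"
  have cc: "cc (axis r b) = c r" if "b \<in> Basis" for r and b :: 'a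
  proof -
    have "c r' * norm (axis r b $ r') = (if r' = r then c r else 0)" for r'
      using that by (simp add: axis_def)
    then show ?thesis by (simp add: cc_def)
  qed
  have T: "T = (\<lambda>w. \<chi> r. y r + c r *\<^sub>R (w $ r))"
  proof (rule ext, rule euclidean_eqI)
    fix w j :: "'a ^ 'k" assume j: "j \<in> Basis"
    then obtain r b where rb: "j = axis r b" "b \<in> Basis" by (auto simp: Basis_vec_def)
    have "T w \<bullet> j = (\<chi> r. y r) \<bullet> j + cc j * (w \<bullet> j)"
      unfolding T_def inner_add_left inner_sum_left inner_scaleR_left using j
      by (simp add: inner_Basis if_distrib sum.delta cong: if_cong)
    then show "T w \<bullet> j = (\<chi> r. y r + c r *\<^sub>R (w $ r)) \<bullet> j"
      using rb by (simp add: cc inner_axis inner_add_left)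
  qed
  have B: "Basis = (\<lambda>(r, b). axis r b) ` ((UNIV :: 'k set) \<times> (Basis :: 'a set))"
    by (auto simp: Basis_vec_def)
  have inj: "inj_on (\<lambda>(r, b). axis r b) ((UNIV :: 'k set) \<times> (Basis :: 'a set))"
    by (auto simp: inj_on_def axis_eq_axis)
  have "(\<Prod>j\<in>Basis. \<bar>cc j\<bar>) = (\<Prod>(r, b)\<in>(UNIV :: 'k set) \<times> (Basis :: 'a set). c r)"
    unfolding B prod.reindex[OF inj] using c
    by (intro prod.cong) (auto simp: cc abs_of_pos)
  also have "\<dots> = (\<Prod>r\<in>UNIV. c r ^ DIM('a))"
    by (subst prod.cartesian_product[symmetric]) simp
  finally have P: "(\<Prod>j\<in>Basis. \<bar>cc j\<bar>) = (\<Prod>r\<in>UNIV. c r ^ DIM('a))" .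
  have nz: "cc j \<noteq> 0" if "j \<in> Basis" for j
  proof -
    from that obtain r b where rb: "j = axis r b" "b \<in> Basis" by (auto simp: Basis_vec_def)
    show ?thesis using c[of r] rb by (simp add: cc)
  qed
  have Tm: "T \<in> borel_measurable borel"
    unfolding T_def by measurable
  have "(\<integral>\<^sup>+z. f z \<partial>lborel) = (\<integral>\<^sup>+z. f z \<partial>density (distr lborel borel T) (\<lambda>_. ennreal (\<Prod>j\<in>Basis. \<bar>cc j\<bar>)))"
    using lborel_affine_euclidean[of cc "\<chi> r. y r", OF nz] unfolding T_def by simp
  also have "\<dots> = ennreal (\<Prod>j\<in>Basis. \<bar>cc j\<bar>) * (\<integral>\<^sup>+w. f (T w) \<partial>lborel)"
    using Tm by (subst nn_integral_density, simp, simp, subst nn_integral_distr, simp, simp, subst nn_integral_cmult) auto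
  finally show ?thesis unfolding P by (simp add: T)
qed

text \<open>The substitution \<open>z $ r = y r + sqrt (\<delta> * a r) *\<^sub>R (w $ r)\<close>
  makes \<open>quad\<close> equal to \<open>\<delta> * (norm w)\<^sup>2\<close>. Its Jacobian is
  \<open>\<delta> powr (p + 1)\<close> times the product of the \<open>a r powr (D/2)\<close>;
  together with the explicit factor \<delta> the exponents of \<delta> add up to
  \<open>(p + 1) + 1 - (p + 2) = 0\<close>. Then \<delta> survives only in the points at which
  \<open>K\<close> is evaluated.\<close>

lemma kernel_rescale:
  fixes y :: "'k::finite \<Rightarrow> 'a::euclidean_space" and a :: "'k \<Rightarrow> real" and K :: "'a ^ 'k \<Rightarrow> real"
  assumes a: "\<And>r. a r > 0" and \<delta>: "\<delta> > 0" and K[measurable]: "K \<in> borel_measurable borel"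
    and p: "real (CARD('k) * DIM('a)) = 2 * p + 2"
  shows "(\<integral>\<^sup>+z. ennreal (\<delta> * (\<delta> + quad a y z) powr (- (p + 2)) * K z) \<partial>lborel)
    = (\<integral>\<^sup>+w. ennreal ((\<Prod>r\<in>UNIV. a r powr (real DIM('a) / 2)) * (1 + (norm w)\<^sup>2) powr (- (p + 2)) *
         K (\<chi> r. y r + sqrt (\<delta> * a r) *\<^sub>R (w $ r))) \<partial>lborel)"
proof -
  have [measurable]: "(\<lambda>z :: 'a ^ 'k. z $ r) \<in> borel_measurable borel" for r
    by (intro borel_measurable_continuous_onI continuous_intros)
  have [measurable]: "(\<lambda>w :: 'a ^ 'k. \<chi> r. y r + sqrt (\<delta> * a r) *\<^sub>R (w $ r)) \<in> borel_measurable borel"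
    by (intro borel_measurable_continuous_onI continuous_intros)
  have pos: "sqrt (\<delta> * a r) > 0" for r using a \<delta> by simp
  have pw: "sqrt (\<delta> * a r) ^ DIM('a) = \<delta> powr (real DIM('a) / 2) * a r powr (real DIM('a) / 2)" for r
  proof -
    have "sqrt (\<delta> * a r) ^ DIM('a) = (\<delta> * a r) powr (1 / 2 * real DIM('a))"
      using a[of r] \<delta> by (simp add: powr_half_sqrt[symmetric] powr_realpow[symmetric] powr_powr)
    then show ?thesis using a[of r] \<delta> by (simp add: powr_mult)
  qed
  have "(\<Prod>r\<in>(UNIV :: 'k set). sqrt (\<delta> * a r) ^ DIM('a)) = \<delta> powr (p + 1) * (\<Prod>r\<in>UNIV. a r powr (real DIM('a) / 2))"
  proof -
    have "(\<Prod>r\<in>(UNIV :: 'k set). \<delta> powr (real DIM('a) / 2)) = \<delta> powr (real (CARD('k) * DIM('a)) / 2)"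
      using \<delta> by (simp add: powr_power)
    moreover have "(2 * p + 2) / 2 = p + 1" by simp
    ultimately show ?thesis unfolding pw prod.distrib p by (simp only:)
  qed
  note P = this
  have q: "quad a y (\<chi> r. y r + sqrt (\<delta> * a r) *\<^sub>R (w $ r)) = \<delta> * (norm w)\<^sup>2" for w
  proof -
    have "(norm (sqrt (\<delta> * a r) *\<^sub>R w $ r))\<^sup>2 / a r = \<delta> * (norm (w $ r))\<^sup>2" for r
      using a[of r] \<delta> by (simp add: power_mult_distrib)
    then show ?thesis
      by (simp add: quad_def norm_vec_def L2_set_def sum_nonneg sum_distrib_left)
  qed
  have e: "\<delta> powr (p + 1) * (\<delta> * (\<delta> + \<delta> * (norm w)\<^sup>2) powr (- (p + 2))) = (1 + (norm w)\<^sup>2) powr (- (p + 2))" for w :: "'a ^ 'k"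
  proof -
    have "\<delta> + \<delta> * (norm w)\<^sup>2 = \<delta> * (1 + (norm w)\<^sup>2)" by (simp add: algebra_simps)
    then have "(\<delta> + \<delta> * (norm w)\<^sup>2) powr (- (p + 2)) = \<delta> powr (- (p + 2)) * (1 + (norm w)\<^sup>2) powr (- (p + 2))"
      using \<delta> by (simp add: powr_mult)
    moreover have "\<delta> powr (p + 1) * (\<delta> * \<delta> powr (- (p + 2))) = 1"
      using \<delta> by (simp add: powr_mult_base powr_add[symmetric])
    ultimately show ?thesis by (simp add: mult.assoc[symmetric])
  qed
  have "(\<integral>\<^sup>+z. ennreal (\<delta> * (\<delta> + quad a y z) powr (- (p + 2)) * K z) \<partial>lborel)
     = ennreal (\<delta> powr (p + 1) * (\<Prod>r\<in>UNIV. a r powr (real DIM('a) / 2))) *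
       (\<integral>\<^sup>+w. ennreal (\<delta> * (\<delta> + \<delta> * (norm w)\<^sup>2) powr (- (p + 2)) * K (\<chi> r. y r + sqrt (\<delta> * a r) *\<^sub>R (w $ r))) \<partial>lborel)"
    by (subst lborel_rescale[of "\<lambda>r. sqrt (\<delta> * a r)" _ y, OF pos]) (simp_all add: P q, simp add: quad_def)
  also have "\<dots> = (\<integral>\<^sup>+w. ennreal (\<delta> powr (p + 1) * (\<Prod>r\<in>UNIV. a r powr (real DIM('a) / 2))) *
       ennreal (\<delta> * (\<delta> + \<delta> * (norm w)\<^sup>2) powr (- (p + 2)) * K (\<chi> r. y r + sqrt (\<delta> * a r) *\<^sub>R (w $ r))) \<partial>lborel)"
    by (rule nn_integral_cmult[symmetric]) measurable
  also have "\<dots> = (\<integral>\<^sup>+w. ennreal ((\<Prod>r\<in>UNIV. a r powr (real DIM('a) / 2)) * (1 + (norm w)\<^sup>2) powr (- (p + 2)) *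
         K (\<chi> r. y r + sqrt (\<delta> * a r) *\<^sub>R (w $ r))) \<partial>lborel)"
  proof (rule nn_integral_cong)
    fix w :: "'a ^ 'k"
    let ?A = "\<Prod>r\<in>UNIV. a r powr (real DIM('a) / 2)" and ?K = "K (\<chi> r. y r + sqrt (\<delta> * a r) *\<^sub>R (w $ r))"
    have "\<delta> powr (p + 1) * ?A \<ge> 0" by (intro mult_nonneg_nonneg prod_nonneg) auto
    moreover have "\<delta> powr (p + 1) * ?A * (\<delta> * (\<delta> + \<delta> * (norm w)\<^sup>2) powr (- (p + 2)) * ?K)
       = ?A * (\<delta> powr (p + 1) * (\<delta> * (\<delta> + \<delta> * (norm w)\<^sup>2) powr (- (p + 2)))) * ?K" by (simp only: ac_simps)
    ultimately show "ennreal (\<delta> powr (p + 1) * ?A) * ennreal (\<delta> * (\<delta> + \<delta> * (norm w)\<^sup>2) powr (- (p + 2)) * ?K)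
       = ennreal (?A * (1 + (norm w)\<^sup>2) powr (- (p + 2)) * ?K)"
      unfolding e by (simp only: ennreal_mult'[symmetric])
  qed
  finally show ?thesis .
qed

text \<open>The sphere area is \<open>n\<close> times the ball volume, and
  \<open>(n - 2) * n = 4p(p+1)\<close> for \<open>n = 2p + 2\<close>: the constant of the
  fundamental solution gives the mollifier total mass 1.\<close>

lemma c0_normalisation:
  assumes p: "p > 0" "real n = 2 * p + 2"
  shows "c0 n * (4 * p * (p + 1)) * unit_ball_vol (real n) = 1"
proof -
  have "n > 0" using p by (cases n) auto
  define v where "v = unit_ball_vol (2 * p + 2)"
  have "v > 0" unfolding v_def p(2)[symmetric] by (rule unit_ball_vol_pos) simp
  then have "4 * p * (p + 1) * v \<noteq> 0" using p(1) by simp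
  moreover have "(2 * p + 2 - 2) * ((2 * p + 2) * v) = 4 * p * (p + 1) * v"
    by (simp add: algebra_simps)
  ultimately show ?thesis
    unfolding c0_def sphere_area_unit_ball_vol[OF \<open>n > 0\<close>] p(2) v_def[symmetric] by simp
qed

context coagulation_coefficients
begin

text \<open>In Dynkin's formula for the truncated potential on \<open>B\<close>, the generator bound
  makes the time integral a loss of potential. This loss cannot exceed the initial value, as the
  potential at time \<open>T\<close> is nonnegative.\<close>

lemma source_estimate:
  fixes K :: "'a ^ 'k::finite \<Rightarrow> real" and l u :: "'a ^ 'k" and \<delta> p T :: real and n :: nat
  assumes P: "transition_semigroup configs P" and G: "has_generator_on configs P L (test_functions L)"
    and X: "markov_process M configs P X"
    and \<delta>: "\<delta> > 0" and p: "0 \<le> p" "real (CARD('k) * DIM('a)) = 2 * p + 2"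
    and K: "continuous_on UNIV K" "\<And>z. K z \<ge> 0" and T: "T \<ge> 0"
  defines "B \<equiv> X 0 -` stable n \<inter> space M"
  shows "(\<integral>\<^sup>+s\<in>{0..T}. (\<integral>\<^sup>+\<omega>. indicator B \<omega> * ennreal (4 * p * (p + 1) * \<delta> * potential \<delta> p (p + 2) l u K (X s \<omega>)) \<partial>M) \<partial>lborel)
    \<le> (\<integral>\<^sup>+\<omega>. indicator B \<omega> * ennreal (potential \<delta> p p l u K (X 0 \<omega>)) \<partial>M)"
proof -
  interpret prob_space M using X by (simp add: markov_process_def)
  note Xm = markov_process_measurable[OF X]
  have Xs: "X s \<omega> \<in> config_set" if "s \<ge> 0" "\<omega> \<in> space M" for s \<omega>
    using measurable_space[OF Xm[OF that(1)] that(2)] by simp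
  have B[measurable]: "B \<in> sets M" unfolding B_def by (rule measurable_sets[OF Xm]) auto
  let ?I = "indicator (stable n) :: ('i, 'a) config \<Rightarrow> real"
  have Im: "?I \<in> borel_measurable configs" by measurable
  \<comment> \<open>The expectation of the indicator on \<open>B\<close> cannot decrease, yet at
    time 0 it already equals the measure of \<open>B\<close>; hence it is constant. The null set may
    depend on \<open>s\<close>, which is harmless since expectations are compared at fixed
    times.\<close>
  have stays: "AE \<omega> in M. \<omega> \<in> B \<longrightarrow> X s \<omega> \<in> stable n" if s: "s \<ge> 0" for s
  proof -
    have [measurable]: "X s \<in> M \<rightarrow>\<^sub>M configs" "X 0 \<in> M \<rightarrow>\<^sub>M configs" using Xm s by auto
    have "0 \<le> (LINT \<omega>:B|M. ?I (X s \<omega>)) - (LINT \<omega>:B|M. ?I (X 0 \<omega>))"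
    proof (rule has_integral_nonneg)
      show "((\<lambda>r. LINT \<omega>:B|M. L ?I (X r \<omega>)) has_integral (LINT \<omega>:B|M. ?I (X s \<omega>)) - (LINT \<omega>:B|M. ?I (X 0 \<omega>))) {0..s}"
        unfolding B_def
        by (rule dynkin_formula[OF X P G indicator_stable_test_function Im _ _ stable_measurable s, where C=1]) (auto simp: indicator_def)
      show "0 \<le> (LINT \<omega>:B|M. L ?I (X r \<omega>))" if "r \<in> {0..s}" for r
        unfolding set_lebesgue_integral_def using generator_indicator_stable Xs that
        by (intro integral_nonneg_AE AE_I2) (auto simp: indicator_def)
    qed
    also have "(LINT \<omega>:B|M. ?I (X s \<omega>)) - (LINT \<omega>:B|M. ?I (X 0 \<omega>)) = (LINT \<omega>|M. indicator B \<omega> * ?I (X s \<omega>) - indicator B \<omega> * ?I (X 0 \<omega>))"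
      unfolding set_lebesgue_integral_def real_scaleR_def
      by (rule Bochner_Integration.integral_diff[symmetric]) (rule integrable_const_bound[where B=1], auto intro!: AE_I2 simp: indicator_def)+
    also have "\<dots> = - (LINT \<omega>|M. indicator B \<omega> * (1 - ?I (X s \<omega>)))"
      unfolding Bochner_Integration.integral_minus[symmetric]
      by (intro Bochner_Integration.integral_cong refl) (auto simp: indicator_def B_def)
    finally have "(LINT \<omega>|M. indicator B \<omega> * (1 - ?I (X s \<omega>))) \<le> 0" by simp
    moreover have nn: "AE \<omega> in M. 0 \<le> indicator B \<omega> * (1 - ?I (X s \<omega>))"
      by (intro AE_I2) (auto simp: indicator_def)
    ultimately have "(LINT \<omega>|M. indicator B \<omega> * (1 - ?I (X s \<omega>))) = 0"
      using integral_nonneg_AE[OF nn] by linarith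
    moreover have "integrable M (\<lambda>\<omega>. indicator B \<omega> * (1 - ?I (X s \<omega>)))"
      by (rule integrable_const_bound[where B=1]) (auto intro!: AE_I2 simp: indicator_def)
    ultimately have "AE \<omega> in M. indicator B \<omega> * (1 - ?I (X s \<omega>)) = 0"
      using integral_nonneg_eq_0_iff_AE[OF _ nn] by blast
    then show ?thesis by eventually_elim (auto simp: indicator_def split: if_splits)
  qed
  define F where "F = (\<lambda>q :: ('i, 'a) config. indicator (stable n) q * potential \<delta> p p l u K q)"
  have FT: "F \<in> test_functions L" unfolding F_def by (rule potential_test_function(1)[OF \<delta> p K])
  \<comment> \<open>This bound is confined to \<open>stable n\<close>; \<open>stays\<close> makes it
    available along the process.\<close>
  have LF: "4 * p * (p + 1) * \<delta> * potential \<delta> p (p + 2) l u K q \<le> - L F q" if "q \<in> stable n" for q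
    using potential_test_function(2)[OF \<delta> p K that, of l u] unfolding F_def by simp
  have Fm[measurable]: "F \<in> borel_measurable configs" using FT by (simp add: test_functions_def)
  have LFm: "L F \<in> borel_measurable configs" by (rule has_generator_on_measurable[OF P G FT Fm])
  from FT have "bounded (F ` config_set)" "bounded (L F ` config_set)" by (auto simp: test_functions_def)
  then obtain C C' where C: "\<And>q. q \<in> config_set \<Longrightarrow> \<bar>F q\<bar> \<le> C" and C': "\<And>q. q \<in> config_set \<Longrightarrow> \<bar>L F q\<bar> \<le> C'"
    unfolding bounded_iff by auto
  have F0: "F q \<ge> 0" if "q \<in> config_set" for q
    unfolding F_def using potential_nonneg[OF \<delta> that K] by simp
  let ?g = "\<lambda>s. LINT \<omega>:B|M. L F (X s \<omega>)" and ?f = "\<lambda>s. LINT \<omega>:B|M. F (X s \<omega>)"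
  have int: "(?g has_integral ?f T - ?f 0) {0..T}"
    unfolding B_def
    by (rule dynkin_formula[OF X P G FT Fm _ _ stable_measurable T, where C=C]) (use F0 C in \<open>auto intro: order_trans[OF abs_ge_self]\<close>)
  have inner: "(\<integral>\<^sup>+\<omega>. indicator B \<omega> * ennreal (4 * p * (p + 1) * \<delta> * potential \<delta> p (p + 2) l u K (X s \<omega>)) \<partial>M) \<le> ennreal (- ?g s)"
    and g_neg: "0 \<le> - ?g s" if s: "s \<ge> 0" for s
  proof -
    have [measurable]: "X s \<in> M \<rightarrow>\<^sub>M configs" using Xm s by simp
    have ae: "AE \<omega> in M. \<omega> \<in> B \<longrightarrow> 0 \<le> 4 * p * (p + 1) * \<delta> * potential \<delta> p (p + 2) l u K (X s \<omega>) \<and>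
         4 * p * (p + 1) * \<delta> * potential \<delta> p (p + 2) l u K (X s \<omega>) \<le> - L F (X s \<omega>)"
      using stays[OF s]
    proof eventually_elim
      case (elim \<omega>)
      show ?case
      proof (intro impI conjI)
        assume "\<omega> \<in> B"
        then have st: "X s \<omega> \<in> stable n" using elim by simp
        then have "X s \<omega> \<in> config_set" by (simp add: stable_def)
        then show "0 \<le> 4 * p * (p + 1) * \<delta> * potential \<delta> p (p + 2) l u K (X s \<omega>)"
          using potential_nonneg[OF \<delta> _ K] p(1) \<delta> by (intro mult_nonneg_nonneg) auto
        show "4 * p * (p + 1) * \<delta> * potential \<delta> p (p + 2) l u K (X s \<omega>) \<le> - L F (X s \<omega>)" by (rule LF[OF st])
      qed
    qed
    have int: "integrable M (\<lambda>\<omega>. indicator B \<omega> * - L F (X s \<omega>))"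
      using measurable_compose[OF Xm[OF s] LFm] C'[OF Xs[OF s]]
      by (intro integrable_const_bound[where B="max C' 0"] borel_measurable_times borel_measurable_uminus) (auto intro!: AE_I2 simp: indicator_def le_max_iff_disj)
    have eq: "(LINT \<omega>|M. indicator B \<omega> * - L F (X s \<omega>)) = - ?g s"
      unfolding set_lebesgue_integral_def by simp
    have nn: "AE \<omega> in M. 0 \<le> indicator B \<omega> * - L F (X s \<omega>)"
      using ae
    proof eventually_elim
      case (elim \<omega>)
      then have "\<omega> \<in> B \<Longrightarrow> 0 \<le> - L F (X s \<omega>)" by linarith
      then show ?case by (simp add: indicator_def)
    qed
    show "0 \<le> - ?g s" unfolding eq[symmetric] by (rule integral_nonneg_AE[OF nn])
    have "(\<integral>\<^sup>+\<omega>. indicator B \<omega> * ennreal (4 * p * (p + 1) * \<delta> * potential \<delta> p (p + 2) l u K (X s \<omega>)) \<partial>M) \<le> (\<integral>\<^sup>+\<omega>. ennreal (indicator B \<omega> * - L F (X s \<omega>)) \<partial>M)"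
      using ae by (intro nn_integral_mono_AE, eventually_elim) (auto simp: indicator_def intro!: ennreal_leI)
    also have "\<dots> = ennreal (- ?g s)"
      unfolding eq[symmetric] by (rule nn_integral_eq_integral[OF int nn])
    finally show "(\<integral>\<^sup>+\<omega>. indicator B \<omega> * ennreal (4 * p * (p + 1) * \<delta> * potential \<delta> p (p + 2) l u K (X s \<omega>)) \<partial>M) \<le> ennreal (- ?g s)" .
  qed
  have "(\<integral>\<^sup>+s\<in>{0..T}. (\<integral>\<^sup>+\<omega>. indicator B \<omega> * ennreal (4 * p * (p + 1) * \<delta> * potential \<delta> p (p + 2) l u K (X s \<omega>)) \<partial>M) \<partial>lborel)
     \<le> (\<integral>\<^sup>+s. ennreal (- ?g s) * indicator {0..T} s \<partial>lborel)"
    using inner by (intro nn_integral_mono) (auto simp: indicator_def)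
  \<comment> \<open>So far \<open>?g\<close> has just a gauge integral over the time interval; its
    constant sign turns this into a Lebesgue integral.\<close>
  also have "\<dots> = ennreal (- (?f T - ?f 0))"
    by (rule nn_integral_has_integral_lebesgue'[OF _ has_integral_neg[OF int]]) (use g_neg in auto)
  also have "\<dots> \<le> ennreal (?f 0)"
  proof (rule ennreal_leI)
    have "?f T \<ge> 0" unfolding set_lebesgue_integral_def using F0 Xs[OF T]
      by (intro integral_nonneg_AE AE_I2) (auto simp: indicator_def)
    then show "- (?f T - ?f 0) \<le> ?f 0" by simp
  qed
  also have "\<dots> = (\<integral>\<^sup>+\<omega>. ennreal (indicator B \<omega> * F (X 0 \<omega>)) \<partial>M)"
  proof -
    have [measurable]: "X 0 \<in> M \<rightarrow>\<^sub>M configs" using Xm by simp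
    have "integrable M (\<lambda>\<omega>. indicator B \<omega> * F (X 0 \<omega>))"
      using C[OF Xs[of 0]] by (intro integrable_const_bound[where B="max C 0"]) (auto intro!: AE_I2 simp: indicator_def le_max_iff_disj)
    then show ?thesis
      unfolding set_lebesgue_integral_def real_scaleR_def using F0 Xs[of 0]
      by (intro nn_integral_eq_integral[symmetric]) (auto intro!: AE_I2 simp: indicator_def)
  qed
  also have "\<dots> = (\<integral>\<^sup>+\<omega>. indicator B \<omega> * ennreal (potential \<delta> p p l u K (X 0 \<omega>)) \<partial>M)"
    by (intro nn_integral_cong) (auto simp: indicator_def F_def B_def)
  finally show ?thesis .
qed

end

subsection \<open>Removing the regularisation\<close>

text \<open>Hoelder continuity compares \<open>V x\<close> with \<open>V 0\<close>, and
  \<open>norm x\<close> is at most \<open>R\<close> wherever \<open>V\<close> does not vanish; the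
  \<open>max 0\<close> covers the other points.\<close>

lemma interaction_potential_bounded:
  assumes "interaction_potential V"
  shows "\<exists>C. \<forall>x. V x \<le> C"
proof -
  note * = assms[unfolded interaction_potential_def]
  from * obtain a C where C: "0 < a" "\<And>x y. \<bar>V x - V y\<bar> \<le> C * dist x y powr a"
    by (elim conjE exE) iprover
  from * have cpt: "compact (closure {x. V x \<noteq> 0})" by (elim conjE)
  from compact_imp_bounded[OF cpt, unfolded bounded_iff]
  obtain R where R': "\<forall>x\<in>closure {x. V x \<noteq> 0}. norm x \<le> R" ..
  have R: "norm x \<le> R" if "V x \<noteq> 0" for x
    by (rule bspec[OF R'], rule subsetD[OF closure_subset]) (simp add: that)
  have "V x \<le> max 0 (V 0 + \<bar>C\<bar> * R powr a)" for x
  proof (cases "V x = 0")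
    case False
    have "C * dist x 0 powr a \<le> \<bar>C\<bar> * R powr a"
      using R[OF False] C(1) by (intro mult_mono powr_mono2) auto
    then show ?thesis using C(2)[of x 0] by simp
  qed simp
  then show ?thesis by (intro exI allI)
qed

text \<open>Equal to 1 for norm at most \<open>n - 1\<close> and to 0 from norm \<open>n\<close> on.
  Piecewise linear is smooth enough: derivatives fall on the kernel, and \<open>K\<close> has to be
  continuous only.\<close>

definition cutoff :: "nat \<Rightarrow> 'b::real_normed_vector \<Rightarrow> real" where
  "cutoff n z = max 0 (min 1 (real n - norm z))"

lemma cutoff_bounds: "0 \<le> cutoff n z" "cutoff n z \<le> 1"
  by (auto simp: cutoff_def)

lemma continuous_on_cutoff: "continuous_on A (cutoff n)"
  unfolding cutoff_def by (intro continuous_intros)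

lemma cutoff_outside_box:
  fixes z :: "'b::euclidean_space"
  assumes "z \<notin> cbox (- (real n *\<^sub>R One)) (real n *\<^sub>R One)"
  shows "cutoff n z = 0"
proof (rule ccontr)
  assume "cutoff n z \<noteq> 0"
  then have "norm z \<le> real n" by (auto simp: cutoff_def max_def min_def split: if_splits)
  then have "\<bar>z \<bullet> b\<bar> \<le> real n" if "b \<in> Basis" for b using Basis_le_norm[OF that, of z] by simp
  then have "z \<in> cbox (- (real n *\<^sub>R One)) (real n *\<^sub>R One)"
    by (auto simp: mem_box inner_Basis abs_le_iff) (metis minus_le_iff)
  then show False using assms by simp
qed

lemma cutoff_tendsto:
  assumes z: "z \<longlonglongrightarrow> y"
  shows "(\<lambda>n. cutoff n (z n)) \<longlonglongrightarrow> 1"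
proof -
  from tendsto_norm[OF z] have "eventually (\<lambda>n. norm (z n) < norm y + 1) sequentially"
    by (rule order_tendstoD) simp
  \<comment> \<open>The margin 2 places \<open>z n\<close> within radius \<open>real n - 1\<close>,
    where the cutoff is 1.\<close>
  moreover have "eventually (\<lambda>n. norm y + 2 \<le> real n) sequentially"
    using filterlim_real_sequentially by (simp add: filterlim_at_top)
  ultimately have "eventually (\<lambda>n. cutoff n (z n) = 1) sequentially"
    by eventually_elim (auto simp: cutoff_def)
  then show ?thesis by (rule tendsto_eventually)
qed

lemma weight_eq:
  assumes "p = real (k * D) / 2 - 1"
  shows "weight D k d \<phi> m = m * \<phi> m powr p * d m powr (real D / 2)"
  using assms by (simp add: weight_def)

lemma c0_nonneg:
  assumes p: "p > 0" "real n = 2 * p + 2"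
  shows "c0 n \<ge> 0"
proof -
  have "Gamma (p + 1) > 0" using p(1) by (intro Gamma_real_pos) simp
  moreover have "(2 * p + 2) / 2 = p + 1" by simp
  ultimately show ?thesis
    unfolding c0_def sphere_area_def p(2) using p(1) by simp
qed

section \<open>Both sides of the estimate as sums over tuples\<close>

context coagulation_coefficients
begin

text \<open>The box disappears because \<open>K\<close> vanishes outside it; each tuple then has an
  integral over the whole space, open to rescaling.\<close>

lemma nn_integral_potential:
  fixes K :: "'a ^ 'k::finite \<Rightarrow> real" and q :: "('i, 'a) config"
  assumes \<delta>: "\<delta> > 0" and q: "q \<in> config_set" and K: "continuous_on UNIV K" "\<And>z. K z \<ge> 0"
    and supp: "\<And>z. z \<notin> cbox l u \<Longrightarrow> K z = 0"
  shows "ennreal (potential \<delta> p s l u K q) =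
    (\<Sum>t\<in>distinct_tuples q. \<integral>\<^sup>+z. ennreal ((\<Prod>r\<in>UNIV. mass q (t r) * \<phi> (mass q (t r)) powr p) *
       (\<delta> + quad (\<lambda>r. d (mass q (t r))) (\<lambda>r. loc q (t r)) z) powr (- s) * K z) \<partial>lborel)"
proof -
  let ?w = "\<lambda>(t :: 'k \<Rightarrow> 'i) (z :: 'a ^ 'k). (\<Prod>r\<in>UNIV. mass q (t r) * \<phi> (mass q (t r)) powr p) *
       (\<delta> + quad (\<lambda>r. d (mass q (t r))) (\<lambda>r. loc q (t r)) z) powr (- s) * K z"
  have [measurable]: "(\<lambda>z :: 'a ^ 'k. z $ r) \<in> borel_measurable borel" for r
    by (intro borel_measurable_continuous_onI continuous_intros)
  have [measurable]: "K \<in> borel_measurable borel" by (rule borel_measurable_continuous_onI[OF K(1)])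
  have w0: "?w t z \<ge> 0" if "t \<in> distinct_tuples q" for t z
    using tuple_mass_pos[OF q that] K(2) by (intro mult_nonneg_nonneg prod_nonneg) (auto simp: less_imp_le)
  have "((\<lambda>z. tuple_sum \<delta> p s d \<phi> q z * K z) has_integral potential \<delta> p s l u K q) (cbox l u)"
    unfolding potential_def by (rule integrable_integral[OF potential_lebesgue(1)[OF \<delta> q K(1)]])
  then have "ennreal (potential \<delta> p s l u K q) = (\<integral>\<^sup>+z. ennreal (tuple_sum \<delta> p s d \<phi> q z * K z) * indicator (cbox l u) z \<partial>lborel)"
    by (intro nn_integral_has_integral_lebesgue'[symmetric]) (auto intro!: mult_nonneg_nonneg tuple_sum_nonneg[OF q] K(2))
  also have "\<dots> = (\<integral>\<^sup>+z. (\<Sum>t\<in>distinct_tuples q. ennreal (?w t z)) \<partial>lborel)"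
  proof (rule nn_integral_cong)
    fix z
    have "ennreal (tuple_sum \<delta> p s d \<phi> q z * K z) * indicator (cbox l u) z = ennreal (tuple_sum \<delta> p s d \<phi> q z * K z)"
      using supp[of z] by (auto simp: indicator_def)
    also have "\<dots> = (\<Sum>t\<in>distinct_tuples q. ennreal (?w t z))"
      using w0 by (simp add: tuple_sum_def tuple_weight_config sum_distrib_right sum_ennreal)
    finally show "ennreal (tuple_sum \<delta> p s d \<phi> q z * K z) * indicator (cbox l u) z = (\<Sum>t\<in>distinct_tuples q. ennreal (?w t z))" .
  qed
  also have "\<dots> = (\<Sum>t\<in>distinct_tuples q. \<integral>\<^sup>+z. ennreal (?w t z) \<partial>lborel)"
    by (rule nn_integral_sum) (unfold quad_def, measurable)
  finally show ?thesis .
qed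

text \<open>Dropping \<delta> and the cutoff enlarges the integrand, as the exponent is negative and
  \<open>K' \<le> K\<close>. The factors \<open>d powr (-D/2)\<close> of \<Lambda> cancel those in
  \<open>weight\<close>, leaving the \<open>m * \<phi> m powr p\<close> of the potential.\<close>

lemma potential_le_Lambda:
  fixes K K' :: "'a ^ 'k::finite \<Rightarrow> real" and q :: "('i, 'a) config"
  assumes \<delta>: "\<delta> > 0" and q: "q \<in> config_set" and K: "continuous_on UNIV K"
    and K': "continuous_on UNIV K'" "\<And>z. K' z \<ge> 0" "\<And>z. K' z \<le> K z"
    and supp: "\<And>z. z \<notin> cbox l u \<Longrightarrow> K' z = 0"
    and p: "p > 0" "real (CARD('k) * DIM('a)) = 2 * p + 2"
  shows "ennreal (c0 (CARD('k) * DIM('a)) * potential \<delta> p p l u K' q) \<le>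
     (\<Sum>t\<in>distinct_tuples q. Lambda_op d (\<chi> r. mass q (t r)) K (\<chi> r. loc q (t r)) *
         ennreal (\<Prod>r\<in>UNIV. weight DIM('a) CARD('k) d \<phi> (mass q (t r))))"
proof -
  let ?c = "c0 (CARD('k) * DIM('a))"
  have c: "?c \<ge> 0" by (rule c0_nonneg[OF p])
  have p': "p = real (CARD('k) * DIM('a)) / 2 - 1" using p(2) by linarith
  have [measurable]: "(\<lambda>z :: 'a ^ 'k. z $ r) \<in> borel_measurable borel" for r
    by (intro borel_measurable_continuous_onI continuous_intros)
  have [measurable]: "K \<in> borel_measurable borel" by (rule borel_measurable_continuous_onI[OF K(1)])
  have "ennreal (?c * potential \<delta> p p l u K' q) = ennreal ?c * ennreal (potential \<delta> p p l u K' q)"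
    by (rule ennreal_mult'[OF c])
  also have "\<dots> = (\<Sum>t\<in>distinct_tuples q. ennreal ?c * (\<integral>\<^sup>+z. ennreal ((\<Prod>r\<in>UNIV. mass q (t r) * \<phi> (mass q (t r)) powr p) *
       (\<delta> + quad (\<lambda>r. d (mass q (t r))) (\<lambda>r. loc q (t r)) z) powr (- p) * K' z) \<partial>lborel))"
    by (subst nn_integral_potential[OF \<delta> q K'(1,2)]) (simp_all only: supp sum_distrib_left not_False_eq_True)
  also have "\<dots> \<le> (\<Sum>t\<in>distinct_tuples q. Lambda_op d (\<chi> r. mass q (t r)) K (\<chi> r. loc q (t r)) *
         ennreal (\<Prod>r\<in>UNIV. weight DIM('a) CARD('k) d \<phi> (mass q (t r))))"
  proof (rule sum_mono)
    fix t :: "'k \<Rightarrow> 'i" assume t: "t \<in> distinct_tuples q"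
    let ?m = "\<lambda>r. mass q (t r)" and ?y = "\<lambda>r. loc q (t r)"
    let ?W = "\<Prod>r\<in>UNIV. weight DIM('a) CARD('k) d \<phi> (?m r)" and ?U = "\<Prod>r\<in>UNIV. ?m r * \<phi> (?m r) powr p"
    let ?D = "\<Prod>r\<in>UNIV. d (?m r) powr (- (real DIM('a) / 2))"
    have m: "?m r > 0" "d (?m r) > 0" for r using tuple_mass_pos[OF q t] d_pos by auto
    have W: "?W \<ge> 0" unfolding weight_def using m by (intro prod_nonneg) (auto simp: less_imp_le)
    have DW: "?D * ?W = ?U"
      unfolding prod.distrib[symmetric] using m
      by (intro prod.cong refl) (simp add: weight_eq[OF p'] powr_minus less_imp_neq[THEN not_sym])
    have U: "?U \<ge> 0" using m by (intro prod_nonneg) (auto simp: less_imp_le)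
    have "(\<integral>\<^sup>+z. ennreal (?U * (\<delta> + quad (\<lambda>r. d (?m r)) ?y z) powr (- p) * K' z) \<partial>lborel)
       \<le> (\<integral>\<^sup>+z. ennreal (?D * (quad (\<lambda>r. d (?m r)) ?y z) powr (- p) * K z) * ennreal ?W \<partial>lborel)"
    proof (rule nn_integral_mono_AE)
      \<comment> \<open>At \<open>z = y\<close> the inequality fails, since \<open>0 powr (- p) = 0\<close>.\<close>
      have "AE z in lborel. z \<noteq> (\<chi> r. ?y r)" by (rule AE_lborel_singleton)
      then show "AE z in lborel. ennreal (?U * (\<delta> + quad (\<lambda>r. d (?m r)) ?y z) powr (- p) * K' z)
         \<le> ennreal (?D * (quad (\<lambda>r. d (?m r)) ?y z) powr (- p) * K z) * ennreal ?W"
      proof eventually_elim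
        case (elim z)
        then obtain r0 where r0: "z $ r0 \<noteq> ?y r0" by (auto simp: vec_eq_iff)
        have "0 < (norm (?y r0 - z $ r0))\<^sup>2 / d (?m r0)" using m(2) r0 by simp
        also have "\<dots> \<le> quad (\<lambda>r. d (?m r)) ?y z"
          unfolding quad_def using m(2) by (intro member_le_sum) (auto simp: less_imp_le)
        finally have "(\<delta> + quad (\<lambda>r. d (?m r)) ?y z) powr (- p) \<le> (quad (\<lambda>r. d (?m r)) ?y z) powr (- p)"
          using \<delta> p(1) by (intro powr_mono2') auto
        then have "?U * (\<delta> + quad (\<lambda>r. d (?m r)) ?y z) powr (- p) * K' z \<le> ?U * (quad (\<lambda>r. d (?m r)) ?y z) powr (- p) * K z"
          using U K'(2,3) by (intro mult_mono) auto
        also have "\<dots> = ?D * (quad (\<lambda>r. d (?m r)) ?y z) powr (- p) * K z * ?W"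
          unfolding DW[symmetric] by (simp only: ac_simps)
        finally show ?case
          using W by (simp only: ennreal_mult''[symmetric] ennreal_leI)
      qed
    qed
    also have "\<dots> = (\<integral>\<^sup>+z. ennreal (?D * (quad (\<lambda>r. d (?m r)) ?y z) powr (- p) * K z) \<partial>lborel) * ennreal ?W"
      by (rule nn_integral_multc) (unfold quad_def, measurable)
    finally have "ennreal ?c * (\<integral>\<^sup>+z. ennreal (?U * (\<delta> + quad (\<lambda>r. d (?m r)) ?y z) powr (- p) * K' z) \<partial>lborel)
       \<le> ennreal ?c * ((\<integral>\<^sup>+z. ennreal (?D * (quad (\<lambda>r. d (?m r)) ?y z) powr (- p) * K z) \<partial>lborel) * ennreal ?W)"
      by (rule mult_left_mono) simp
    also have "\<dots> = Lambda_op d (\<chi> r. ?m r) K (\<chi> r. ?y r) * ennreal ?W"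
    proof -
      have "1 - real (CARD('k) * DIM('a)) / 2 = - p" using p(2) by linarith
      then show ?thesis by (simp add: Lambda_op_def quad_def mult.assoc del: of_nat_mult)
    qed
    finally show "ennreal ?c * (\<integral>\<^sup>+z. ennreal (?U * (\<delta> + quad (\<lambda>r. d (?m r)) ?y z) powr (- p) * K' z) \<partial>lborel)
       \<le> Lambda_op d (\<chi> r. ?m r) K (\<chi> r. ?y r) * ennreal ?W" .
  qed
  finally show ?thesis .
qed

text \<open>The Jacobian from \<open>kernel_rescale\<close> completes
  \<open>m * \<phi> m powr p\<close> to \<open>weight\<close>. All tuples are brought under one
  integral with a common profile in \<open>w\<close>, so that a single use of Fatou's lemma can
  treat them together.\<close>

lemma source_rescaled:
  fixes K :: "'a ^ 'k::finite \<Rightarrow> real" and q :: "('i, 'a) config"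
  assumes \<delta>: "\<delta> > 0" and q: "q \<in> config_set" and K: "continuous_on UNIV K" "\<And>z. K z \<ge> 0"
    and supp: "\<And>z. z \<notin> cbox l u \<Longrightarrow> K z = 0"
    and p: "p > 0" "real (CARD('k) * DIM('a)) = 2 * p + 2" and C: "C \<ge> 0"
  shows "ennreal (C * (\<delta> * potential \<delta> p (p + 2) l u K q)) =
    (\<integral>\<^sup>+w. ennreal (\<Sum>t\<in>distinct_tuples q. C * (\<Prod>r\<in>UNIV. weight DIM('a) CARD('k) d \<phi> (mass q (t r))) *
       (1 + (norm w)\<^sup>2) powr (- (p + 2)) * K (\<chi> r. loc q (t r) + sqrt (\<delta> * d (mass q (t r))) *\<^sub>R (w $ r))) \<partial>lborel)"
proof -
  have p': "p = real (CARD('k) * DIM('a)) / 2 - 1" using p(2) by linarith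
  have Kb: "K \<in> borel_measurable borel" by (rule borel_measurable_continuous_onI[OF K(1)])
  note [measurable] = Kb
  have [measurable]: "(\<lambda>w :: 'a ^ 'k. \<chi> r. y r + s r *\<^sub>R (w $ r)) \<in> borel_measurable borel" for y :: "'k \<Rightarrow> 'a" and s
    by (intro borel_measurable_continuous_onI continuous_intros)
  have [measurable]: "(\<lambda>z :: 'a ^ 'k. z $ r) \<in> borel_measurable borel" for r
    by (intro borel_measurable_continuous_onI continuous_intros)
  let ?h = "\<lambda>(t :: 'k \<Rightarrow> 'i) (w :: 'a ^ 'k). C * (\<Prod>r\<in>UNIV. weight DIM('a) CARD('k) d \<phi> (mass q (t r))) *
       (1 + (norm w)\<^sup>2) powr (- (p + 2)) * K (\<chi> r. loc q (t r) + sqrt (\<delta> * d (mass q (t r))) *\<^sub>R (w $ r))"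
  have "ennreal (C * (\<delta> * potential \<delta> p (p + 2) l u K q)) = ennreal C * (ennreal \<delta> * ennreal (potential \<delta> p (p + 2) l u K q))"
    using C \<delta> by (simp add: ennreal_mult')
  also have "\<dots> = (\<Sum>t\<in>distinct_tuples q. ennreal C * (ennreal \<delta> * (\<integral>\<^sup>+z. ennreal ((\<Prod>r\<in>UNIV. mass q (t r) * \<phi> (mass q (t r)) powr p) *
       (\<delta> + quad (\<lambda>r. d (mass q (t r))) (\<lambda>r. loc q (t r)) z) powr (- (p + 2)) * K z) \<partial>lborel)))"
    by (subst nn_integral_potential[OF \<delta> q K]) (simp_all only: supp sum_distrib_left not_False_eq_True)
  also have "\<dots> = (\<Sum>t\<in>distinct_tuples q. \<integral>\<^sup>+w. ennreal (?h t w) \<partial>lborel)"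
  proof (rule sum.cong[OF refl])
    fix t :: "'k \<Rightarrow> 'i" assume t: "t \<in> distinct_tuples q"
    let ?m = "\<lambda>r. mass q (t r)" and ?y = "\<lambda>r. loc q (t r)"
    let ?W = "\<Prod>r\<in>UNIV. weight DIM('a) CARD('k) d \<phi> (?m r)" and ?U = "\<Prod>r\<in>UNIV. ?m r * \<phi> (?m r) powr p"
    let ?D = "\<Prod>r\<in>UNIV. d (?m r) powr (real DIM('a) / 2)"
    have m: "?m r > 0" "d (?m r) > 0" for r using tuple_mass_pos[OF q t] d_pos by auto
    have U: "?U \<ge> 0" using m by (intro prod_nonneg) (auto simp: less_imp_le)
    have UD: "?U * ?D = ?W"
      unfolding prod.distrib[symmetric] by (intro prod.cong refl) (simp only: weight_eq[OF p'])
    have "ennreal C * (ennreal \<delta> * (\<integral>\<^sup>+z. ennreal (?U * (\<delta> + quad (\<lambda>r. d (?m r)) ?y z) powr (- (p + 2)) * K z) \<partial>lborel))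
       = (\<integral>\<^sup>+z. ennreal (C * ?U) * ennreal (\<delta> * (\<delta> + quad (\<lambda>r. d (?m r)) ?y z) powr (- (p + 2)) * K z) \<partial>lborel)"
    proof -
      have "ennreal C * (ennreal \<delta> * (\<integral>\<^sup>+z. ennreal (?U * (\<delta> + quad (\<lambda>r. d (?m r)) ?y z) powr (- (p + 2)) * K z) \<partial>lborel))
        = (\<integral>\<^sup>+z. ennreal C * (ennreal \<delta> * ennreal (?U * (\<delta> + quad (\<lambda>r. d (?m r)) ?y z) powr (- (p + 2)) * K z)) \<partial>lborel)"
        by (subst nn_integral_cmult, (unfold quad_def, measurable)[1], subst nn_integral_cmult, (unfold quad_def, measurable)[1], rule refl)
      also have "\<dots> = (\<integral>\<^sup>+z. ennreal (C * ?U) * ennreal (\<delta> * (\<delta> + quad (\<lambda>r. d (?m r)) ?y z) powr (- (p + 2)) * K z) \<partial>lborel)"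
      proof (rule nn_integral_cong)
        fix z
        let ?k = "(\<delta> + quad (\<lambda>r. d (?m r)) ?y z) powr (- (p + 2))"
        have "C * (\<delta> * (?U * ?k * K z)) = (C * ?U) * (\<delta> * ?k * K z)" by (simp only: ac_simps)
        moreover have "C * ?U \<ge> 0" using C U by (rule mult_nonneg_nonneg)
        ultimately show "ennreal C * (ennreal \<delta> * ennreal (?U * ?k * K z)) = ennreal (C * ?U) * ennreal (\<delta> * ?k * K z)"
          using C \<delta> by (simp only: ennreal_mult'[symmetric] less_imp_le)
      qed
      finally show ?thesis .
    qed
    also have "\<dots> = ennreal (C * ?U) * (\<integral>\<^sup>+z. ennreal (\<delta> * (\<delta> + quad (\<lambda>r. d (?m r)) ?y z) powr (- (p + 2)) * K z) \<partial>lborel)"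
      by (rule nn_integral_cmult) (unfold quad_def, measurable)
    also have "\<dots> = ennreal (C * ?U) * (\<integral>\<^sup>+w. ennreal (?D * (1 + (norm w)\<^sup>2) powr (- (p + 2)) *
         K (\<chi> r. ?y r + sqrt (\<delta> * d (?m r)) *\<^sub>R (w $ r))) \<partial>lborel)"
      unfolding kernel_rescale[OF m(2) \<delta> Kb p(2)] by (rule refl)
    also have "\<dots> = (\<integral>\<^sup>+w. ennreal (C * ?U) * ennreal (?D * (1 + (norm w)\<^sup>2) powr (- (p + 2)) *
         K (\<chi> r. ?y r + sqrt (\<delta> * d (?m r)) *\<^sub>R (w $ r))) \<partial>lborel)"
      by (rule nn_integral_cmult[symmetric]) measurable
    also have "\<dots> = (\<integral>\<^sup>+w. ennreal (?h t w) \<partial>lborel)"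
    proof (rule nn_integral_cong)
      fix w :: "'a ^ 'k"
      let ?k = "(1 + (norm w)\<^sup>2) powr (- (p + 2))" and ?K = "K (\<chi> r. ?y r + sqrt (\<delta> * d (?m r)) *\<^sub>R (w $ r))"
      have "(C * ?U) * (?D * ?k * ?K) = C * (?U * ?D) * ?k * ?K" by (simp only: ac_simps)
      moreover have "C * ?U \<ge> 0" using C U by (rule mult_nonneg_nonneg)
      ultimately show "ennreal (C * ?U) * ennreal (?D * ?k * ?K) = ennreal (?h t w)"
        unfolding UD by (simp only: ennreal_mult'[symmetric])
    qed
    finally show "ennreal C * (ennreal \<delta> * (\<integral>\<^sup>+z. ennreal (?U * (\<delta> + quad (\<lambda>r. d (?m r)) ?y z) powr (- (p + 2)) * K z) \<partial>lborel)) = (\<integral>\<^sup>+w. ennreal (?h t w) \<partial>lborel)" .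
  qed
  also have "\<dots> = (\<integral>\<^sup>+w. (\<Sum>t\<in>distinct_tuples q. ennreal (?h t w)) \<partial>lborel)"
    by (rule nn_integral_sum[symmetric]) measurable
  also have "\<dots> = (\<integral>\<^sup>+w. ennreal (\<Sum>t\<in>distinct_tuples q. ?h t w) \<partial>lborel)"
  proof (rule nn_integral_cong, rule sum_ennreal)
    fix w and t :: "'k \<Rightarrow> 'i" assume t: "t \<in> distinct_tuples q"
    have "(\<Prod>r\<in>UNIV. weight DIM('a) CARD('k) d \<phi> (mass q (t r))) \<ge> 0"
      unfolding weight_def using tuple_mass_pos[OF q t] by (intro prod_nonneg) (auto simp: less_imp_le)
    then show "0 \<le> ?h t w" using C K(2) by (intro mult_nonneg_nonneg) auto
  qed
  finally show ?thesis .
qed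

text \<open>For fixed \<open>w\<close> the evaluation points tend to the locations of the tuple and
  the cutoffs to 1, although \<delta> and the box vary together. Fatou's lemma in \<open>w\<close>
  gives the lower bound, the profile having integral 1 after multiplication by \<open>?C\<close>.
  One inequality is enough, since this quantity is to be bounded from above by the limit.\<close>

lemma source_liminf:
  fixes K :: "'a ^ 'k::finite \<Rightarrow> real" and q :: "('i, 'a) config" and \<delta> :: "nat \<Rightarrow> real"
  assumes \<delta>: "\<And>n. \<delta> n > 0" "\<delta> \<longlonglongrightarrow> 0" and q: "q \<in> config_set" and K: "continuous_on UNIV K" "\<And>z. K z \<ge> 0"
    and p: "p > 0" "real (CARD('k) * DIM('a)) = 2 * p + 2"
  defines "S \<equiv> \<lambda>n. ennreal (c0 (CARD('k) * DIM('a)) * (4 * p * (p + 1)) * (\<delta> n * potential (\<delta> n) p (p + 2)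
     (- (real n *\<^sub>R One)) (real n *\<^sub>R One) (\<lambda>z. K z * cutoff n z) q))"
  shows "(\<Sum>t\<in>distinct_tuples q. ennreal (K (\<chi> r. loc q (t r)) * (\<Prod>r\<in>UNIV. weight DIM('a) CARD('k) d \<phi> (mass q (t r)))))
     \<le> liminf S"
proof -
  let ?C = "c0 (CARD('k) * DIM('a)) * (4 * p * (p + 1))"
  have C1: "?C * unit_ball_vol (real (CARD('k) * DIM('a))) = 1" by (rule c0_normalisation[OF p])
  have C: "?C \<ge> 0"
    using c0_nonneg[OF p] p(1) by simp
  let ?W = "\<lambda>t :: 'k \<Rightarrow> 'i. \<Prod>r\<in>UNIV. weight DIM('a) CARD('k) d \<phi> (mass q (t r))"
  let ?k = "\<lambda>w :: 'a ^ 'k. (1 + (norm w)\<^sup>2) powr (- (p + 2))"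
  let ?z = "\<lambda>(t :: 'k \<Rightarrow> 'i) n (w :: 'a ^ 'k). \<chi> r. loc q (t r) + sqrt (\<delta> n * d (mass q (t r))) *\<^sub>R (w $ r)"
  let ?h = "\<lambda>n (w :: 'a ^ 'k). \<Sum>t\<in>distinct_tuples q. ?C * ?W t * ?k w * (K (?z t n w) * cutoff n (?z t n w))"
  let ?G = "\<Sum>t\<in>distinct_tuples q. K (\<chi> r. loc q (t r)) * ?W t"
  have W: "?W t \<ge> 0" if "t \<in> distinct_tuples q" for t :: "'k \<Rightarrow> 'i"
    unfolding weight_def using tuple_mass_pos[OF q that] by (intro prod_nonneg) (auto simp: less_imp_le)
  have G0: "?G \<ge> 0" using W K(2) by (intro sum_nonneg mult_nonneg_nonneg) auto
  have Kc: "continuous_on UNIV (\<lambda>z. K z * cutoff n z)" for n by (intro continuous_intros K continuous_on_cutoff)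
  have S: "S n = (\<integral>\<^sup>+w. ennreal (?h n w) \<partial>lborel)" for n
    unfolding S_def
    by (rule source_rescaled[OF \<delta>(1) q Kc _ _ p C]) (auto simp: K(2) cutoff_bounds cutoff_outside_box)
  have lim: "(\<lambda>n. ?h n w) \<longlonglongrightarrow> ?C * ?k w * ?G" for w
  proof -
    have z: "(\<lambda>n. ?z t n w) \<longlonglongrightarrow> (\<chi> r. loc q (t r))" for t :: "'k \<Rightarrow> 'i"
    proof (rule vec_tendstoI)
      fix r
      have "(\<lambda>n. loc q (t r) + sqrt (\<delta> n * d (mass q (t r))) *\<^sub>R (w $ r)) \<longlonglongrightarrow> loc q (t r) + sqrt (0 * d (mass q (t r))) *\<^sub>R (w $ r)"
        by (intro tendsto_intros \<delta>(2))
      then show "(\<lambda>n. ?z t n w $ r) \<longlonglongrightarrow> (\<chi> r. loc q (t r)) $ r" by simp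
    qed
    have Kz: "(\<lambda>n. K (?z t n w)) \<longlonglongrightarrow> K (\<chi> r. loc q (t r))" for t :: "'k \<Rightarrow> 'i"
      by (rule continuous_on_tendsto_compose[OF K(1) z]) auto
    have ct: "(\<lambda>n. cutoff n (?z t n w)) \<longlonglongrightarrow> 1" for t :: "'k \<Rightarrow> 'i"
      by (rule cutoff_tendsto[OF z])
    have "(\<lambda>n. ?h n w) \<longlonglongrightarrow> (\<Sum>t\<in>distinct_tuples q. ?C * ?W t * ?k w * (K (\<chi> r. loc q (t r)) * 1))"
      by (intro tendsto_sum tendsto_mult tendsto_const Kz ct)
    then show ?thesis by (simp add: sum_distrib_left ac_simps)
  qed
  have [measurable]: "(\<lambda>w. ennreal (?h n w)) \<in> borel_measurable lborel" for n
  proof -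
    have [measurable]: "K \<in> borel_measurable borel" "cutoff n \<in> borel_measurable (borel :: ('a ^ 'k) measure)"
      by (intro borel_measurable_continuous_onI K(1) continuous_on_cutoff)+
    have [measurable]: "(\<lambda>w :: 'a ^ 'k. \<chi> r. y r + s r *\<^sub>R (w $ r)) \<in> borel_measurable borel" for y :: "'k \<Rightarrow> 'a" and s
      by (intro borel_measurable_continuous_onI continuous_intros)
    show ?thesis by measurable
  qed
  have "(\<Sum>t\<in>distinct_tuples q. ennreal (K (\<chi> r. loc q (t r)) * ?W t)) = ennreal ?G"
    using W K(2) by (intro sum_ennreal) auto
  \<comment> \<open>A factor 1, by \<open>C1\<close>, is inserted so that the target becomes an
    integral of the profile.\<close>
  also have "\<dots> = ennreal (?C * ?G) * ennreal (unit_ball_vol (real (CARD('k) * DIM('a))))"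
  proof -
    have "(?C * ?G) * unit_ball_vol (real (CARD('k) * DIM('a))) = (?C * unit_ball_vol (real (CARD('k) * DIM('a)))) * ?G"
      by (simp only: ac_simps)
    also have "\<dots> = ?G" unfolding C1 by simp
    finally have "ennreal ?G = ennreal ((?C * ?G) * unit_ball_vol (real (CARD('k) * DIM('a))))"
      by (rule arg_cong[OF sym])
    also have "\<dots> = ennreal (?C * ?G) * ennreal (unit_ball_vol (real (CARD('k) * DIM('a))))"
      by (rule ennreal_mult'', rule unit_ball_vol_nonneg) simp
    finally show ?thesis .
  qed
  also have "\<dots> = ennreal (?C * ?G) * (\<integral>\<^sup>+w. ennreal (?k w) \<partial>lborel)"
  proof -
    have e1: "real DIM('a ^ 'k) = real (CARD('k) * DIM('a))" by (simp only: DIM_cart)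
    then have e2: "real DIM('a ^ 'k) / 2 + 1 = p + 2" using p(2) by linarith
    have "(\<integral>\<^sup>+w. ennreal (?k w) \<partial>lborel) = ennreal (unit_ball_vol (real (CARD('k) * DIM('a))))"
      using nn_integral_radial[where 'b="'a ^ 'k"] unfolding e2 unfolding e1 .
    then show ?thesis by (rule arg_cong[OF sym])
  qed
  also have "\<dots> = (\<integral>\<^sup>+w. ennreal (?C * ?G) * ennreal (?k w) \<partial>lborel)"
    by (rule nn_integral_cmult[symmetric]) measurable
  also have "\<dots> = (\<integral>\<^sup>+w. liminf (\<lambda>n. ennreal (?h n w)) \<partial>lborel)"
  proof (rule nn_integral_cong)
    fix w
    have "(\<lambda>n. ennreal (?h n w)) \<longlonglongrightarrow> ennreal (?C * ?k w * ?G)"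
      by (intro tendsto_ennrealI lim)
    then have "liminf (\<lambda>n. ennreal (?h n w)) = ennreal (?C * ?k w * ?G)"
      by (intro lim_imp_Liminf) auto
    also have "\<dots> = ennreal (?C * ?G) * ennreal (?k w)"
    proof -
      have "?C * ?k w * ?G = (?C * ?G) * ?k w" by (simp only: ac_simps)
      then show ?thesis by (simp only: ennreal_mult''[OF powr_ge_zero])
    qed
    finally show "ennreal (?C * ?G) * ennreal (?k w) = liminf (\<lambda>n. ennreal (?h n w))" by simp
  qed
  also have "\<dots> \<le> liminf S"
    unfolding S by (rule nn_integral_liminf) measurable
  finally show ?thesis .
qed

end

section \<open>Passage to the limit in time and expectation\<close>

context coagulation_coefficients
begin

text \<open>A single index \<open>n\<close> drives all approximations: \<delta> is
  \<open>1 / Suc n\<close>, the box and the cutoff have size \<open>n\<close>, the start lies in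
  \<open>stable n\<close> and time is at most \<open>n\<close>. The right-hand side bounds every
  approximation, so Fatou's lemma, in time and then in probability, gives the claim.\<close>

lemma moment_bound:
  fixes K :: "'a ^ 'k::finite \<Rightarrow> real" and p :: real
  assumes P: "transition_semigroup configs P" and G: "has_generator_on configs P L (test_functions L)"
    and X: "markov_process M configs P X"
    and p: "p > 0" "real (CARD('k) * DIM('a)) = 2 * p + 2"
    and K: "continuous_on UNIV K" "\<And>z. K z \<ge> 0"
  shows "(\<integral>\<^sup>+\<omega>. (\<integral>\<^sup>+t\<in>{0..}. (\<Sum>i\<in>(distinct_tuples (X t \<omega>) :: ('k \<Rightarrow> 'i) set).
            ennreal (K (\<chi> r. loc (X t \<omega>) (i r)) * (\<Prod>r\<in>UNIV. weight DIM('a) CARD('k) d \<phi> (mass (X t \<omega>) (i r)))))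
           \<partial>lborel) \<partial>M)
    \<le> (\<integral>\<^sup>+\<omega>. (\<Sum>i\<in>(distinct_tuples (X 0 \<omega>) :: ('k \<Rightarrow> 'i) set).
            Lambda_op d (\<chi> r. mass (X 0 \<omega>) (i r)) K (\<chi> r. loc (X 0 \<omega>) (i r)) *
            ennreal (\<Prod>r\<in>UNIV. weight DIM('a) CARD('k) d \<phi> (mass (X 0 \<omega>) (i r)))) \<partial>M)"
    (is "(\<integral>\<^sup>+\<omega>. (\<integral>\<^sup>+t\<in>{0..}. ?G (X t \<omega>) \<partial>lborel) \<partial>M) \<le> (\<integral>\<^sup>+\<omega>. ?R (X 0 \<omega>) \<partial>M)")
proof -
  interpret prob_space M using X by (simp add: markov_process_def)
  interpret pair_sigma_finite lborel M by unfold_locales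
  note Xm = markov_process_measurable[OF X]
  have Xs: "X t \<omega> \<in> config_set" if "t \<ge> 0" "\<omega> \<in> space M" for t \<omega>
    using measurable_space[OF Xm[OF that(1)] that(2)] by simp
  define c where "c = c0 (CARD('k) * DIM('a))"
  have c: "c \<ge> 0" unfolding c_def by (rule c0_nonneg[OF p])
  define \<delta> where "\<delta> n = 1 / real (Suc n)" for n
  have \<delta>: "\<delta> n > 0" "\<delta> \<longlonglongrightarrow> 0" for n
    unfolding \<delta>_def using LIMSEQ_Suc[OF lim_const_over_n[of "1::real"]] by simp_all
  define K' where "K' n z = K z * cutoff n z" for n z
  have K': "continuous_on UNIV (K' n)" "\<And>z. K' n z \<ge> 0" "\<And>z. K' n z \<le> K z" for n
    unfolding K'_def
  proof -
    show "continuous_on UNIV (\<lambda>z. K z * cutoff n z)" by (intro continuous_on_mult K(1) continuous_on_cutoff)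
    show "K z * cutoff n z \<ge> 0" for z by (intro mult_nonneg_nonneg K(2) cutoff_bounds)
    show "K z * cutoff n z \<le> K z" for z by (intro mult_right_le_one_le K(2) cutoff_bounds)
  qed
  define l where "l n = - (real n *\<^sub>R (One :: 'a ^ 'k))" for n
  define u where "u n = real n *\<^sub>R (One :: 'a ^ 'k)" for n
  have supp: "K' n z = 0" if "z \<notin> cbox (l n) (u n)" for n z
    using cutoff_outside_box[of z n] that by (simp add: K'_def l_def u_def)
  define B where "B n = X 0 -` stable n \<inter> space M" for n
  have B: "B n \<in> sets M" for n unfolding B_def by (rule measurable_sets[OF Xm]) auto
  define S where "S n x = ennreal (c * (4 * p * (p + 1) * \<delta> n * potential (\<delta> n) p (p + 2) (l n) (u n) (K' n) x))" for n x
  have Sm: "S n \<in> borel_measurable configs" for n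
    unfolding S_def using potential_measurable[OF \<delta>(1) K'(1)] by measurable
  \<comment> \<open>The truncated integrand on the whole product space; the time indicator removes
    the artificial values that \<open>max 0 t\<close> creates at negative times.\<close>
  define \<Psi> where "\<Psi> n t \<omega> = indicator {0..real n} t * (indicator (B n) \<omega> * S n (X (max 0 t) \<omega>))" for n t \<omega>
  have pair_m: "(\<lambda>(t, \<omega>). indicator {0..real n} t * (indicator (B n) \<omega> * f (X (max 0 t) \<omega>))) \<in> borel_measurable (lborel \<Otimes>\<^sub>M M)"
    if f: "f \<in> borel_measurable configs" for n and f :: "('i, 'a) config \<Rightarrow> ennreal"
  proof -
    have "sets (lborel \<Otimes>\<^sub>M M) = sets (borel \<Otimes>\<^sub>M M)" by (intro sets_pair_measure_cong) auto
    note cong = measurable_cong_sets[OF this refl]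
    have "(\<lambda>w. f (case_prod (\<lambda>t \<omega>. X (max 0 t) \<omega>) w)) \<in> borel_measurable (borel \<Otimes>\<^sub>M M)"
      by (rule measurable_compose[OF markov_process_measurable_pair[OF X] f])
    then have 1: "(\<lambda>w. f (X (max 0 (fst w)) (snd w))) \<in> borel_measurable (lborel \<Otimes>\<^sub>M M)"
      unfolding cong by (simp add: case_prod_unfold)
    have 2: "(\<lambda>w. indicator {0..real n} (fst w) :: ennreal) \<in> borel_measurable (lborel \<Otimes>\<^sub>M M)"
      by (rule measurable_compose[OF measurable_fst]) simp
    have 3: "(\<lambda>w. indicator (B n) (snd w) :: ennreal) \<in> borel_measurable (lborel \<Otimes>\<^sub>M M)"
      by (rule measurable_compose[OF measurable_snd borel_measurable_indicator[OF B]])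
    show ?thesis
      unfolding case_prod_unfold by (intro borel_measurable_times_ennreal 1 2 3)
  qed
  have \<Psi>m: "case_prod (\<Psi> n) \<in> borel_measurable (lborel \<Otimes>\<^sub>M M)" for n
    unfolding \<Psi>_def by (rule pair_m[OF Sm])
  have bound: "(\<integral>\<^sup>+\<omega>. (\<integral>\<^sup>+t. \<Psi> n t \<omega> \<partial>lborel) \<partial>M) \<le> (\<integral>\<^sup>+\<omega>. ?R (X 0 \<omega>) \<partial>M)" for n
  proof -
    let ?V = "\<lambda>x. ennreal (4 * p * (p + 1) * \<delta> n * potential (\<delta> n) p (p + 2) (l n) (u n) (K' n) x)"
    have Vm: "?V \<in> borel_measurable configs" using potential_measurable[OF \<delta>(1) K'(1)] by measurable
    have inner: "(\<integral>\<^sup>+\<omega>. \<Psi> n t \<omega> \<partial>M) = ennreal c * ((\<integral>\<^sup>+\<omega>. indicator (B n) \<omega> * ?V (X t \<omega>) \<partial>M) * indicator {0..real n} t)" for t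
    proof (cases "t \<in> {0..real n}")
      case True
      have "(\<lambda>\<omega>. ?V (X t \<omega>)) \<in> borel_measurable M"
        by (rule measurable_compose[OF Xm Vm]) (use True in simp)
      then have "(\<integral>\<^sup>+\<omega>. ennreal c * (indicator (B n) \<omega> * ?V (X t \<omega>)) \<partial>M) = ennreal c * (\<integral>\<^sup>+\<omega>. indicator (B n) \<omega> * ?V (X t \<omega>) \<partial>M)"
        using B by (intro nn_integral_cmult borel_measurable_times_ennreal) auto
      moreover have "\<Psi> n t \<omega> = ennreal c * (indicator (B n) \<omega> * ?V (X t \<omega>))" for \<omega>
        using True c unfolding \<Psi>_def S_def by (simp add: max_def indicator_def ennreal_mult')
      ultimately show ?thesis using True by simp
    next
      case False
      then have "\<Psi> n t \<omega> = 0" for \<omega> unfolding \<Psi>_def by simp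
      then show ?thesis using False by simp
    qed
    \<comment> \<open>The source estimate has the time integral outside, the claim has the
      expectation outside.\<close>
    have "(\<integral>\<^sup>+\<omega>. (\<integral>\<^sup>+t. \<Psi> n t \<omega> \<partial>lborel) \<partial>M) = (\<integral>\<^sup>+t. (\<integral>\<^sup>+\<omega>. \<Psi> n t \<omega> \<partial>M) \<partial>lborel)"
      by (rule Fubini'[OF \<Psi>m])
    also have "\<dots> = (\<integral>\<^sup>+t. ennreal c * ((\<integral>\<^sup>+\<omega>. indicator (B n) \<omega> * ?V (X t \<omega>) \<partial>M) * indicator {0..real n} t) \<partial>lborel)"
      unfolding inner by (rule refl)
    also have "\<dots> = ennreal c * (\<integral>\<^sup>+t\<in>{0..real n}. (\<integral>\<^sup>+\<omega>. indicator (B n) \<omega> * ?V (X t \<omega>) \<partial>M) \<partial>lborel)"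
    proof (rule nn_integral_cmult)
      have "(\<lambda>t. \<integral>\<^sup>+\<omega>. indicator {0..real n} t * (indicator (B n) \<omega> * ?V (X (max 0 t) \<omega>)) \<partial>M) \<in> borel_measurable lborel"
        by (rule sigma_finite_measure.borel_measurable_nn_integral[OF prob_space_imp_sigma_finite[OF prob_space_axioms] pair_m[OF Vm]])
      also have "(\<lambda>t. \<integral>\<^sup>+\<omega>. indicator {0..real n} t * (indicator (B n) \<omega> * ?V (X (max 0 t) \<omega>)) \<partial>M)
        = (\<lambda>t. (\<integral>\<^sup>+\<omega>. indicator (B n) \<omega> * ?V (X t \<omega>) \<partial>M) * indicator {0..real n} t)"
        by (rule ext) (simp add: indicator_def max_def)
      finally show "(\<lambda>t. (\<integral>\<^sup>+\<omega>. indicator (B n) \<omega> * ?V (X t \<omega>) \<partial>M) * indicator {0..real n} t) \<in> borel_measurable lborel" .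
    qed
    also have "\<dots> \<le> ennreal c * (\<integral>\<^sup>+\<omega>. indicator (B n) \<omega> * ennreal (potential (\<delta> n) p p (l n) (u n) (K' n) (X 0 \<omega>)) \<partial>M)"
      unfolding B_def by (intro mult_left_mono source_estimate[OF P G X \<delta>(1) _ p(2) K'(1,2)]) (use p(1) in auto)
    also have "\<dots> = (\<integral>\<^sup>+\<omega>. ennreal c * (indicator (B n) \<omega> * ennreal (potential (\<delta> n) p p (l n) (u n) (K' n) (X 0 \<omega>))) \<partial>M)"
    proof (rule nn_integral_cmult[symmetric])
      have "(\<lambda>\<omega>. potential (\<delta> n) p p (l n) (u n) (K' n) (X 0 \<omega>)) \<in> borel_measurable M"
        by (rule measurable_compose[OF Xm potential_measurable[OF \<delta>(1) K'(1)]]) simp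
      then show "(\<lambda>\<omega>. indicator (B n) \<omega> * ennreal (potential (\<delta> n) p p (l n) (u n) (K' n) (X 0 \<omega>))) \<in> borel_measurable M"
        using B by (intro borel_measurable_times_ennreal) auto
    qed
    also have "\<dots> \<le> (\<integral>\<^sup>+\<omega>. ?R (X 0 \<omega>) \<partial>M)"
    proof (rule nn_integral_mono)
      fix \<omega> assume "\<omega> \<in> space M"
      then have x: "X 0 \<omega> \<in> config_set" by (intro Xs) auto
      have "ennreal c * (indicator (B n) \<omega> * ennreal (potential (\<delta> n) p p (l n) (u n) (K' n) (X 0 \<omega>)))
         \<le> ennreal c * ennreal (potential (\<delta> n) p p (l n) (u n) (K' n) (X 0 \<omega>))"
        by (intro mult_left_mono) (auto simp: indicator_def)
      also have "\<dots> = ennreal (c * potential (\<delta> n) p p (l n) (u n) (K' n) (X 0 \<omega>))"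
        by (rule ennreal_mult'[OF c, symmetric])
      also have "\<dots> \<le> ?R (X 0 \<omega>)"
        unfolding c_def by (rule potential_le_Lambda[OF \<delta>(1) x K(1) K' supp p])
      finally show "ennreal c * (indicator (B n) \<omega> * ennreal (potential (\<delta> n) p p (l n) (u n) (K' n) (X 0 \<omega>))) \<le> ?R (X 0 \<omega>)" .
    qed
    finally show ?thesis .
  qed
  have pointwise: "?G (X t \<omega>) * indicator {0..} t \<le> liminf (\<lambda>n. \<Psi> n t \<omega>)" if \<omega>: "\<omega> \<in> space M" for t \<omega>
  proof (cases "t \<ge> 0")
    case True
    have "?G (X t \<omega>) \<le> liminf (\<lambda>n. S n (X t \<omega>))"
    proof -
      have "S n x = ennreal (c0 (CARD('k) * DIM('a)) * (4 * p * (p + 1)) * (\<delta> n * potential (\<delta> n) p (p + 2)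
         (- (real n *\<^sub>R One)) (real n *\<^sub>R One) (\<lambda>z. K z * cutoff n z) x))" for n x
        unfolding S_def c_def l_def u_def K'_def by (simp only: mult.assoc)
      then show ?thesis
        using source_liminf[OF \<delta> Xs[OF True \<omega>] K p] by (simp only:)
    qed
    also have "\<dots> \<le> liminf (\<lambda>n. \<Psi> n t \<omega>)"
    proof (rule Liminf_mono)
      \<comment> \<open>For a fixed outcome and time, the truncations of the initial state and of
        time are eventually inactive.\<close>
      have "eventually (\<lambda>n. X 0 \<omega> \<in> stable n) sequentially"
        by (rule eventually_stable) (rule Xs[OF order_refl \<omega>])
      moreover have "eventually (\<lambda>n. t \<le> real n) sequentially"
        using filterlim_real_sequentially by (simp add: filterlim_at_top)
      ultimately show "eventually (\<lambda>n. S n (X t \<omega>) \<le> \<Psi> n t \<omega>) sequentially"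
        by eventually_elim (use True \<omega> in \<open>simp add: \<Psi>_def B_def max_def\<close>)
    qed
    finally show ?thesis using True by simp
  qed simp
  have "(\<integral>\<^sup>+\<omega>. (\<integral>\<^sup>+t\<in>{0..}. ?G (X t \<omega>) \<partial>lborel) \<partial>M) \<le> (\<integral>\<^sup>+\<omega>. (\<integral>\<^sup>+t. liminf (\<lambda>n. \<Psi> n t \<omega>) \<partial>lborel) \<partial>M)"
    by (intro nn_integral_mono pointwise)
  also have "\<dots> \<le> (\<integral>\<^sup>+\<omega>. liminf (\<lambda>n. \<integral>\<^sup>+t. \<Psi> n t \<omega> \<partial>lborel) \<partial>M)"
  proof (intro nn_integral_mono nn_integral_liminf)
    fix n \<omega> assume "\<omega> \<in> space M"
    then show "(\<lambda>t. \<Psi> n t \<omega>) \<in> borel_measurable lborel"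
      using measurable_compose[OF measurable_Pair2' \<Psi>m] by simp
  qed
  also have "\<dots> \<le> liminf (\<lambda>n. \<integral>\<^sup>+\<omega>. (\<integral>\<^sup>+t. \<Psi> n t \<omega> \<partial>lborel) \<partial>M)"
  proof (rule nn_integral_liminf)
    fix n
    have "(\<lambda>(\<omega>, t). \<Psi> n t \<omega>) \<in> borel_measurable (M \<Otimes>\<^sub>M lborel)"
      using measurable_compose[OF measurable_pair_swap' \<Psi>m] by (simp add: case_prod_unfold)
    then show "(\<lambda>\<omega>. \<integral>\<^sup>+t. \<Psi> n t \<omega> \<partial>lborel) \<in> borel_measurable M"
      by (rule lborel.borel_measurable_nn_integral)
  qed
  also have "\<dots> \<le> (\<integral>\<^sup>+\<omega>. ?R (X 0 \<omega>) \<partial>M)"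
    using Liminf_mono[of "\<lambda>n. \<integral>\<^sup>+\<omega>. (\<integral>\<^sup>+t. \<Psi> n t \<omega> \<partial>lborel) \<partial>M" "\<lambda>_. \<integral>\<^sup>+\<omega>. ?R (X 0 \<omega>) \<partial>M" sequentially] bound
    by (simp add: Liminf_const)
  finally show ?thesis .
qed

end

theorem theorem3p1:
  fixes fresh :: "'i::countable set \<Rightarrow> 'i"
    and lab :: "nat \<Rightarrow> 'i set"
    and V :: "'a::euclidean_space \<Rightarrow> real"
    and h :: "'a \<Rightarrow> real \<Rightarrow> real"
    and d \<phi> :: "real \<Rightarrow> real"
    and \<alpha> :: "real \<Rightarrow> real \<Rightarrow> real"
    and \<nu> :: "nat \<Rightarrow> nat pmf"
    and Z \<epsilon> :: real
    and N :: nat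
    and M :: "'w measure"
    and q :: "real \<Rightarrow> 'w \<Rightarrow> ('i, 'a) config"
    and K :: "'a ^ 'k::finite \<Rightarrow> real"
  assumes dim: "DIM('a) \<ge> 3"
    and V: "interaction_potential V"
    and h: "initial_density h Z"
    and A: "hypothesis_A DIM('a) d \<phi> \<alpha>"
    and fresh: "\<And>J. finite J \<Longrightarrow> fresh J \<notin> J"
    and lab: "\<And>n. finite (lab n) \<and> card (lab n) = n"
    and number: "deterministic_number \<nu> \<or> random_number \<nu>"
    and N: "N \<ge> 1"
    and eps: "\<epsilon> > 0" "real N = \<epsilon> powr (2 - real DIM('a)) * Z"
    and process: "coagulation_process fresh \<epsilon> d V \<alpha> M q"
    and initial: "distr M configs (q 0) = initial_law lab h Z (\<nu> N)"
    and K: "\<And>z. K z \<ge> 0" "bounded (range K)" "continuous_on UNIV K"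
  shows "(\<integral>\<^sup>+\<omega>. (\<integral>\<^sup>+t\<in>{0..}.
             (\<Sum>i\<in>(distinct_tuples (q t \<omega>) :: ('k \<Rightarrow> 'i) set).
                ennreal (K (\<chi> r. loc (q t \<omega>) (i r)) *
                  (\<Prod>r\<in>UNIV. weight DIM('a) CARD('k) d \<phi> (mass (q t \<omega>) (i r)))))
           \<partial>lborel) \<partial>M)
       \<le> (\<integral>\<^sup>+\<omega>.
             (\<Sum>i\<in>(distinct_tuples (q 0 \<omega>) :: ('k \<Rightarrow> 'i) set).
                Lambda_op d (\<chi> r. mass (q 0 \<omega>) (i r)) K (\<chi> r. loc (q 0 \<omega>) (i r)) *
                ennreal (\<Prod>r\<in>UNIV. weight DIM('a) CARD('k) d \<phi> (mass (q 0 \<omega>) (i r))))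
           \<partial>M)"
proof -
  from process obtain P where P: "transition_semigroup configs P"
    and G: "has_generator_on configs P (generator fresh \<epsilon> d V \<alpha>) (test_functions (generator fresh \<epsilon> d V \<alpha>))"
    and X: "markov_process M configs P q"
    unfolding coagulation_process_def by (elim exE conjE)
  from interaction_potential_bounded[OF V] obtain V_max where V_max: "\<forall>x. V x \<le> V_max" ..
  note A' = A[unfolded hypothesis_A_def]
  have \<alpha>: "\<forall>n>0. \<forall>m>0. \<alpha> n m > 0 \<and> \<alpha> n m = \<alpha> m n" using A' by (elim conjE)
  have "bounded ((\<lambda>(n, m). \<alpha> n m) ` ({0<..} \<times> {0<..}))" using A' by (elim conjE)
  then obtain \<alpha>_max where \<alpha>_max: "\<forall>x\<in>(\<lambda>(n, m). \<alpha> n m) ` ({0<..} \<times> {0<..}). norm x \<le> \<alpha>_max"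
    unfolding bounded_iff ..
  have "\<exists>c>0. \<forall>m>0. \<phi> m \<ge> c" using A' by (elim conjE)
  then have \<phi>: "\<phi> m > 0" if "m > 0" for m using that by force
  interpret coagulation_coefficients fresh \<epsilon> d V \<alpha> \<phi> V_max \<alpha>_max
  proof
    show "0 \<le> V x" for x using V unfolding interaction_potential_def by (elim conjE) (rule spec)
    show "0 \<le> \<alpha> m m'" if "0 < m" "0 < m'" for m m' using \<alpha> that by (simp add: less_imp_le)
    show "\<alpha> m m' \<le> \<alpha>_max" if "0 < m" "0 < m'" for m m'
    proof -
      have "norm (\<alpha> m m') \<le> \<alpha>_max" by (rule bspec[OF \<alpha>_max]) (use that in \<open>auto intro!: image_eqI[of _ _ "(m, m')"]\<close>)
      then show ?thesis by simp
    qed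
    show "0 < d m" if "0 < m" for m using A' that by (elim conjE) simp
    show "continuous_on {0<..} d" using A' by (elim conjE)
    show "continuous_on {0<..} \<phi>" using A' by (elim conjE)
    show "antimono_on {0<..} \<phi>" using A' by (elim conjE)
    show "antimono_on {0<..} (\<lambda>m. \<phi> m * d m)" using A' by (elim conjE)
  qed (use fresh V_max \<phi> in auto)
  define p where "p = real (CARD('k) * DIM('a)) / 2 - 1"
  \<comment> \<open>Dimension at least 3 gives \<open>kd \<ge> 3\<close>, hence
    \<open>p \<ge> 1/2\<close>; positivity of \<open>p\<close> makes the kernel decreasing and
    \<open>c0\<close> nonnegative.\<close>
  have "DIM('a) \<le> CARD('k) * DIM('a)" by (simp add: Suc_le_eq)
  with dim have "3 \<le> CARD('k) * DIM('a)" by (rule order_trans)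
  then have "real 3 \<le> real (CARD('k) * DIM('a))" by (rule of_nat_mono)
  then have "p > 0" unfolding p_def by (simp del: of_nat_mult)
  moreover have "x = 2 * (x / 2 - 1) + 2" for x :: real by simp
  then have "real (CARD('k) * DIM('a)) = 2 * p + 2" unfolding p_def .
  ultimately show ?thesis by (rule moment_bound[OF P G X _ _ K(3,1)])
qed

end
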